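(* Let $G$ be a nilpotent subgroup of $\mathrm{Homeo}(\mathbb{T}^2)$. Then there exists a finite index normal subgroup $H$ of $G$ (of index $1$, $2$, $3$, $4$, $6$ or $8$) containing $G_0$ such that $$\{\rho_\mu(\tilde\phi)\ ;\ \mu\in\mathcal{P}(\phi)\}=\{\rho_\nu(\tilde\phi)\ ;\ \nu\in\mathcal{P}(H)\}$$ for any lift $\tilde\phi$ of every $\phi\in G_0$. In particular $\mathcal{I}_G=\mathcal{I}_H=H_{\mathcal{I}}$. Moreover $\mathcal{I}_G$ is a normal subgroup of $G$.
   Context: $\mathbb{T}^2=\mathbb{R}^2/\mathbb{Z}^2$. For a subgroup $L\subset\mathrm{Homeo}(\mathbb{T}^2)$, $L_0$ is the subgroup of elements of $L$ isotopic to the identity. $\mathcal{P}(\phi)$ is the set of $\phi$-invariant Borel probability measures on $\mathbb{T}^2$ and $\mathcal{P}(L)=\bigcap_{\psi\in L}\mathcal{P}(\psi)$. "Lift" means lift to the universal covering $\mathbb{R}^2$. For $\phi$ isotopic to the identity with lift $\tilde\phi$ and $\mu\in\mathcal{P}(\phi)$, $\rho_\mu(\tilde\phi):=\int_{\mathbb{T}^2}(\tilde\phi-\mathrm{Id})\,d\mu\in\mathbb{R}^2$ (note $\tilde\phi-\mathrm{Id}$ is well defined on $\mathbb{T}^2$). $\mathcal{I}_L:=\{\phi\in L_0 : \exists\text{ a lift }\tilde\phi\text{ of }\phi\text{ with }\rho_\mu(\tilde\phi)=(0,0)\text{ for all }\mu\in\mathcal{P}(\phi)\}$. $L_{\mathcal{I}}:=\{\phi\in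 L_0 : \exists\text{ a lift }\tilde\phi\text{ of }\phi\text{ with }\rho_\mu(\tilde\phi)=(0,0)\text{ for all }\mu\in\mathcal{P}(L)\}$. *)

theory Defs
  imports "HOL-Probability.Probability" "HOL-Algebra.Coset" "HOL-Algebra.Generated_Groups"
begin

section \<open>The torus as the quotient of the plane by the integer lattice\<close>

definition int_lattice :: "(real^2) set" where
  "int_lattice = {v. \<forall>i. v $ i \<in> \<int>}"

lemma int_lattice_zero: "0 \<in> int_lattice"
  by (simp add: int_lattice_def)

lemma int_lattice_uminus: "v \<in> int_lattice \<Longrightarrow> - v \<in> int_lattice"
  by (simp add: int_lattice_def)

lemma int_lattice_add: "v \<in> int_lattice \<Longrightarrow> w \<in> int_lattice \<Longrightarrow> v + w \<in> int_lattice"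
  by (simp add: int_lattice_def)

definition lattice_rel :: "real^2 \<Rightarrow> real^2 \<Rightarrow> bool" where
  "lattice_rel x y \<longleftrightarrow> x - y \<in> int_lattice"

lemma equivp_lattice_rel: "equivp lattice_rel"
proof (rule equivpI)
  show "reflp lattice_rel"
    by (simp add: reflp_def lattice_rel_def int_lattice_zero)
  show "symp lattice_rel"
    by (metis int_lattice_uminus lattice_rel_def minus_diff_eq sympI)
  show "transp lattice_rel"
  proof (rule transpI)
    fix x y z assume "lattice_rel x y" "lattice_rel y z"
    then have "(x - y) + (y - z) \<in> int_lattice"
      unfolding lattice_rel_def by (rule int_lattice_add)
    then show "lattice_rel x z" by (simp add: lattice_rel_def)
  qed
qed

quotient_type torus = "real^2" / lattice_rel
  by (rule equivp_lattice_rel)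

abbreviation proj_torus :: "real^2 \<Rightarrow> torus" where
  "proj_torus \<equiv> abs_torus"

lemma proj_torus_eq_iff: "proj_torus x = proj_torus y \<longleftrightarrow> x - y \<in> int_lattice"
  using torus.abs_eq_iff[of x y] by (simp add: lattice_rel_def)

lemma proj_rep_torus [simp]: "proj_torus (rep_torus p) = p"
  by (rule Quotient3_abs_rep[OF Quotient3_torus])

text \<open>The quotient topology.\<close>

instantiation torus :: topological_space
begin

definition open_torus :: "torus set \<Rightarrow> bool" where
  "open_torus U \<longleftrightarrow> open (proj_torus -` U)"

instance
  by standard (auto simp: open_torus_def vimage_Union open_Int)

end

lemma quotient_map_proj_torus: "quotient_map euclidean euclidean proj_torus"
  unfolding quotient_map_def
proof (intro conjI allI impI)
  show "proj_torus ` topspace euclidean = topspace euclidean"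
    by (auto intro!: image_eqI[where x = "rep_torus _"])
qed (simp add: open_torus_def vimage_def)

section \<open>Homeomorphisms\<close>

definition Homeo_torus :: "(torus \<Rightarrow> torus) monoid" where
  "Homeo_torus =
     \<lparr>carrier = {f. homeomorphic_map euclidean euclidean f}, mult = (\<circ>), one = id\<rparr>"

lemma group_Homeo_torus: "group Homeo_torus"
proof (rule groupI)
  fix f assume "f \<in> carrier Homeo_torus"
  then obtain g where "homeomorphic_maps euclidean euclidean f g"
    by (auto simp: Homeo_torus_def homeomorphic_map_maps)
  then have "homeomorphic_maps euclidean euclidean g f" "g \<circ> f = id"
    by (auto simp: homeomorphic_maps_def fun_eq_iff)
  then show "\<exists>g\<in>carrier Homeo_torus. g \<otimes>\<^bsub>Homeo_torus\<^esub> f = \<one>\<^bsub>Homeo_torus\<^esub>"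
    by (auto simp: Homeo_torus_def homeomorphic_map_maps)
qed (auto simp: Homeo_torus_def comp_assoc
       intro: homeomorphic_map_compose homeomorphic_map_id[THEN iffD2])

definition isotopic_to_id :: "(torus \<Rightarrow> torus) \<Rightarrow> bool" where
  "isotopic_to_id f \<longleftrightarrow>
     homotopic_with (homeomorphic_map euclidean euclidean) euclidean euclidean id f"

text \<open>The subgroup \<open>L\<^sub>0\<close> of elements of \<open>L\<close> isotopic to the identity.\<close>

definition isotopic_part :: "(torus \<Rightarrow> torus) set \<Rightarrow> (torus \<Rightarrow> torus) set" where
  "isotopic_part L = {f \<in> L. isotopic_to_id f}"

text \<open>Lifts to the universal covering; if \<open>f\<close> is a homeomorphism, then \<open>F\<close> is automatically a
  homeomorphism of the plane.\<close>

definition is_lift :: "(torus \<Rightarrow> torus) \<Rightarrow> (real^2 \<Rightarrow> real^2) \<Rightarrow> bool" where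
  "is_lift f F \<longleftrightarrow> continuous_on UNIV F \<and> proj_torus \<circ> F = f \<circ> proj_torus"

section \<open>Nilpotent groups\<close>

fun lower_central :: "('a, 'b) monoid_scheme \<Rightarrow> nat \<Rightarrow> 'a set" where
  "lower_central K 0 = carrier K"
| "lower_central K (Suc n) =
     generate K (\<Union>x\<in>carrier K. \<Union>y\<in>lower_central K n.
       {x \<otimes>\<^bsub>K\<^esub> y \<otimes>\<^bsub>K\<^esub> inv\<^bsub>K\<^esub> x \<otimes>\<^bsub>K\<^esub> inv\<^bsub>K\<^esub> y})"

definition nilpotent_group :: "('a, 'b) monoid_scheme \<Rightarrow> bool" where
  "nilpotent_group K \<longleftrightarrow> group K \<and> (\<exists>n. lower_central K n = {\<one>\<^bsub>K\<^esub>})"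

section \<open>Invariant measures and rotation vectors\<close>

definition inv_measures :: "(torus \<Rightarrow> torus) \<Rightarrow> torus measure set" where
  "inv_measures f = {\<mu>. prob_space \<mu> \<and> sets \<mu> = sets borel \<and> distr \<mu> borel f = \<mu>}"

definition common_inv_measures :: "(torus \<Rightarrow> torus) set \<Rightarrow> torus measure set" where
  "common_inv_measures L = (\<Inter>f\<in>L. inv_measures f)"

text \<open>The map that \<open>F - Id\<close> induces on the torus. The value does not depend on the chosen
  representative when \<open>F\<close> commutes with integer translations, as every lift of a homeomorphism
  isotopic to the identity does.\<close>

definition displacement :: "(real^2 \<Rightarrow> real^2) \<Rightarrow> torus \<Rightarrow> real^2" where
  "displacement F p = F (rep_torus p) - rep_torus p"

lemma displacement_proj_torus:
  assumes "\<And>x v. v \<in> int_lattice \<Longrightarrow> F (x + v) = F x + v"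
  shows "displacement F (proj_torus x) = F x - x"
proof -
  let ?r = "rep_torus (proj_torus x)"
  have "?r - x \<in> int_lattice"
    using proj_torus_eq_iff[of ?r x] by simp
  from assms[OF this, of x] show ?thesis
    by (simp add: displacement_def algebra_simps)
qed

definition rotation_vector :: "torus measure \<Rightarrow> (real^2 \<Rightarrow> real^2) \<Rightarrow> real^2" where
  "rotation_vector \<mu> F = (\<integral>p. displacement F p \<partial>\<mu>)"

text \<open>The set written \<open>\<I>\<^sub>L\<close> (tested on all measures invariant under the single map \<open>f\<close>).\<close>

definition irrotational :: "(torus \<Rightarrow> torus) set \<Rightarrow> (torus \<Rightarrow> torus) set" where
  "irrotational L = {f \<in> isotopic_part L.
     \<exists>F. is_lift f F \<and> (\<forall>\<mu>\<in>inv_measures f. rotation_vector \<mu> F = 0)}"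

text \<open>The set written \<open>L\<^sub>\<I>\<close> (tested only on the measures invariant under all of \<open>L\<close>).\<close>

definition common_irrotational :: "(torus \<Rightarrow> torus) set \<Rightarrow> (torus \<Rightarrow> torus) set" where
  "common_irrotational L = {f \<in> isotopic_part L.
     \<exists>F. is_lift f F \<and> (\<forall>\<mu>\<in>common_inv_measures L. rotation_vector \<mu> F = 0)}"

end

(* Let H be the set of g in G whose action on the lattice Z^2 is congruent to 1 modulo 3. Elements of H
   act with determinant 1 and either trace 2 or trace of absolute value at least 7, so the only
   root of unity that can be an eigenvalue is 1. For phi isotopic to the identity with lift Phi,
   mu invariant under phi and a in H, nilpotency makes n -> rho (a^n mu) Phi satisfy a linear recursion
   whose bounded solutions are constant; hence pushing forward by a does not change the rotation
   vector. A Markov-Kakutani argument along the lower central series then replaces mu by an H-invariant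
   measure with the same rotation vector.

   For the index: modulo 3 every matrix of determinant +-1 has order dividing 24, and a nilpotent
   group of integer matrices either lies in {1, -1}, or is commutative because it centralizes a
   non-scalar matrix, or has at most 8 elements. A commutative group reduces modulo 3 into the at most
   8 units of the commutant of a non-scalar matrix, or into the scalars. So G/H has at most 8 elements and exponent dividing 24,
   which excludes the orders 5 and 7. *)

theory Submission
  imports Defs "HOL-Algebra.Multiplicative_Group"
begin

section \<open>Lifts and the action on the lattice\<close>

text \<open>Why modulo 3: for A = 1 + 3B of determinant 1 the trace is 2 - 9 det B, which misses the
  values -2, ..., 1 that belong to the other roots of unity; modulo 2 the matrix -1 would survive.
  The obstacle in the recursion is a commutator. Let A be the matrix of a, let E be a lift of phi
  and E' the matching lift of c = phi^-1 a^-1 phi a. Then rho (a mu) E = A (rho mu E + rho mu E').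
  The second term is harmless once it is known to be unchanged by a, which is the same claim for a
  deeper commutator; nilpotency ends this chain at the identity. The difference d mu = rho (a mu) E
  - rho mu E then satisfies d (a mu) = A (d mu), and Cayley-Hamilton gives the recursion. The group
  may be infinitely generated, so adjoining one map at a time reaches only finitely many of them.
  Whole layers of the lower central series are reached by compactness, for which both invariance and
  the rotation vector are expressed by integrals of continuous functions.\<close>

lemma continuous_on_from_torus:
  fixes g :: "torus \<Rightarrow> 'a::topological_space"
  assumes "continuous_on UNIV (\<lambda>x. g (proj_torus x))"
  shows "continuous_on UNIV g"
proof -
  have "continuous_map euclidean euclidean (g \<circ> proj_torus)"
    using assms by (simp add: o_def)
  then have "continuous_map euclidean euclidean g"
    using continuous_compose_quotient_map quotient_map_proj_torus by blast
  then show ?thesis by simp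
qed

lemma continuous_on_proj_torus: "continuous_on S proj_torus"
  using quotient_imp_continuous_map[OF quotient_map_proj_torus] continuous_on_subset by fastforce

lemma int_lattice_constant:
  fixes f :: "'a::topological_space \<Rightarrow> real^2"
  assumes "connected S" "continuous_on S f" "\<And>x. x \<in> S \<Longrightarrow> f x \<in> int_lattice"
    and "x \<in> S" "y \<in> S"
  shows "f x = f y"
proof -
  have "f x $ i = f y $ i" for i
  proof -
    have "(\<lambda>x. f x $ i) constant_on S"
    proof (rule continuous_discrete_range_constant[OF assms(1)])
      show "continuous_on S (\<lambda>x. f x $ i)"
        using assms(2) by (intro continuous_intros)
      fix x assume "x \<in> S"
      then have x: "f x $ i \<in> \<int>"
        using assms(3) by (simp add: int_lattice_def)
      show "\<exists>e>0. \<forall>y. y \<in> S \<and> f y $ i \<noteq> f x $ i \<longrightarrow> e \<le> norm (f y $ i - f x $ i)"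
      proof (intro exI[of _ 1] conjI allI impI)
        fix y assume y: "y \<in> S \<and> f y $ i \<noteq> f x $ i"
        then have "f y $ i \<in> \<int>"
          using assms(3) by (simp add: int_lattice_def)
        then have "f y $ i - f x $ i \<in> \<int>" using x by simp
        then show "1 \<le> norm (f y $ i - f x $ i)"
          using y by (metis Ints_nonzero_abs_ge1 eq_iff_diff_eq_0 real_norm_def)
      qed simp
    qed
    then show ?thesis
      using assms(4,5) by (auto simp: constant_on_def)
  qed
  then show ?thesis by (simp add: vec_eq_iff)
qed

text \<open>A coordinate of the embedding of the torus into a product of two unit circles. It does
  not depend on the representative, and it turns lifting problems into the existence of continuous
  logarithms.\<close>

definition circle_coord :: "2 \<Rightarrow> torus \<Rightarrow> complex" where
  "circle_coord i p = exp (2 * of_real pi * \<i> * of_real (rep_torus p $ i))"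

lemma exp_2pi_eq_iff:
  "exp (2 * of_real pi * \<i> * of_real a) = exp (2 * of_real pi * \<i> * of_real b) \<longleftrightarrow> a - b \<in> \<int>"
proof -
  have "(\<exists>n::int. 2 * of_real pi * \<i> * of_real a = 2 * of_real pi * \<i> * of_real b + (of_int (2 * n) * pi) * \<i>)
    \<longleftrightarrow> (\<exists>n::int. a - b = of_int n)"
    (is "(\<exists>n. ?l n) \<longleftrightarrow> (\<exists>n. ?r n)")
  proof -
    have "?l n \<longleftrightarrow> ?r n" for n
    proof -
      have "?l n \<longleftrightarrow> 2 * of_real pi * \<i> * (of_real (a - b - of_int n) :: complex) = 0"
        by (simp add: algebra_simps)
      also have "\<dots> \<longleftrightarrow> a - b - of_int n = 0"
        by (simp del: of_real_diff)
      finally show ?thesis by auto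
    qed
    then show ?thesis by simp
  qed
  then show ?thesis
    unfolding exp_eq by (auto simp: Ints_def)
qed

lemma circle_coord_proj_torus:
  "circle_coord i (proj_torus x) = exp (2 * of_real pi * \<i> * of_real (x $ i))"
proof -
  have "rep_torus (proj_torus x) - x \<in> int_lattice"
    using proj_torus_eq_iff[of "rep_torus (proj_torus x)" x] by simp
  then have "rep_torus (proj_torus x) $ i - x $ i \<in> \<int>"
    by (simp add: int_lattice_def)
  then show ?thesis
    unfolding circle_coord_def exp_2pi_eq_iff .
qed

lemma continuous_on_circle_coord: "continuous_on UNIV (circle_coord i)"
  by (rule continuous_on_from_torus) (simp add: circle_coord_proj_torus, intro continuous_intros)

lemma norm_circle_coord: "norm (circle_coord i p) = 1"
  by (simp add: circle_coord_def)

lemma circle_coord_inject: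
  assumes "\<And>i. circle_coord i p = circle_coord i q"
  shows "p = q"
proof -
  have "rep_torus p $ i - rep_torus q $ i \<in> \<int>" for i
    using assms[of i] unfolding circle_coord_def exp_2pi_eq_iff .
  then have "proj_torus (rep_torus p) = proj_torus (rep_torus q)"
    unfolding proj_torus_eq_iff by (simp add: int_lattice_def)
  then show ?thesis by simp
qed

text \<open>A circle coordinate of \<open>g\<close> has no zeros, so it has a continuous logarithm
  on a contractible set; the modulus is 1, so this logarithm is purely imaginary and, divided by 2
  pi i, is a coordinate of the lift. Contractible sets cover both the plane and the strip that
  carries an isotopy.\<close>

lemma contractible_lift_exists:
  fixes g :: "'a::real_normed_vector \<Rightarrow> torus"
  assumes "continuous_on S g" "contractible S"
  obtains F where "continuous_on S F" "\<And>x. x \<in> S \<Longrightarrow> proj_torus (F x) = g x"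
proof -
  have "\<exists>c. continuous_on S c \<and> (\<forall>x\<in>S. circle_coord i (g x) = exp (c x))" for i
  proof -
    have "continuous_on S (\<lambda>x. circle_coord i (g x))"
      by (rule continuous_on_compose2[OF continuous_on_circle_coord assms(1)]) simp
    then show ?thesis
      using continuous_logarithm_on_contractible[OF _ assms(2), of "\<lambda>x. circle_coord i (g x)"]
        norm_circle_coord by (metis norm_zero zero_neq_one)
  qed
  then obtain c where c: "\<And>i. continuous_on S (c i)"
    and exp_c: "\<And>i x. x \<in> S \<Longrightarrow> circle_coord i (g x) = exp (c i x)"
    by metis
  define F :: "'a \<Rightarrow> real^2" where "F x = (\<chi> i. Im (c i x) / (2 * pi))" for x
  show thesis
  proof
    show "continuous_on S F"
      unfolding F_def using c by (intro continuous_intros) auto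
    fix x assume x: "x \<in> S"
    show "proj_torus (F x) = g x"
    proof (rule circle_coord_inject)
      fix i
      have "exp (Re (c i x)) = 1"
        using norm_circle_coord[of i "g x"] exp_c[OF x, of i] by simp
      then have "Re (c i x) = 0" by simp
      then have "2 * of_real pi * \<i> * of_real (F x $ i) = c i x"
        by (simp add: F_def complex_eq_iff)
      then show "circle_coord i (proj_torus (F x)) = circle_coord i (g x)"
        using exp_c[OF x, of i] by (simp add: circle_coord_proj_torus)
    qed
  qed
qed

section \<open>Lifts and the integer matrices they induce\<close>

definition rmat :: "int^2^2 \<Rightarrow> real^2^2" where
  "rmat A = (\<chi> i j. real_of_int (A $ i $ j))"

definition equivariant :: "(real^2 \<Rightarrow> real^2) \<Rightarrow> int^2^2 \<Rightarrow> bool" where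
  "equivariant F A \<longleftrightarrow> (\<forall>x. \<forall>v\<in>int_lattice. F (x + v) = F x + rmat A *v v)"

lemma rmat_mult: "rmat (A ** B) = rmat A ** rmat B"
  by (simp add: rmat_def matrix_matrix_mult_def vec_eq_iff)

lemma rmat_one: "rmat (mat 1) = mat 1"
  by (simp add: rmat_def mat_def vec_eq_iff)

lemma rmat_lattice: "v \<in> int_lattice \<Longrightarrow> rmat A *v v \<in> int_lattice"
  by (auto simp: int_lattice_def rmat_def matrix_vector_mult_def intro!: Ints_sum Ints_mult)

lemma is_liftD:
  assumes "is_lift f F"
  shows "continuous_on UNIV F" "proj_torus (F x) = f (proj_torus x)"
  using assms by (auto simp: is_lift_def fun_eq_iff)

lemma lift_exists:
  assumes "continuous_on UNIV f"
  obtains F where "is_lift f F"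
proof -
  have "continuous_on UNIV (\<lambda>x. f (proj_torus x))"
    by (rule continuous_on_compose2[OF assms continuous_on_proj_torus]) simp
  then obtain F where "continuous_on UNIV F" "\<And>x. proj_torus (F x) = f (proj_torus x)"
    using contractible_lift_exists[OF _ contractible_UNIV] by (metis UNIV_I)
  then show thesis
    by (intro that) (auto simp: is_lift_def)
qed

lemma is_lift_translate:
  assumes "is_lift f F" "w \<in> int_lattice"
  shows "is_lift f (\<lambda>x. F x + w)"
proof -
  have "proj_torus (F x + w) = f (proj_torus x)" for x
    using is_liftD(2)[OF assms(1), of x] proj_torus_eq_iff[of "F x + w" "F x"] assms(2) by simp
  then show ?thesis
    using is_liftD(1)[OF assms(1)] by (auto simp: is_lift_def intro!: continuous_intros)
qed

lemma is_lift_compose: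
  assumes "is_lift f F" "is_lift g G"
  shows "is_lift (f \<circ> g) (F \<circ> G)"
proof -
  have "continuous_on UNIV (\<lambda>x. F (G x))"
    by (rule continuous_on_compose2[OF is_liftD(1)[OF assms(1)] is_liftD(1)[OF assms(2)]]) simp
  then show ?thesis
    using is_liftD(2)[OF assms(1)] is_liftD(2)[OF assms(2)] by (simp add: is_lift_def o_def)
qed

lemma is_lift_id: "is_lift id id"
  by (simp add: is_lift_def continuous_on_id)

lemma lift_unique:
  assumes "is_lift f F" "is_lift f F'"
  obtains w where "w \<in> int_lattice" "\<And>x. F' x = F x + w"
proof -
  have lat: "F' x - F x \<in> int_lattice" for x
    using is_liftD(2)[OF assms(1), of x] is_liftD(2)[OF assms(2), of x]
    by (simp flip: proj_torus_eq_iff)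
  have "F' x - F x = F' 0 - F 0" for x
    by (rule int_lattice_constant[of UNIV])
      (use is_liftD(1)[OF assms(1)] is_liftD(1)[OF assms(2)] lat in \<open>auto intro!: continuous_intros\<close>)
  then show thesis
    using that[of "F' 0 - F 0"] lat by (metis add.commute diff_add_cancel)
qed

lemma int_lattice_decompose:
  assumes "v \<in> int_lattice"
  obtains k :: "2 \<Rightarrow> int" where "v = (\<chi> i. of_int (k i))"
proof -
  have "\<exists>k. v $ i = of_int k" for i
    using assms by (auto simp: int_lattice_def Ints_def)
  then obtain k where "\<And>i. v $ i = of_int (k i)" by metis
  then show thesis by (intro that[of k]) (simp add: vec_eq_iff)
qed

lemma additive_int_scale:
  fixes h :: "'a::real_vector \<Rightarrow> 'b::real_vector"
  assumes add: "\<And>u v. u \<in> L \<Longrightarrow> v \<in> L \<Longrightarrow> h (u + v) = h u + h v"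
    and L: "0 \<in> L" "\<And>u v. u \<in> L \<Longrightarrow> v \<in> L \<Longrightarrow> u + v \<in> L" "\<And>u. u \<in> L \<Longrightarrow> - u \<in> L"
    and v: "v \<in> L"
  shows "h (of_int k *\<^sub>R v) = of_int k *\<^sub>R h v \<and> of_int k *\<^sub>R v \<in> L"
proof -
  have h0: "h 0 = 0" using add[OF L(1) L(1)] by simp
  have nat: "h (real n *\<^sub>R u) = real n *\<^sub>R h u \<and> real n *\<^sub>R u \<in> L" if "u \<in> L" for n u
  proof (induction n)
    case (Suc n)
    then show ?case
      using add[OF that, of "real n *\<^sub>R u"] L(2)[OF that, of "real n *\<^sub>R u"]
      by (simp add: scaleR_add_left)
  qed (use L h0 in simp)
  have "h (- v) = - h v"
    using add[OF v L(3)[OF v]] h0 by (simp add: eq_neg_iff_add_eq_0 add.commute)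
  then show ?thesis
    using nat[OF v, of "nat k"] nat[OF L(3)[OF v], of "nat (- k)"]
    by (cases "k \<ge> 0") auto
qed

text \<open>For a lattice vector \<open>v\<close> the increment \<open>F (x + v) - F x\<close> is
  continuous in \<open>x\<close> with values in the lattice, hence a constant \<open>h v\<close>.
  Since \<open>h\<close> is additive, its values on the two basis vectors are the columns of the
  matrix.\<close>

lemma lift_equivariant:
  assumes "is_lift f F"
  obtains A where "equivariant F A"
proof -
  define h where "h v = F v - F 0" for v
  have lat: "F (x + v) - F x \<in> int_lattice" if "v \<in> int_lattice" for x v
    using is_liftD(2)[OF assms, of x] is_liftD(2)[OF assms, of "x + v"] that
      proj_torus_eq_iff[of "x + v" x] by (simp flip: proj_torus_eq_iff)
  have h: "F (x + v) = F x + h v" if "v \<in> int_lattice" for x v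
  proof -
    have cont: "continuous_on UNIV (\<lambda>x. F (x + v) - F x)"
      using is_liftD(1)[OF assms]
      by (intro continuous_intros continuous_on_compose2[OF is_liftD(1)[OF assms]]) auto
    have "F (x + v) - F x = F (0 + v) - F 0"
      by (rule int_lattice_constant[OF connected_UNIV cont]) (use lat that in auto)
    then show ?thesis by (simp add: h_def algebra_simps)
  qed
  have add: "h (u + v) = h u + h v" if "u \<in> int_lattice" "v \<in> int_lattice" for u v
    using h[OF that(2), of u] by (simp add: h_def)
  have axis: "axis i 1 \<in> int_lattice" for i :: 2
    by (simp add: int_lattice_def axis_def)
  \<comment> \<open>The floor only changes the type: by \<open>lat\<close> the entries are integers
    already.\<close>
  define A :: "int^2^2" where "A = (\<chi> i j. \<lfloor>h (axis j 1) $ i\<rfloor>)"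
  have A: "real_of_int (A $ i $ j) = h (axis j 1) $ i" for i j
    using lat[OF axis, of 0 j] by (simp add: A_def h_def int_lattice_def)
  have "h v = rmat A *v v" if v: "v \<in> int_lattice" for v
  proof -
    obtain k where k: "v = (\<chi> i. of_int (k i))" using int_lattice_decompose[OF v] .
    have sc: "h (of_int k *\<^sub>R axis i 1) = of_int k *\<^sub>R h (axis i 1)"
      "of_int k *\<^sub>R axis i 1 \<in> int_lattice" for k i
      using additive_int_scale[of int_lattice h "axis i 1" k] add axis
      by (auto simp: int_lattice_zero int_lattice_add int_lattice_uminus)
    have "v = of_int (k 1) *\<^sub>R axis 1 1 + of_int (k 2) *\<^sub>R axis 2 1"
      unfolding k by (simp add: vec_eq_iff forall_2 axis_def)
    then have "h v = of_int (k 1) *\<^sub>R h (axis 1 1) + of_int (k 2) *\<^sub>R h (axis 2 1)"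
      using add sc by simp
    then show ?thesis
      by (simp add: k vec_eq_iff rmat_def matrix_vector_mult_def sum_2 A mult.commute)
  qed
  then show thesis
    using h that[of A] by (simp add: equivariant_def)
qed

lemma rmat_eq_on_lattice:
  assumes "\<And>v. v \<in> int_lattice \<Longrightarrow> rmat A *v v = rmat B *v v"
  shows "A = B"
proof -
  have "rmat A $ i $ j = rmat B $ i $ j" for i j
  proof -
    have "axis j 1 \<in> int_lattice" by (simp add: int_lattice_def axis_def)
    from assms[OF this] have "column j (rmat A) = column j (rmat B)"
      by (simp add: matrix_vector_mult_basis)
    then show ?thesis by (simp add: column_def vec_eq_iff)
  qed
  then show ?thesis
    by (simp add: rmat_def vec_eq_iff)
qed

lemma equivariant_unique:
  assumes "is_lift f F" "is_lift f F'" "equivariant F A" "equivariant F' B"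
  shows "A = B"
proof -
  obtain w where w: "\<And>x. F' x = F x + w" using lift_unique[OF assms(1,2)] by blast
  show ?thesis
  proof (rule rmat_eq_on_lattice)
    fix v assume v: "v \<in> int_lattice"
    then have "F (0 + v) = F 0 + rmat A *v v" "F' (0 + v) = F' 0 + rmat B *v v"
      using assms(3,4) unfolding equivariant_def by blast+
    then show "rmat A *v v = rmat B *v v" using w by simp
  qed
qed

text \<open>The action on the fundamental group of the torus, that is, on first homology. By
  \<open>equivariant_unique\<close> the choice of lift does not matter.\<close>

definition hmat :: "(torus \<Rightarrow> torus) \<Rightarrow> int^2^2" where
  "hmat f = (SOME A. \<exists>F. is_lift f F \<and> equivariant F A)"

lemma lift_hmat:
  assumes "is_lift f F"
  shows "equivariant F (hmat f)"
proof -
  obtain A where A: "equivariant F A" using lift_equivariant[OF assms] .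
  have "\<exists>F. is_lift f F \<and> equivariant F (hmat f)"
    unfolding hmat_def by (rule someI_ex) (use A assms in blast)
  then show ?thesis
    using equivariant_unique[OF _ assms _ A] A by blast
qed

lemma hmat_eqI: "is_lift f F \<Longrightarrow> equivariant F A \<Longrightarrow> hmat f = A"
  using equivariant_unique lift_hmat by blast

lemma hmat_id: "hmat id = mat 1"
  by (rule hmat_eqI[OF is_lift_id]) (simp add: equivariant_def rmat_one)

lemma equivariant_compose:
  assumes "equivariant F A" "equivariant G B"
  shows "equivariant (F \<circ> G) (A ** B)"
  using assms rmat_lattice[of _ B]
  by (simp add: equivariant_def rmat_mult matrix_vector_mul_assoc)

lemma hmat_compose:
  assumes "continuous_on UNIV f" "continuous_on UNIV g"
  shows "hmat (f \<circ> g) = hmat f ** hmat g"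
proof -
  obtain F G where FG: "is_lift f F" "is_lift g G" using assms lift_exists by metis
  show ?thesis
    by (rule hmat_eqI[OF is_lift_compose[OF FG]]) (intro equivariant_compose lift_hmat FG)
qed

text \<open>The isotopy is lifted on the whole strip. The increment of the lift under
  \<open>v\<close> is lattice-valued and continuous on this connected set, so it is the same at time
  1 as at time 0, where the lift is a translation and the increment is \<open>v\<close>.\<close>

lemma hmat_isotopic:
  assumes "isotopic_to_id f"
  shows "hmat f = mat 1"
proof -
  obtain k where contk: "continuous_map (prod_topology (top_of_set {0..1::real}) euclidean) euclidean k"
    and k0: "\<And>p. k (0, p) = p" and k1: "\<And>p. k (1, p) = f p"
    using assms unfolding isotopic_to_id_def homotopic_with_def by auto
  define S where "S = {0..1::real} \<times> (UNIV :: (real^2) set)"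
  have contk': "continuous_on ({0..1} \<times> UNIV) k"
    using contk prod_topology_subtopology_eu[of "{0..1::real}" "UNIV :: torus set"] by simp
  have "continuous_on S (\<lambda>z. k (fst z, proj_torus (snd z)))"
    unfolding S_def
    by (rule continuous_on_compose2[OF contk'])
      (auto intro!: continuous_intros continuous_on_compose2[OF continuous_on_proj_torus])
  moreover have convS: "convex S"
    unfolding S_def by (intro convex_Times convex_real_interval convex_UNIV)
  ultimately obtain \<Phi> where cont: "continuous_on S \<Phi>"
    and \<Phi>: "\<And>z. z \<in> S \<Longrightarrow> proj_torus (\<Phi> z) = k (fst z, proj_torus (snd z))"
    using contractible_lift_exists[OF _ convex_imp_contractible] by blast
  have slice: "continuous_on UNIV (\<lambda>x. \<Phi> (t, x))" if "t \<in> {0..1}" for t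
    by (rule continuous_on_compose2[OF cont]) (use that in \<open>auto simp: S_def intro!: continuous_intros\<close>)
  have lift0: "is_lift id (\<lambda>x. \<Phi> (0, x))" and lift1: "is_lift f (\<lambda>x. \<Phi> (1, x))"
    using slice \<Phi> by (auto simp: is_lift_def S_def k0 k1 fun_eq_iff)
  have "equivariant (\<lambda>x. \<Phi> (1, x)) (mat 1)"
    unfolding equivariant_def
  proof (intro allI ballI)
    fix x v :: "real^2" assume v: "v \<in> int_lattice"
    have "\<Phi> (1, x + v) - \<Phi> (1, x) = \<Phi> (0, 0 + v) - \<Phi> (0, 0)"
    proof -
      define \<delta> where "\<delta> z = \<Phi> (fst z, snd z + v) - \<Phi> z" for z
      have "\<delta> (1, x) = \<delta> (0, 0)"
      proof (rule int_lattice_constant[of S \<delta>])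
        show "connected S" by (rule convex_connected[OF convS])
        have "continuous_on S (\<lambda>z. \<Phi> (fst z, snd z + v))"
          by (rule continuous_on_compose2[OF cont]) (auto simp: S_def intro!: continuous_intros)
        then show "continuous_on S \<delta>"
          unfolding \<delta>_def using cont by (intro continuous_intros)
        fix z assume z: "z \<in> S"
        then have "proj_torus (\<Phi> (fst z, snd z + v)) = proj_torus (\<Phi> z)"
          using \<Phi>[OF z] \<Phi>[of "(fst z, snd z + v)"] v proj_torus_eq_iff[of "snd z + v" "snd z"]
          by (auto simp: S_def)
        then show "\<delta> z \<in> int_lattice"
          by (simp add: \<delta>_def proj_torus_eq_iff)
      qed (auto simp: S_def)
      then show ?thesis by (simp add: \<delta>_def)
    qed
    also have "\<dots> = rmat (mat 1) *v v"
    proof -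
      obtain w where "\<And>x. \<Phi> (0, x) = id x + w" using lift_unique[OF is_lift_id lift0] by blast
      then show ?thesis by (simp add: rmat_one)
    qed
    finally show "\<Phi> (1, x + v) = \<Phi> (1, x) + rmat (mat 1) *v v"
      by (simp add: algebra_simps)
  qed
  then show ?thesis
    by (rule hmat_eqI[OF lift1])
qed

section \<open>Compactness of the space of probability measures\<close>

definition torus_prob :: "torus measure \<Rightarrow> bool" where
  "torus_prob \<mu> \<longleftrightarrow> prob_space \<mu> \<and> sets \<mu> = sets borel"

lemma torus_probD:
  assumes "torus_prob \<mu>"
  shows "prob_space \<mu>" "sets \<mu> = sets borel" "space \<mu> = UNIV"
  using assms sets_eq_imp_space_eq[of \<mu> borel] by (auto simp: torus_prob_def)

lemma torus_prob_distr:
  assumes "torus_prob \<mu>" "continuous_on UNIV f"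
  shows "torus_prob (distr \<mu> borel f)"
proof -
  have "f \<in> borel_measurable \<mu>"
    using borel_measurable_continuous_onI[OF assms(2)] torus_probD(2)[OF assms(1)]
    by (simp cong: measurable_cong_sets)
  then show ?thesis
    using prob_space.prob_space_distr[OF torus_probD(1)[OF assms(1)]] by (simp add: torus_prob_def)
qed

lemma compact_torus: "compact (UNIV :: torus set)"
proof -
  have "proj_torus ` cbox 0 1 = UNIV"
  proof (rule UNIV_eq_I[symmetric])
    fix p
    define x :: "real^2" where "x = (\<chi> i. frac (rep_torus p $ i))"
    have "proj_torus x = proj_torus (rep_torus p)"
      unfolding proj_torus_eq_iff by (simp add: x_def int_lattice_def frac_def)
    moreover have "x \<in> cbox 0 1"
      by (simp add: x_def mem_box_cart less_imp_le[OF frac_lt_1])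
    ultimately show "p \<in> proj_torus ` cbox 0 1" by force
  qed
  then show ?thesis
    using compact_continuous_image[OF continuous_on_proj_torus compact_cbox] by metis
qed

lemma torus_bounded:
  fixes \<phi> :: "torus \<Rightarrow> 'a::real_normed_vector"
  assumes "continuous_on UNIV \<phi>"
  obtains B where "\<And>p. norm (\<phi> p) \<le> B"
proof -
  have "bounded (range \<phi>)"
    by (rule compact_imp_bounded[OF compact_continuous_image[OF assms compact_torus]])
  then show thesis using that by (auto simp: bounded_iff)
qed

lemma torus_integrable:
  fixes \<phi> :: "torus \<Rightarrow> 'a::euclidean_space"
  assumes "torus_prob \<mu>" "continuous_on UNIV \<phi>"
  shows "integrable \<mu> \<phi>"
proof -
  interpret prob_space \<mu> using torus_probD(1)[OF assms(1)] .
  obtain B where B: "\<And>p. norm (\<phi> p) \<le> B" using torus_bounded[OF assms(2)] by blast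
  have "\<phi> \<in> borel_measurable \<mu>"
    using borel_measurable_continuous_onI[OF assms(2)] torus_probD(2)[OF assms(1)]
    by (simp cong: measurable_cong_sets)
  then show ?thesis
    by (rule integrable_const_bound[of _ B, rotated]) (simp add: B)
qed

text \<open>The indicator of an open set is a pointwise limit of continuous functions, so integrals
  of continuous functions determine the measure of open sets, which form an intersection-stable
  generator of the Borel sets.\<close>

lemma torus_measure_eqI:
  assumes "torus_prob \<mu>" "torus_prob \<nu>"
    and eq: "\<And>\<phi>::torus \<Rightarrow> real. continuous_on UNIV \<phi> \<Longrightarrow> (\<integral>p. \<phi> p \<partial>\<mu>) = (\<integral>p. \<phi> p \<partial>\<nu>)"
  shows "\<mu> = \<nu>"
proof -
  have open_eq: "emeasure \<mu> U = emeasure \<nu> U" if U: "open U" for U :: "torus set"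
  proof (cases "U = UNIV")
    case True
    then show ?thesis
      using prob_space.emeasure_space_1[of \<mu>] prob_space.emeasure_space_1[of \<nu>]
        torus_probD[OF assms(1)] torus_probD[OF assms(2)] by simp
  next
    case False
    define V where "V = proj_torus -` U"
    have V: "open V" using U by (simp add: V_def open_torus_def)
    have V_ne: "- V \<noteq> {}"
      using False by (metis (no_types, lifting) ComplI UNIV_eq_I V_def empty_iff proj_rep_torus vimage_eq)
    \<comment> \<open>The distance is taken in the plane, to the complement of the preimage of
      \<open>U\<close>; this complement is invariant under the lattice, so \<open>d\<close> descends
      to the torus.\<close>
    define d where "d x = infdist x (- V)" for x
    have d_le: "d (x + v) \<le> d x" if "v \<in> int_lattice" for x v
    proof -
      have "infdist (x + v) (- V) \<le> dist x y" if y: "y \<in> - V" for y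
      proof -
        have "proj_torus (y + v) = proj_torus y"
          using \<open>v \<in> int_lattice\<close> by (simp add: proj_torus_eq_iff)
        then have "y + v \<in> - V" using y by (simp add: V_def)
        then have "infdist (x + v) (- V) \<le> dist (x + v) (y + v)" by (rule infdist_le)
        then show ?thesis by simp
      qed
      then show ?thesis
        unfolding d_def infdist_def using V_ne by (auto intro!: cINF_greatest simp: infdist_def)
    qed
    have d_eq: "d x = d y" if "proj_torus x = proj_torus y" for x y
    proof -
      have "x - y \<in> int_lattice" "y - x \<in> int_lattice"
        using proj_torus_eq_iff[THEN iffD1, OF that] proj_torus_eq_iff[THEN iffD1, OF that[symmetric]] by simp_all
      from d_le[OF this(1), of y] d_le[OF this(2), of x] show ?thesis by simp
    qed
    define \<phi> where "\<phi> n p = min 1 (real n * d (rep_torus p))" for n p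
    have \<phi>_proj: "\<phi> n (proj_torus x) = min 1 (real n * d x)" for n x
      unfolding \<phi>_def using d_eq[of "rep_torus (proj_torus x)" x] by simp
    have cont: "continuous_on UNIV (\<phi> n)" for n
      by (rule continuous_on_from_torus) (simp add: \<phi>_proj d_def, intro continuous_intros)
    have d_nonneg: "0 \<le> d x" for x by (simp add: d_def infdist_nonneg)
    have lim: "(\<lambda>n. \<phi> n p) \<longlonglongrightarrow> indicator U p" for p
    proof (cases "p \<in> U")
      case True
      then have "rep_torus p \<in> V" by (simp add: V_def)
      then have pos: "d (rep_torus p) > 0"
        unfolding d_def using V V_ne by (subst infdist_pos_not_in_closed) (auto simp: closed_def)
      obtain N :: nat where N: "1 < real N * d (rep_torus p)"
        using reals_Archimedean3[OF pos] by blast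
      have "\<forall>\<^sub>F n in sequentially. \<phi> n p = indicator U p"
        using eventually_ge_at_top[of N]
      proof eventually_elim
        case (elim n)
        then have "real N * d (rep_torus p) \<le> real n * d (rep_torus p)"
          using pos by (intro mult_right_mono) auto
        then show ?case using N True by (simp add: \<phi>_def)
      qed
      then show ?thesis by (rule tendsto_eventually)
    next
      case False
      then have "rep_torus p \<in> - V" by (simp add: V_def)
      then have "d (rep_torus p) = 0" by (simp add: d_def)
      then show ?thesis using False by (simp add: \<phi>_def)
    qed
    have int: "(\<lambda>n. \<integral>p. \<phi> n p \<partial>\<rho>) \<longlonglongrightarrow> measure \<rho> U" if \<rho>: "torus_prob \<rho>" for \<rho>
    proof -
      interpret prob_space \<rho> using torus_probD(1)[OF \<rho>] .
      have U': "U \<in> sets \<rho>" using U torus_probD(2)[OF \<rho>] by simp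
      have "(\<lambda>n. \<integral>p. \<phi> n p \<partial>\<rho>) \<longlonglongrightarrow> (\<integral>p. indicator U p \<partial>\<rho>)"
      proof (rule integral_dominated_convergence[where w = "\<lambda>_. 1"])
        show "(\<lambda>p. indicator U p :: real) \<in> borel_measurable \<rho>" using U' by simp
        show "\<phi> n \<in> borel_measurable \<rho>" for n
          using torus_integrable[OF \<rho> cont] by simp
        show "AE p in \<rho>. (\<lambda>n. \<phi> n p) \<longlonglongrightarrow> indicator U p" using lim by simp
      qed (auto simp: \<phi>_def d_nonneg)
      then show ?thesis using U' torus_probD(3)[OF \<rho>] by simp
    qed
    have "measure \<mu> U = measure \<nu> U"
      using LIMSEQ_unique[OF int[OF assms(1)]] int[OF assms(2)] eq[OF cont] by simp
    then show ?thesis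
      using torus_probD(1)[OF assms(1)] torus_probD(1)[OF assms(2)]
      by (simp add: finite_measure.emeasure_eq_measure prob_space_def)
  qed
  show ?thesis
  proof (rule measure_eqI_generator_eq[where E = "Collect open" and \<Omega> = UNIV and A = "\<lambda>_. UNIV"])
    show "Int_stable (Collect open :: torus set set)" by (auto simp: Int_stable_def)
    show "sets \<mu> = sigma_sets UNIV (Collect open)"  "sets \<nu> = sigma_sets UNIV (Collect open)"
      using torus_probD(2)[OF assms(1)] torus_probD(2)[OF assms(2)] by (simp_all add: borel_def)
    show "emeasure \<mu> UNIV \<noteq> \<infinity>"
      using prob_space.emeasure_space_1[OF torus_probD(1)[OF assms(1)]] torus_probD(3)[OF assms(1)] by simp
  qed (auto simp: open_eq)
qed

text \<open>Schoenberg's space-filling curve. It has a Borel measurable right inverse, so that weak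
  compactness for measures on the torus follows from Helly's theorem on the line.\<close>

definition schoenberg_profile :: "real \<Rightarrow> real" where
  "schoenberg_profile t = max 0 (min 1 (1/2 - cos (pi * t)))"

text \<open>Ternary digits at even positions feed \<open>schoenberg 0\<close>, those at odd
  positions feed \<open>schoenberg 1\<close>; each sequence is reassembled in base 2.\<close>

definition schoenberg :: "nat \<Rightarrow> real \<Rightarrow> real" where
  "schoenberg i t = (\<Sum>k. schoenberg_profile (3 ^ (2 * k + i) * t) / 2 ^ Suc k)"

lemma continuous_on_schoenberg: "continuous_on UNIV (schoenberg i)"
proof -
  have lim: "uniform_limit UNIV (\<lambda>n t. \<Sum>k<n. schoenberg_profile (3 ^ (2 * k + i) * t) / 2 ^ Suc k)
    (\<lambda>t. \<Sum>k. schoenberg_profile (3 ^ (2 * k + i) * t) / 2 ^ Suc k) sequentially"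
  proof (rule Weierstrass_m_test)
    show "summable (\<lambda>k. (1/2::real) ^ Suc k)" by (simp add: summable_geometric)
    show "norm (schoenberg_profile (3 ^ (2 * k + i) * t) / 2 ^ Suc k) \<le> (1/2) ^ Suc k" for k t
      by (simp add: schoenberg_profile_def power_divide divide_simps)
  qed
  have "continuous_on UNIV (\<lambda>t. \<Sum>k. schoenberg_profile (3 ^ (2 * k + i) * t) / 2 ^ Suc k)"
    by (rule uniform_limit_theorem[OF _ lim])
      (auto simp: schoenberg_profile_def intro!: always_eventually continuous_intros)
  then show ?thesis by (simp add: schoenberg_def[abs_def])
qed

text \<open>The profile has period 2. The clamping makes it 0 on [0, 1/3], where the cosine is at
  least 1/2, and 1 on [2/3, 1], where it is at most -1/2; so it reads off the leading digit of a
  Cantor expansion.\<close>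

lemma schoenberg_profile_ternary:
  assumes "b \<in> {0, 1}" "0 \<le> r" "r \<le> 1/3"
  shows "schoenberg_profile (2 * of_int m + 2/3 * of_nat b + r) = of_nat b"
proof -
  have "cos (pi * (2 * of_int m + 2/3 * of_nat b + r)) = cos (pi * (2/3 * of_nat b + r))"
  proof -
    have "cos (pi * (2 * of_int m + 2/3 * of_nat b + r)) = cos (pi * (2/3 * of_nat b + r) + of_int m * (2 * pi))"
      by (rule arg_cong[where f = cos]) (simp add: algebra_simps)
    also have "\<dots> = cos (pi * (2/3 * of_nat b + r))"
      using cos.plus_of_int[of "pi * (2/3 * of_nat b + r)" m] by simp
    finally show ?thesis .
  qed
  moreover have "cos (pi * r) \<ge> 1/2"
  proof -
    have "cos (pi / 3) \<le> cos (pi * r)"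
      by (rule cos_monotone_0_pi_le) (use assms in auto)
    then show ?thesis by (simp add: cos_60)
  qed
  moreover have "cos (pi * (2/3 + r)) \<le> - 1/2"
  proof -
    have "cos (pi * (2/3 + r)) \<le> cos (pi * (2/3))"
      by (rule cos_monotone_0_pi_le) (use assms in auto)
    moreover have "cos (pi * (2/3)) = - 1/2"
      using cos_120 by (simp add: mult.commute)
    ultimately show ?thesis by simp
  qed
  ultimately show ?thesis
    using assms(1) by (auto simp: schoenberg_profile_def)
qed

definition ternary :: "(nat \<Rightarrow> nat) \<Rightarrow> real" where
  "ternary b = (\<Sum>j. 2 * real (b j) / 3 ^ Suc j)"

lemma summable_ternary:
  assumes "\<And>j. b j \<in> {0, 1}"
  shows "summable (\<lambda>j. 2 * real (b j) / 3 ^ Suc j)"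
proof (rule summable_comparison_test')
  show "summable (\<lambda>j. (2/3) * (1/3::real) ^ j)" by (intro summable_mult summable_geometric) simp
  show "norm (2 * real (b j) / 3 ^ Suc j) \<le> (2/3) * (1/3) ^ j" for j
    using assms[of j] by (auto simp: power_divide)
qed

lemma ternary_bounds:
  assumes "\<And>j. b j \<in> {0, 1}"
  shows "0 \<le> ternary b" "ternary b \<le> 1"
proof -
  show "0 \<le> ternary b"
    unfolding ternary_def by (intro suminf_nonneg summable_ternary assms) simp
  have "ternary b \<le> (\<Sum>j. (2/3) * (1/3::real) ^ j)"
    unfolding ternary_def
  proof (intro suminf_le summable_ternary assms summable_mult summable_geometric)
    show "2 * real (b j) / 3 ^ Suc j \<le> (2/3) * (1/3) ^ j" for j
      using assms[of j] by (auto simp: power_divide)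
  qed simp
  also have "\<dots> = 1"
    by (subst suminf_mult) (simp_all add: suminf_geometric summable_geometric)
  finally show "ternary b \<le> 1" .
qed

lemma ternary_Suc:
  assumes "\<And>j. b j \<in> {0, 1}"
  shows "3 * ternary b = 2 * real (b 0) + ternary (\<lambda>j. b (Suc j))"
proof -
  have "ternary b = 2 * real (b 0) / 3 + (\<Sum>j. 2 * real (b (Suc j)) / 3 ^ Suc (Suc j))"
    unfolding ternary_def using suminf_split_head[OF summable_ternary[of b, OF assms]] by simp
  also have "(\<Sum>j. 2 * real (b (Suc j)) / 3 ^ Suc (Suc j)) = ternary (\<lambda>j. b (Suc j)) / 3"
    unfolding ternary_def
    using suminf_divide[OF summable_ternary[of "\<lambda>j. b (Suc j)", OF assms], of 3]
    by (simp add: mult.commute mult.left_commute)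
  finally show ?thesis by simp
qed

text \<open>The digits are 0 or 2, so the integer split off by a shift is even, in accordance with
  the period 2 of the profile.\<close>

lemma ternary_shift:
  assumes "\<And>j. b j \<in> {0, 1}"
  shows "\<exists>m::int. 3 ^ k * ternary b = 2 * of_int m + ternary (\<lambda>j. b (j + k))"
proof (induction k)
  case 0
  show ?case by (rule exI[of _ 0]) simp
next
  case (Suc k)
  then obtain m :: int where m: "3 ^ k * ternary b = 2 * of_int m + ternary (\<lambda>j. b (j + k))" by blast
  have "3 ^ Suc k * ternary b = 3 * (3 ^ k * ternary b)" by simp
  also have "\<dots> = 2 * of_int (3 * m) + 3 * ternary (\<lambda>j. b (j + k))" unfolding m by simp
  also have "\<dots> = 2 * of_int (3 * m + int (b k)) + ternary (\<lambda>j. b (j + Suc k))"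
    by (subst ternary_Suc) (use assms in auto)
  finally show ?case by blast
qed

lemma schoenberg_ternary:
  assumes "\<And>j. b j \<in> {0, 1}"
  shows "schoenberg i (ternary b) = (\<Sum>k. real (b (2 * k + i)) / 2 ^ Suc k)"
proof -
  have "schoenberg_profile (3 ^ n * ternary b) = real (b n)" for n
  proof -
    obtain m :: int where m: "3 ^ n * ternary b = 2 * of_int m + ternary (\<lambda>j. b (j + n))"
      using ternary_shift[of b n] assms by blast
    have "3 * ternary (\<lambda>j. b (j + n)) = 2 * real (b n) + ternary (\<lambda>j. b (j + Suc n))"
      by (subst ternary_Suc) (use assms in auto)
    then have "3 ^ n * ternary b = 2 * of_int m + 2/3 * of_nat (b n) + ternary (\<lambda>j. b (j + Suc n)) / 3"
      unfolding m by simp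
    then show ?thesis
      using schoenberg_profile_ternary[OF assms[of n], of "ternary (\<lambda>j. b (j + Suc n)) / 3" m]
        ternary_bounds[of "\<lambda>j. b (j + Suc n)"] assms by simp
  qed
  then show ?thesis by (simp add: schoenberg_def)
qed

definition bit_at :: "nat \<Rightarrow> real \<Rightarrow> nat" where
  "bit_at k x = nat (\<lfloor>2 ^ Suc k * x\<rfloor> mod 2)"

lemma bit_at_01: "bit_at k x \<in> {0, 1}"
  unfolding bit_at_def by (cases "even \<lfloor>2 ^ Suc k * x\<rfloor>") (auto simp: even_iff_mod_2_eq_zero odd_iff_mod_2_eq_one)

text \<open>The first \<open>n\<close> terms add up to the truncation of \<open>x\<close> after
  \<open>n\<close> binary places, which is within \<open>(1/2) ^ n\<close> of
  \<open>x\<close>.\<close>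

lemma bits_sums:
  assumes "0 \<le> x" "x < 1"
  shows "(\<lambda>k. real (bit_at k x) / 2 ^ Suc k) sums x"
proof -
  have part: "(\<Sum>k<n. real (bit_at k x) / 2 ^ Suc k) = of_int \<lfloor>2 ^ n * x\<rfloor> / 2 ^ n" for n
  proof (induction n)
    case 0
    have "\<lfloor>x\<rfloor> = 0" using assms by linarith
    then show ?case by simp
  next
    case (Suc n)
    define y where "y = 2 ^ n * x"
    have half: "\<lfloor>2 * y\<rfloor> div 2 = \<lfloor>y\<rfloor>"
      using floor_divide_real_eq_div[of 2 "2 * y"] by simp
    have "real (bit_at n x) = of_int (\<lfloor>2 * y\<rfloor> mod 2)"
      by (simp add: bit_at_def y_def mult.assoc)
    also have "\<dots> = of_int \<lfloor>2 * y\<rfloor> - 2 * of_int \<lfloor>y\<rfloor>"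
      unfolding minus_div_mult_eq_mod[symmetric] half by simp
    finally have "real (bit_at n x) = of_int \<lfloor>2 * y\<rfloor> - 2 * of_int \<lfloor>y\<rfloor>" .
    then show ?case
      using Suc by (simp add: y_def field_simps)
  qed
  have "(\<lambda>n. of_int \<lfloor>2 ^ n * x\<rfloor> / 2 ^ n) \<longlonglongrightarrow> x"
  proof (rule tendsto_sandwich)
    show "\<forall>\<^sub>F n in sequentially. x - (1/2) ^ n \<le> of_int \<lfloor>2 ^ n * x\<rfloor> / 2 ^ n"
    proof (intro always_eventually allI)
      fix n
      have "2 ^ n * x - 1 \<le> of_int \<lfloor>2 ^ n * x\<rfloor>" by linarith
      then have "(2 ^ n * x - 1) / 2 ^ n \<le> of_int \<lfloor>2 ^ n * x\<rfloor> / 2 ^ n"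
        by (intro divide_right_mono) auto
      then show "x - (1/2) ^ n \<le> of_int \<lfloor>2 ^ n * x\<rfloor> / 2 ^ n"
        by (simp add: diff_divide_distrib power_divide)
    qed
    show "\<forall>\<^sub>F n in sequentially. of_int \<lfloor>2 ^ n * x\<rfloor> / 2 ^ n \<le> x"
    proof (intro always_eventually allI)
      fix n
      have "of_int \<lfloor>2 ^ n * x\<rfloor> / 2 ^ n \<le> (2 ^ n * x) / 2 ^ n"
        by (intro divide_right_mono) auto
      then show "of_int \<lfloor>2 ^ n * x\<rfloor> / 2 ^ n \<le> x" by simp
    qed
    show "(\<lambda>n. x - (1/2) ^ n) \<longlonglongrightarrow> x"
      using tendsto_diff[OF tendsto_const[of x] LIMSEQ_power_zero[of "1/2::real"]] by simp
  qed simp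
  then show ?thesis by (simp only: sums_def part)
qed

text \<open>\<open>g\<close> interleaves the binary digits of the two coordinates in one Cantor
  number, from which \<open>h\<close> recovers them. Being Borel, \<open>g\<close> carries measures
  to the line, and \<open>h\<close> carries them back.\<close>

lemma torus_curve:
  obtains h :: "real \<Rightarrow> torus" and g :: "torus \<Rightarrow> real"
  where "continuous_on UNIV h" "g \<in> borel_measurable borel" "\<And>p. h (g p) = p"
    "\<And>p. g p \<in> {0..1}"
proof -
  define u where "u i p = frac (rep_torus p $ i)" for i p
  have u_proj: "u i (proj_torus x) = frac (x $ i)" for i x
  proof -
    have "rep_torus (proj_torus x) - x \<in> int_lattice"
      using proj_torus_eq_iff[of "rep_torus (proj_torus x)" x] by simp
    then have "rep_torus (proj_torus x) $ i - x $ i \<in> \<int>" by (simp add: int_lattice_def)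
    then obtain n where "rep_torus (proj_torus x) $ i = x $ i + of_int n"
      by (metis Ints_cases add.commute diff_add_cancel)
    then show ?thesis by (simp add: u_def frac_def)
  qed
  \<comment> \<open>The representative in [0, 1) of a coordinate jumps on the torus, but it is lower
    semicontinuous: its superlevel sets are open.\<close>
  have u_meas [measurable]: "u i \<in> borel_measurable borel" for i
  proof (rule borel_measurableI_greater)
    fix c
    have "open {p. c < u i p}"
    proof (cases "c < 0")
      case True
      then have "{p. c < u i p} = UNIV" using frac_ge_0 by (auto simp: u_def intro: less_le_trans)
      then show ?thesis by simp
    next
      case False
      have "{x::real^2. c < frac (x $ i)} = (\<Union>n::int. {x. of_int n + c < x $ i} \<inter> {x. x $ i < of_int n + 1})"
      proof (intro Set.set_eqI iffI)
        fix x :: "real^2" assume "x \<in> {x. c < frac (x $ i)}"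
        then have "of_int \<lfloor>x $ i\<rfloor> + c < x $ i" "x $ i < of_int \<lfloor>x $ i\<rfloor> + 1"
          by (auto simp: frac_def)
        then show "x \<in> (\<Union>n::int. {x. of_int n + c < x $ i} \<inter> {x. x $ i < of_int n + 1})" by blast
      next
        fix x :: "real^2" assume "x \<in> (\<Union>n::int. {x. of_int n + c < x $ i} \<inter> {x. x $ i < of_int n + 1})"
        then obtain n :: int where n: "of_int n + c < x $ i" "x $ i < of_int n + 1" by blast
        then have "\<lfloor>x $ i\<rfloor> = n" using False by (simp add: floor_eq_iff)
        then show "x \<in> {x. c < frac (x $ i)}" using n by (simp add: frac_def)
      qed
      also have "open \<dots>"
        by (intro open_UN ballI open_Int open_Collect_less continuous_intros)
      finally show ?thesis
        by (simp add: open_torus_def vimage_def u_proj)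
    qed
    then show "{p \<in> space borel. c < u i p} \<in> sets borel" by simp
  qed
  define b where "b p j = bit_at (j div 2) (u (if even j then 1 else 2) p)" for p j
  have b01: "b p j \<in> {0, 1}" for p j by (simp only: b_def bit_at_01)
  define g where "g p = ternary (b p)" for p
  define h where "h t = proj_torus (\<chi> i. schoenberg (if i = 1 then 0 else 1) t)" for t
  show thesis
  proof
    show "continuous_on UNIV h"
      unfolding h_def
      by (rule continuous_on_compose2[OF continuous_on_proj_torus[of UNIV]])
        (auto intro!: continuous_intros continuous_on_schoenberg)
    show "g \<in> borel_measurable borel"
      unfolding g_def ternary_def b_def bit_at_def by measurable
    show "g p \<in> {0..1}" for p
      using ternary_bounds[OF b01] by (simp add: g_def)
    show "h (g p) = p" for p
    proof -
      have "schoenberg (if i = 1 then 0 else 1) (g p) = u i p" for i :: 2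
      proof -
        have "schoenberg (if i = 1 then 0 else 1) (g p)
          = (\<Sum>k. real (b p (2 * k + (if i = 1 then 0 else 1))) / 2 ^ Suc k)"
          unfolding g_def by (rule schoenberg_ternary[OF b01])
        also have "\<dots> = (\<Sum>k. real (bit_at k (u i p)) / 2 ^ Suc k)"
          using exhaust_2[of i] by (auto simp: b_def)
        also have "\<dots> = u i p"
          by (rule sums_unique[symmetric], rule bits_sums) (simp_all add: u_def frac_lt_1)
        finally show ?thesis .
      qed
      then have "h (g p) = proj_torus (\<chi> i. u i p)" by (simp add: h_def)
      also have "\<dots> = proj_torus (rep_torus p)"
        unfolding proj_torus_eq_iff by (simp add: int_lattice_def u_def frac_def)
      finally show ?thesis by simp
    qed
  qed
qed

section \<open>Transfer of weak compactness from the line to the torus\<close>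

lemma integral_distr_torus:
  fixes \<phi> :: "torus \<Rightarrow> 'b::{banach, second_countable_topology}"
  assumes "X \<in> borel_measurable M" "continuous_on UNIV \<phi>"
  shows "(\<integral>p. \<phi> p \<partial>distr M borel X) = (\<integral>x. \<phi> (X x) \<partial>M)"
  by (rule integral_distr[OF assms(1) borel_measurable_continuous_onI[OF assms(2)]])

lemma torus_measurable:
  assumes "torus_prob \<mu>" "continuous_on UNIV f"
  shows "f \<in> borel_measurable \<mu>"
  using borel_measurable_continuous_onI[OF assms(2)] torus_probD(2)[OF assms(1)]
  by (simp cong: measurable_cong_sets)

text \<open>A continuous function that vanishes exactly on [0, 1], capped at 1 to be bounded.
  Concentration on [0, 1] thus becomes an integral condition that passes to weak limits.\<close>

definition unit_excess :: "real \<Rightarrow> real" where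
  "unit_excess x = min 1 (max 0 (x - 1) + max 0 (- x))"

definition unit_distr :: "real measure \<Rightarrow> bool" where
  "unit_distr M \<longleftrightarrow> real_distribution M \<and> (\<integral>x. unit_excess x \<partial>M) = 0"

lemma continuous_on_unit_excess: "continuous_on S unit_excess"
  unfolding unit_excess_def by (intro continuous_intros)

lemma unit_excess_range: "0 \<le> unit_excess x" "unit_excess x \<le> 1"
  by (auto simp: unit_excess_def)

text \<open>Tightness is stated with intervals open on the left; the left end -1 leaves room for an
  atom at 0.\<close>

lemma unit_distr_measure:
  assumes "unit_distr M"
  shows "measure M {-1<..1} = 1"
proof -
  interpret real_distribution M using assms by (simp add: unit_distr_def)
  have meas: "unit_excess \<in> borel_measurable M"
    using borel_measurable_continuous_onI[OF continuous_on_unit_excess] by simp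
  have "integrable M unit_excess"
    by (rule integrable_const_bound[of _ 1, OF _ meas]) (simp add: unit_excess_range)
  then have "AE x in M. unit_excess x = 0"
    using assms by (subst integral_nonneg_eq_0_iff_AE[symmetric]) (auto simp: unit_distr_def unit_excess_range)
  then have "AE x in M. x \<in> {-1<..1}"
    by eventually_elim (auto simp: unit_excess_def)
  then show ?thesis by (subst prob_eq_1) auto
qed

lemma unit_distr_distr:
  assumes "torus_prob \<mu>" "g \<in> borel_measurable borel" "\<And>p. g p \<in> {0..1}"
  shows "unit_distr (distr \<mu> borel g)"
proof -
  interpret prob_space \<mu> using torus_probD(1)[OF assms(1)] .
  have g: "g \<in> borel_measurable \<mu>"
    using assms(2) torus_probD(2)[OF assms(1)] by (simp cong: measurable_cong_sets)
  have "(\<integral>x. unit_excess x \<partial>distr \<mu> borel g) = (\<integral>p. unit_excess (g p) \<partial>\<mu>)"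
    by (rule integral_distr[OF g borel_measurable_continuous_onI[OF continuous_on_unit_excess]])
  moreover have "unit_excess (g p) = 0" for p using assms(3)[of p] by (simp add: unit_excess_def)
  ultimately show ?thesis
    unfolding unit_distr_def using real_distribution_distr[OF g] by simp
qed

lemma weak_conv_integral:
  fixes \<phi> :: "real \<Rightarrow> real"
  assumes "\<And>n. real_distribution (M n)" "real_distribution M'" "weak_conv_m M M'"
    and "continuous_on UNIV \<phi>" "\<And>x. norm (\<phi> x) \<le> B"
  shows "(\<lambda>n. \<integral>x. \<phi> x \<partial>M n) \<longlonglongrightarrow> (\<integral>x. \<phi> x \<partial>M')"
  by (rule weak_conv_imp_integral_bdd_continuous_conv[OF assms(1-3) _ assms(5)])
    (use assms(4) in \<open>simp add: continuous_on_eq_continuous_at\<close>)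

lemma unit_distr_subseq:
  fixes M :: "nat \<Rightarrow> real measure"
  assumes "\<And>n. unit_distr (M n)"
  obtains r M' where "strict_mono r" "unit_distr M'" "weak_conv_m (\<lambda>n. M (r n)) M'"
proof -
  have "tight M"
    unfolding tight_def
  proof (intro conjI allI impI)
    show "real_distribution (M n)" for n using assms by (simp add: unit_distr_def)
    fix \<epsilon> :: real assume "\<epsilon> > 0"
    then show "\<exists>a b. a < b \<and> (\<forall>n. 1 - \<epsilon> < measure (M n) {a<..b})"
      using unit_distr_measure[OF assms] by (intro exI[of _ "-1"] exI[of _ 1]) simp
  qed
  from tight_imp_convergent_subsubsequence[OF this strict_mono_id]
  obtain r M' where r: "strict_mono r" and M': "real_distribution M'"
    and conv: "weak_conv_m (\<lambda>n. M (r n)) M'"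
    by (auto simp: o_def)
  have "(\<lambda>n. \<integral>x. unit_excess x \<partial>M (r n)) \<longlonglongrightarrow> (\<integral>x. unit_excess x \<partial>M')"
    by (rule weak_conv_integral[OF _ M' conv continuous_on_unit_excess, of 1])
      (use assms in \<open>auto simp: unit_distr_def unit_excess_range\<close>)
  moreover have "(\<lambda>n. \<integral>x. unit_excess x \<partial>M (r n)) = (\<lambda>_. 0)"
    using assms by (simp add: unit_distr_def)
  ultimately have "(\<integral>x. unit_excess x \<partial>M') = 0"
    using LIMSEQ_unique[of "\<lambda>_. 0::real" 0] by simp
  then show thesis
    using that[OF r _ conv] M' by (simp add: unit_distr_def)
qed

text \<open>Invariance under a map and a prescribed rotation vector are both conditions of this
  kind. For continuous functions they survive averaging and weak limits.\<close>

definition lin_meas :: "((torus \<Rightarrow> real) \<times> real) set \<Rightarrow> torus measure set" where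
  "lin_meas \<E> = {\<mu>. torus_prob \<mu> \<and> (\<forall>(\<phi>, c)\<in>\<E>. (\<integral>p. \<phi> p \<partial>\<mu>) = c)}"

lemma distr_real_torus:
  assumes "real_distribution M" "continuous_on UNIV h"
  shows "torus_prob (distr M borel h)"
    and "continuous_on UNIV (\<phi> :: torus \<Rightarrow> real) \<Longrightarrow> (\<integral>p. \<phi> p \<partial>distr M borel h) = (\<integral>x. \<phi> (h x) \<partial>M)"
proof -
  interpret real_distribution M by fact
  have h: "h \<in> borel_measurable M"
    using borel_measurable_continuous_onI[OF assms(2)] by simp
  show "torus_prob (distr M borel h)"
    using prob_space_distr[OF h] by (simp add: torus_prob_def)
  show "(\<integral>p. \<phi> p \<partial>distr M borel h) = (\<integral>x. \<phi> (h x) \<partial>M)" if "continuous_on UNIV \<phi>"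
    by (rule integral_distr_torus[OF h that])
qed

lemma weak_conv_torus:
  fixes \<phi> :: "torus \<Rightarrow> real"
  assumes "\<And>n. real_distribution (M n)" "real_distribution M'" "weak_conv_m M M'"
    and h: "continuous_on UNIV h" and \<phi>: "continuous_on UNIV \<phi>"
  shows "(\<lambda>n. \<integral>p. \<phi> p \<partial>distr (M n) borel h) \<longlonglongrightarrow> (\<integral>p. \<phi> p \<partial>distr M' borel h)"
proof -
  obtain B where "\<And>p. norm (\<phi> p) \<le> B" using torus_bounded[OF \<phi>] by blast
  then have "(\<lambda>n. \<integral>x. \<phi> (h x) \<partial>M n) \<longlonglongrightarrow> (\<integral>x. \<phi> (h x) \<partial>M')"
    by (intro weak_conv_integral[OF assms(1-3)] continuous_on_compose2[OF \<phi> h]) auto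
  then show ?thesis
    using distr_real_torus(2)[OF assms(1) h \<phi>] distr_real_torus(2)[OF assms(2) h \<phi>] by simp
qed

lemma tendsto_fun_componentwise:
  assumes "\<And>i. ((\<lambda>n. f n i) \<longlongrightarrow> l i) F"
  shows "(f \<longlongrightarrow> l) F"
  using assms limitin_componentwise[of "\<lambda>_. euclidean" UNIV f l F]
  by (simp add: euclidean_product_topology)

definition char_rat :: "real measure \<Rightarrow> rat \<Rightarrow> complex" where
  "char_rat M q = char M (of_rat q)"

text \<open>Characteristic functions are continuous, so agreement on the dense set of rationals is
  agreement everywhere.\<close>

lemma char_rat_inject:
  assumes "real_distribution M" "real_distribution M'" "char_rat M = char_rat M'"
  shows "M = M'"
proof (rule Levy_uniqueness[OF assms(1,2)], rule ext)
  fix t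
  have cont: "continuous_on UNIV (\<lambda>t. char M t - char M' t)"
    using real_distribution.isCont_char[OF assms(1)] real_distribution.isCont_char[OF assms(2)]
    by (intro continuous_intros continuous_at_imp_continuous_on) auto
  have "char M t - char M' t = 0"
  proof (rule continuous_constant_on_closure[of \<rat> "\<lambda>t. char M t - char M' t"])
    show "continuous_on (closure \<rat>) (\<lambda>t. char M t - char M' t)"
      using cont continuous_on_subset by blast
    show "\<And>t. t \<in> \<rat> \<Longrightarrow> char M t - char M' t = 0"
      using assms(3) by (auto simp: Rats_def char_rat_def fun_eq_iff)
  qed (simp add: Rats_closure_real)
  then show "char M t = char M' t" by simp
qed

text \<open>Helly's theorem gives a weakly convergent subsequence, the constraints pass to its
  limit, and Levy's continuity theorem turns weak convergence into pointwise convergence of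
  characteristic functions, which is convergence in the product.\<close>

lemma compact_char_rat_image:
  assumes h: "continuous_on UNIV h" and \<E>: "\<And>\<phi> c. (\<phi>, c) \<in> \<E> \<Longrightarrow> continuous_on UNIV \<phi>"
  shows "compact (char_rat ` {M. unit_distr M \<and> distr M borel h \<in> lin_meas \<E>})" (is "compact (_ ` ?S)")
  unfolding compact_eq_seq_compact_metric
proof (rule seq_compactI)
  fix y :: "nat \<Rightarrow> rat \<Rightarrow> complex" assume "\<forall>n. y n \<in> char_rat ` ?S"
  then have "\<forall>n. \<exists>M. M \<in> ?S \<and> y n = char_rat M" by blast
  from choice[OF this] obtain M where M: "\<And>n. M n \<in> ?S" "\<And>n. y n = char_rat (M n)" by blast
  then have rd: "real_distribution (M n)" for n by (auto simp: unit_distr_def)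
  obtain r M' where r: "strict_mono r" and M': "unit_distr M'"
    and conv: "weak_conv_m (\<lambda>n. M (r n)) M'"
    using unit_distr_subseq[of M] M(1) by blast
  have rd': "real_distribution M'" using M' by (simp add: unit_distr_def)
  have "(\<integral>p. \<phi> p \<partial>distr M' borel h) = c" if "(\<phi>, c) \<in> \<E>" for \<phi> c
  proof -
    have "(\<lambda>n. \<integral>p. \<phi> p \<partial>distr (M (r n)) borel h) \<longlonglongrightarrow> (\<integral>p. \<phi> p \<partial>distr M' borel h)"
      by (rule weak_conv_torus[OF rd rd' conv h \<E>[OF that]])
    moreover have "(\<lambda>n. \<integral>p. \<phi> p \<partial>distr (M (r n)) borel h) = (\<lambda>_. c)"
    proof
      fix n
      have "distr (M (r n)) borel h \<in> lin_meas \<E>" using M(1) by simp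
      then show "(\<integral>p. \<phi> p \<partial>distr (M (r n)) borel h) = c" using that by (auto simp: lin_meas_def)
    qed
    ultimately show ?thesis by (simp add: LIMSEQ_const_iff)
  qed
  then have "M' \<in> ?S"
    using M' distr_real_torus(1)[OF rd' h] by (auto simp: lin_meas_def)
  moreover have "(y \<circ> r) \<longlonglongrightarrow> char_rat M'"
    by (rule tendsto_fun_componentwise)
      (simp add: M(2) char_rat_def levy_continuity1[OF rd rd' conv])
  ultimately show "\<exists>l\<in>char_rat ` ?S. \<exists>r. strict_mono r \<and> (y \<circ> r) \<longlonglongrightarrow> l"
    using r by blast
qed

lemma distr_section:
  assumes "torus_prob \<mu>" "continuous_on UNIV h" "g \<in> borel_measurable borel" "\<And>p. h (g p) = p"
  shows "distr (distr \<mu> borel g) borel h = \<mu>"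
proof -
  have g: "g \<in> borel_measurable \<mu>"
    using assms(3) torus_probD(2)[OF assms(1)] by (simp cong: measurable_cong_sets)
  have "distr (distr \<mu> borel g) borel h = distr \<mu> borel (h \<circ> g)"
    by (rule distr_distr[OF borel_measurable_continuous_onI[OF assms(2)] g])
  also have "\<dots> = distr \<mu> \<mu> (\<lambda>p. p)"
    by (rule distr_cong) (use assms torus_probD in auto)
  finally show ?thesis by (simp add: distr_id)
qed

text \<open>The family of constraints may be uncountable, but Helly's theorem only gives sequential
  compactness. Characteristic functions at rational arguments embed the measures in a metrizable
  product, where sequentially compact sets are compact.\<close>

lemma lin_meas_finite_intersection:
  assumes \<E>: "\<And>\<phi> c. (\<phi>, c) \<in> \<E> \<Longrightarrow> continuous_on UNIV \<phi>"
    and fin: "\<And>\<E>'. \<E>' \<subseteq> \<E> \<Longrightarrow> finite \<E>' \<Longrightarrow> lin_meas \<E>' \<noteq> {}"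
  shows "lin_meas \<E> \<noteq> {}"
proof -
  obtain h :: "real \<Rightarrow> torus" and g :: "torus \<Rightarrow> real"
    where h: "continuous_on UNIV h" and g: "g \<in> borel_measurable borel" "\<And>p. h (g p) = p"
      "\<And>p. g p \<in> {0..1}" using torus_curve by metis
  define S where "S \<F> = {M. unit_distr M \<and> distr M borel h \<in> lin_meas \<F>}" for \<F>
  \<comment> \<open>Injectivity turns a common point of all images into one measure that satisfies
    all constraints.\<close>
  have inj: "M = M'" if "char_rat M = char_rat M'" "M \<in> S \<F>" "M' \<in> S \<F>'" for M M' \<F> \<F>'
    using char_rat_inject[OF _ _ that(1)] that by (simp add: S_def unit_distr_def)
  have "char_rat ` S {} \<inter> (\<Inter>e\<in>\<E>. char_rat ` S {e}) \<noteq> {}"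
  proof (rule compact_imp_fip_image)
    show "compact (char_rat ` S {})"
      unfolding S_def by (rule compact_char_rat_image[OF h]) simp
    show "closed (char_rat ` S {e})" if "e \<in> \<E>" for e
      unfolding S_def
      by (rule compact_imp_closed, rule compact_char_rat_image[OF h]) (use \<E> that in auto)
    fix I' assume "finite I'" "I' \<subseteq> \<E>"
    then obtain \<mu> where \<mu>: "\<mu> \<in> lin_meas I'" using fin by blast
    then have prob: "torus_prob \<mu>" by (simp add: lin_meas_def)
    have "distr \<mu> borel g \<in> S \<F>" if "\<F> \<subseteq> I'" for \<F>
      using \<mu> that unit_distr_distr[OF prob g(1,3)] distr_section[OF prob h g(1,2)]
      by (auto simp: S_def lin_meas_def)
    then show "char_rat ` S {} \<inter> (\<Inter>i\<in>I'. char_rat ` S {i}) \<noteq> {}"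
      by (metis (no_types, lifting) INT_I IntI empty_iff empty_subsetI image_eqI insert_subset)
  qed
  then obtain y where y: "y \<in> char_rat ` S {}" "\<And>e. e \<in> \<E> \<Longrightarrow> y \<in> char_rat ` S {e}" by blast
  then obtain M where M: "M \<in> S {}" "y = char_rat M" by blast
  have "M \<in> S {e}" if "e \<in> \<E>" for e
  proof -
    from y(2)[OF that] obtain M' where "M' \<in> S {e}" "y = char_rat M'" by blast
    then show ?thesis using inj[of M M' "{}" "{e}"] M by simp
  qed
  then have "distr M borel h \<in> lin_meas \<E>"
    using M(1) by (auto simp: S_def lin_meas_def)
  then show ?thesis by blast
qed

section \<open>Averages along iterates and fixed measures\<close>

lemma continuous_on_funpow:
  fixes a :: "'a::topological_space \<Rightarrow> 'a"
  assumes "continuous_on UNIV a"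
  shows "continuous_on UNIV (a ^^ n)"
proof (induction n)
  case (Suc n)
  then show ?case
    using continuous_on_compose2[OF assms Suc] by (simp add: o_def)
qed (simp add: continuous_on_id)

text \<open>The average is the law of \<open>(a ^^ i) p\<close>, where \<open>i\<close> is uniform
  on \<open>{..n}\<close> and \<open>p\<close> is independent of it with law \<open>\<mu>\<close>;
  Fubini's theorem computes its integrals.\<close>

lemma averaged_measure:
  assumes \<mu>: "torus_prob \<mu>" and a: "continuous_on UNIV a"
  obtains \<nu> where "torus_prob \<nu>"
    "\<And>\<phi> :: torus \<Rightarrow> real. continuous_on UNIV \<phi> \<Longrightarrow>
      (\<integral>p. \<phi> p \<partial>\<nu>) = (\<Sum>i\<le>n. \<integral>p. \<phi> ((a ^^ i) p) \<partial>\<mu>) / real (Suc n)"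
proof -
  define P where "P = measure_pmf (pmf_of_set {..n})"
  interpret P: prob_space P unfolding P_def by (rule prob_space_measure_pmf)
  interpret prob_space \<mu> using torus_probD(1)[OF \<mu>] .
  interpret PM: pair_prob_space P \<mu> ..
  define X where "X = (\<lambda>(i, p). (a ^^ i) p)"
  have "X \<in> borel_measurable (count_space UNIV \<Otimes>\<^sub>M \<mu>)"
    unfolding X_def
    by (rule measurable_pair_measure_countable1)
      (simp_all add: torus_measurable[OF \<mu> continuous_on_funpow[OF a]])
  then have X: "X \<in> borel_measurable (P \<Otimes>\<^sub>M \<mu>)"
    by (subst measurable_cong_sets[OF sets_pair_measure_cong[of P "count_space UNIV" \<mu> \<mu>] refl])
      (simp_all add: P_def)
  show thesis
  proof
    show "torus_prob (distr (P \<Otimes>\<^sub>M \<mu>) borel X)"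
      using PM.prob_space_distr[OF X] by (simp add: torus_prob_def)
    fix \<phi> :: "torus \<Rightarrow> real" assume \<phi>: "continuous_on UNIV \<phi>"
    obtain B where B: "\<And>p. norm (\<phi> p) \<le> B" using torus_bounded[OF \<phi>] by blast
    have int: "integrable (P \<Otimes>\<^sub>M \<mu>) (\<lambda>z. \<phi> (X z))"
      by (rule PM.integrable_const_bound[of _ B])
        (use B measurable_compose[OF X borel_measurable_continuous_onI[OF \<phi>]] in auto)
    have "(\<integral>p. \<phi> p \<partial>distr (P \<Otimes>\<^sub>M \<mu>) borel X) = (\<integral>z. \<phi> (X z) \<partial>(P \<Otimes>\<^sub>M \<mu>))"
      by (rule integral_distr_torus[OF X \<phi>])
    also have "\<dots> = (\<integral>i. (\<integral>p. \<phi> ((a ^^ i) p) \<partial>\<mu>) \<partial>P)"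
      using PM.integral_fst'[OF int] by (simp add: X_def)
    also have "\<dots> = (\<Sum>i\<le>n. (\<integral>p. \<phi> ((a ^^ i) p) \<partial>\<mu>) * pmf (pmf_of_set {..n}) i)"
      unfolding P_def by (rule integral_measure_pmf_real) (auto simp: set_pmf_of_set)
    also have "\<dots> = (\<Sum>i\<le>n. (\<integral>p. \<phi> ((a ^^ i) p) \<partial>\<mu>) / real (Suc n))"
      by (rule sum.cong) (auto simp: pmf_of_set)
    finally show "(\<integral>p. \<phi> p \<partial>distr (P \<Otimes>\<^sub>M \<mu>) borel X) = (\<Sum>i\<le>n. \<integral>p. \<phi> ((a ^^ i) p) \<partial>\<mu>) / real (Suc n)"
      by (simp add: sum_divide_distrib)
  qed
qed

text \<open>The Krylov-Bogolyubov argument inside \<open>lin_meas\<close>, which is the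
  Markov-Kakutani step for a single map. All iterates of the initial measure satisfy the
  constraints, hence so do their averages and a subsequential weak limit.\<close>

lemma lin_meas_fixed_point:
  assumes ne: "lin_meas \<E> \<noteq> {}" and \<E>: "\<And>\<phi> c. (\<phi>, c) \<in> \<E> \<Longrightarrow> continuous_on UNIV \<phi>"
    and a: "continuous_on UNIV a"
    and inv: "\<And>\<mu>. \<mu> \<in> lin_meas \<E> \<Longrightarrow> distr \<mu> borel a \<in> lin_meas \<E>"
  obtains \<mu> where "\<mu> \<in> lin_meas \<E>" "distr \<mu> borel a = \<mu>"
proof -
  obtain h :: "real \<Rightarrow> torus" and g :: "torus \<Rightarrow> real"
    where h: "continuous_on UNIV h" and g: "g \<in> borel_measurable borel" "\<And>p. h (g p) = p"
      "\<And>p. g p \<in> {0..1}" using torus_curve by metis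
  obtain \<mu>0 where \<mu>0: "\<mu>0 \<in> lin_meas \<E>" using ne by blast
  then have prob0: "torus_prob \<mu>0" by (simp add: lin_meas_def)
  have "\<exists>\<nu>. torus_prob \<nu> \<and> (\<forall>\<phi> :: torus \<Rightarrow> real. continuous_on UNIV \<phi> \<longrightarrow>
      (\<integral>p. \<phi> p \<partial>\<nu>) = (\<Sum>i\<le>n. \<integral>p. \<phi> ((a ^^ i) p) \<partial>\<mu>0) / real (Suc n))" for n
    using averaged_measure[OF prob0 a, of n] by metis
  then obtain \<nu> where \<nu>: "\<And>n. torus_prob (\<nu> n)"
    and avg: "\<And>n \<phi> :: torus \<Rightarrow> real. continuous_on UNIV \<phi> \<Longrightarrow>
      (\<integral>p. \<phi> p \<partial>\<nu> n) = (\<Sum>i\<le>n. \<integral>p. \<phi> ((a ^^ i) p) \<partial>\<mu>0) / real (Suc n)"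
    by metis
  define M where "M n = distr (\<nu> n) borel g" for n
  have M: "unit_distr (M n)" for n unfolding M_def by (rule unit_distr_distr[OF \<nu> g(1,3)])
  have M_h: "distr (M n) borel h = \<nu> n" for n
    unfolding M_def by (rule distr_section[OF \<nu> h g(1,2)])
  obtain r M' where r: "strict_mono r" and M': "unit_distr M'"
    and conv: "weak_conv_m (\<lambda>n. M (r n)) M'"
    using unit_distr_subseq[of M] M by blast
  define \<mu> where "\<mu> = distr M' borel h"
  have rd: "real_distribution (M n)" "real_distribution M'" for n
    using M M' by (simp_all add: unit_distr_def)
  have \<mu>: "torus_prob \<mu>" unfolding \<mu>_def by (rule distr_real_torus(1)[OF rd(2) h])
  have lim: "(\<lambda>n. \<integral>p. \<phi> p \<partial>\<nu> (r n)) \<longlonglongrightarrow> (\<integral>p. \<phi> p \<partial>\<mu>)"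
    if "continuous_on UNIV \<phi>" for \<phi> :: "torus \<Rightarrow> real"
    using weak_conv_torus[OF rd(1) rd(2) conv h that] by (simp add: M_h \<mu>_def)
  have iter: "distr \<mu>0 borel (a ^^ i) \<in> lin_meas \<E>" for i
  proof (induction i)
    case 0
    have "distr \<mu>0 borel (\<lambda>p. p) = distr \<mu>0 \<mu>0 (\<lambda>p. p)"
      by (rule distr_cong) (use torus_probD[OF prob0] in auto)
    then show ?case using \<mu>0 by (simp add: distr_id id_def)
  next
    case (Suc i)
    have "distr (distr \<mu>0 borel (a ^^ i)) borel a = distr \<mu>0 borel (a ^^ Suc i)"
      by (simp add: distr_distr[OF borel_measurable_continuous_onI[OF a]
            torus_measurable[OF prob0 continuous_on_funpow[OF a]]])
    then show ?case using inv[OF Suc] by (metis funpow.simps(2))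
  qed
  have "(\<integral>p. \<phi> p \<partial>\<mu>) = c" if e: "(\<phi>, c) \<in> \<E>" for \<phi> c
  proof -
    have "(\<integral>p. \<phi> ((a ^^ i) p) \<partial>\<mu>0) = c" for i
    proof -
      have "(\<integral>p. \<phi> p \<partial>distr \<mu>0 borel (a ^^ i)) = c" using iter[of i] e by (auto simp: lin_meas_def)
      then show ?thesis
        using integral_distr_torus[OF torus_measurable[OF prob0 continuous_on_funpow[OF a]] \<E>[OF e], of i]
        by simp
    qed
    then have "(\<lambda>n. \<integral>p. \<phi> p \<partial>\<nu> (r n)) = (\<lambda>_. c)"
      by (simp add: avg[OF \<E>[OF e]] del: of_nat_Suc)
    then show ?thesis using lim[OF \<E>[OF e]] by (simp add: LIMSEQ_const_iff)
  qed
  then have in_lin: "\<mu> \<in> lin_meas \<E>" using \<mu> by (auto simp: lin_meas_def)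
  have "distr \<mu> borel a = \<mu>"
  proof (rule torus_measure_eqI[OF torus_prob_distr[OF \<mu> a] \<mu>])
    fix \<phi> :: "torus \<Rightarrow> real" assume \<phi>: "continuous_on UNIV \<phi>"
    have \<phi>a: "continuous_on UNIV (\<lambda>p. \<phi> (a p))" by (rule continuous_on_compose2[OF \<phi> a]) simp
    obtain B where B: "\<And>p. norm (\<phi> p) \<le> B" using torus_bounded[OF \<phi>] by blast
    define s where "s i = (\<integral>p. \<phi> ((a ^^ i) p) \<partial>\<mu>0)" for i
    interpret prob_space \<mu>0 using torus_probD(1)[OF prob0] .
    have s_bound: "\<bar>s i\<bar> \<le> B" for i
    proof -
      have c: "continuous_on UNIV (\<lambda>p. \<phi> ((a ^^ i) p))"
        by (rule continuous_on_compose2[OF \<phi> continuous_on_funpow[OF a]]) simp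
      have "\<bar>s i\<bar> \<le> (\<integral>p. \<bar>\<phi> ((a ^^ i) p)\<bar> \<partial>\<mu>0)"
        unfolding s_def by (rule integral_abs_bound)
      also have "\<dots> \<le> (\<integral>p. B \<partial>\<mu>0)"
        by (rule integral_mono) (use torus_integrable[OF prob0 c] B in auto)
      finally show ?thesis by (simp add: prob_space)
    qed
    \<comment> \<open>Applying \<open>a\<close> shifts the sum by one index, so only two boundary
      terms survive the subtraction.\<close>
    have diff: "(\<integral>p. \<phi> (a p) \<partial>\<nu> n) - (\<integral>p. \<phi> p \<partial>\<nu> n) = (s (Suc n) - s 0) / real (Suc n)" for n
    proof -
      have "(\<Sum>i\<le>n. s (Suc i)) - (\<Sum>i\<le>n. s i) = s (Suc n) - s 0"
        by (induction n) simp_all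
      moreover have "(\<integral>p. \<phi> (a p) \<partial>\<nu> n) = (\<Sum>i\<le>n. s (Suc i)) / real (Suc n)"
        unfolding avg[OF \<phi>a] s_def by simp
      ultimately show ?thesis
        unfolding avg[OF \<phi>] s_def[symmetric] by (simp add: diff_divide_distrib[symmetric])
    qed
    have "(\<lambda>n. (\<integral>p. \<phi> (a p) \<partial>\<nu> n) - (\<integral>p. \<phi> p \<partial>\<nu> n)) \<longlonglongrightarrow> 0"
    proof (rule Lim_null_comparison)
      show "\<forall>\<^sub>F n in sequentially. norm ((\<integral>p. \<phi> (a p) \<partial>\<nu> n) - (\<integral>p. \<phi> p \<partial>\<nu> n)) \<le> 2 * B * inverse (real (Suc n))"
      proof (intro always_eventually allI)
        fix n
        have "\<bar>s (Suc n) - s 0\<bar> \<le> 2 * B" using s_bound[of "Suc n"] s_bound[of 0] by linarith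
        then show "norm ((\<integral>p. \<phi> (a p) \<partial>\<nu> n) - (\<integral>p. \<phi> p \<partial>\<nu> n)) \<le> 2 * B * inverse (real (Suc n))"
          unfolding diff divide_inverse real_norm_def abs_mult
          by (simp add: mult_right_mono del: of_nat_Suc)
      qed
      show "(\<lambda>n. 2 * B * inverse (real (Suc n))) \<longlonglongrightarrow> 0"
        using tendsto_mult_right_zero[OF LIMSEQ_inverse_real_of_nat] .
    qed
    then have "(\<lambda>n. (\<integral>p. \<phi> (a p) \<partial>\<nu> (r n)) - (\<integral>p. \<phi> p \<partial>\<nu> (r n))) \<longlonglongrightarrow> 0"
      using LIMSEQ_subseq_LIMSEQ[OF _ r] by (fastforce simp: o_def)
    moreover have "(\<lambda>n. (\<integral>p. \<phi> (a p) \<partial>\<nu> (r n)) - (\<integral>p. \<phi> p \<partial>\<nu> (r n))) \<longlonglongrightarrow> (\<integral>p. \<phi> (a p) \<partial>\<mu>) - (\<integral>p. \<phi> p \<partial>\<mu>)"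
      by (intro tendsto_diff lim \<phi> \<phi>a)
    ultimately have "(\<integral>p. \<phi> (a p) \<partial>\<mu>) - (\<integral>p. \<phi> p \<partial>\<mu>) = 0"
      using LIMSEQ_unique by blast
    then show "(\<integral>p. \<phi> p \<partial>distr \<mu> borel a) = (\<integral>p. \<phi> p \<partial>\<mu>)"
      by (simp add: integral_distr_torus[OF torus_measurable[OF \<mu> a] \<phi>])
  qed
  then show thesis using that in_lin by blast
qed

section \<open>Nilpotent groups of integer matrices\<close>

lemma mat2_eq_iff:
  fixes A B :: "'a^2^2"
  shows "A = B \<longleftrightarrow> A$1$1 = B$1$1 \<and> A$1$2 = B$1$2 \<and> A$2$1 = B$2$1 \<and> A$2$2 = B$2$2"
  by (auto simp: vec_eq_iff forall_2)

lemma mat2_mult_component: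
  fixes A B :: "'a::semiring_1^2^2"
  shows "(A ** B) $ i $ j = A $ i $ 1 * B $ 1 $ j + A $ i $ 2 * B $ 2 $ j"
  by (simp add: matrix_matrix_mult_def sum_2)

lemmas mat2_simps = mat2_eq_iff mat2_mult_component mat_def det_2

lemma int_unit_cases: "(x::int) * y = 1 \<Longrightarrow> x = 1 \<or> x = -1"
  using zmult_eq_1_iff by blast

text \<open>The identities say that the traceless parts of \<open>X\<close> and \<open>C\<close>, as
  vectors with three coordinates, are parallel.\<close>

lemma commuting_entries:
  fixes C X :: "int^2^2"
  assumes "X ** C = C ** X"
  shows "X$1$2 * C$2$1 = X$2$1 * C$1$2" "X$1$2 * (C$1$1 - C$2$2) = (X$1$1 - X$2$2) * C$1$2"
    "X$2$1 * (C$1$1 - C$2$2) = (X$1$1 - X$2$2) * C$2$1"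
proof -
  have entry: "X$i$1 * C$1$j + X$i$2 * C$2$j = C$i$1 * X$1$j + C$i$2 * X$2$j" for i j
    using arg_cong[OF assms, of "\<lambda>M. M $ i $ j"] by (simp only: mat2_mult_component)
  show "X$1$2 * C$2$1 = X$2$1 * C$1$2" using entry[of 1 1] by (simp add: algebra_simps)
  show "X$1$2 * (C$1$1 - C$2$2) = (X$1$1 - X$2$2) * C$1$2" using entry[of 1 2] by (simp add: algebra_simps)
  show "X$2$1 * (C$1$1 - C$2$2) = (X$1$1 - X$2$2) * C$2$1" using entry[of 2 1] by (simp add: algebra_simps)
qed

text \<open>By Cayley-Hamilton the square of \<open>C\<close> is the scalar e = - det C, and a
  commuting \<open>X\<close> satisfies 2 X = a + b C, where a is the trace of \<open>X\<close> and b
  is e times the trace of \<open>X ** C\<close>. Hence a^2 - e b^2 = 4 det X, whose solutions can be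
  listed: for e = -1 by size, for e = 1 by factoring.\<close>

lemma commutant_traceless:
  fixes C X :: "int^2^2"
  assumes C: "C$1$1 + C$2$2 = 0" "\<bar>det C\<bar> = 1"
    and comm: "X ** C = C ** X" and X: "\<bar>det X\<bar> = 1"
  shows "X \<in> {mat 1, - mat 1, C, - C}"
proof -
  define p q r where "p = C$1$1" and "q = C$1$2" and "r = C$2$1"
  define x y z w where "x = X$1$1" and "y = X$1$2" and "z = X$2$1" and "w = X$2$2"
  have C22: "C$2$2 = - p" using C(1) by (simp add: p_def)
  define e where "e = p * p + q * r"
  have e: "e = 1 \<or> e = -1"
    using C(2) by (auto simp: det_2 C22 e_def simp flip: p_def q_def r_def)
  have cc: "y * r = z * q" "2 * p * y = q * (x - w)" "2 * p * z = r * (x - w)"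
  proof -
    have "C$2$2 = - C$1$1" using C(1) by simp
    then show "y * r = z * q" "2 * p * y = q * (x - w)" "2 * p * z = r * (x - w)"
      unfolding p_def q_def r_def x_def y_def z_def w_def
      using commuting_entries[OF comm] by (simp_all add: algebra_simps)
  qed
  define b where "b = e * ((x - w) * p + 2 * y * r)"
  have e2: "e * e = 1" using e by auto
  have bp: "b * p = x - w"
  proof -
    have "b * p = e * ((x - w) * p * p + (2 * p * y) * r)" by (simp add: b_def algebra_simps)
    also have "\<dots> = e * e * (x - w)" unfolding cc(2) by (simp add: e_def algebra_simps)
    finally show ?thesis using e2 by simp
  qed
  have bq: "b * q = 2 * y"
  proof -
    have "b * q = e * (p * (q * (x - w)) + 2 * y * r * q)" by (simp add: b_def algebra_simps)
    also have "\<dots> = e * e * (2 * y)" unfolding cc(2)[symmetric] by (simp add: e_def algebra_simps)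
    finally show ?thesis using e2 by simp
  qed
  have br: "b * r = 2 * z"
  proof -
    have "b * r = e * (p * (r * (x - w)) + 2 * (y * r) * r)" by (simp add: b_def algebra_simps)
    also have "\<dots> = e * e * (2 * z)" unfolding cc(3)[symmetric] cc(1) by (simp add: e_def algebra_simps)
    finally show ?thesis using e2 by simp
  qed
  define a where "a = x + w"
  have "a * a - e * (b * b) = 4 * (x * w - y * z)"
  proof -
    have "e * (b * b) = (b * p) * (b * p) + (b * q) * (b * r)" by (simp add: e_def algebra_simps)
    then show ?thesis unfolding bp bq br by (simp add: a_def algebra_simps)
  qed
  moreover have "x * w - y * z = 1 \<or> x * w - y * z = -1"
    using X by (auto simp: det_2 simp flip: x_def y_def z_def w_def)
  ultimately have norm: "a * a - e * (b * b) = 4 \<or> a * a - e * (b * b) = -4" by auto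
  have ab: "(a = 2 \<and> b = 0) \<or> (a = -2 \<and> b = 0) \<or> (a = 0 \<and> b = 2) \<or> (a = 0 \<and> b = -2)"
    using e
  proof
    assume e1: "e = -1"
    then have sum: "a * a + b * b = 4" using norm by (auto simp: add_nonneg_eq_0_iff) (smt (verit) zero_le_square)
    then have "a * a \<le> 2 * 2" "b * b \<le> 2 * 2" using zero_le_square[of a] zero_le_square[of b] by linarith+
    then have "\<bar>a\<bar> \<le> 2" "\<bar>b\<bar> \<le> 2"
      using abs_le_square_iff[of a 2] abs_le_square_iff[of b 2] by (simp_all add: power2_eq_square)
    then have "a \<in> {-2,-1,0,1,2}" "b \<in> {-2,-1,0,1,2}" by auto
    then show ?thesis using sum by auto
  next
    assume e1: "e = 1"
    \<comment> \<open>\<open>a + b\<close> and \<open>a - b\<close> have equal parity and product 4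
      or -4, so each of them is 2 or -2.\<close>
    have par: "even (a + b)"
    proof -
      have "a * a - b * b = 4 \<or> a * a - b * b = -4" using norm e1 by simp
      then have "even (a * a - b * b)" by (elim disjE) (simp_all only: even_numeral even_minus)
      then show ?thesis by simp
    qed
    then obtain s where s: "a + b = 2 * s" by blast
    then have t: "a - b = 2 * (s - b)" by simp
    have "(a + b) * (a - b) = 4 \<or> (a + b) * (a - b) = -4" using norm e1 by (simp add: algebra_simps)
    moreover have "(a + b) * (a - b) = 4 * (s * (s - b))" unfolding s t by simp
    ultimately have "s * (s - b) = 1 \<or> s * (s - b) = -1" by linarith
    then have "s * (s - b) = 1 \<or> s * (b - s) = 1" by (auto simp: algebra_simps)
    then have "(s = 1 \<or> s = -1) \<and> (s - b = 1 \<or> s - b = -1)"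
      using int_unit_cases[of s "s - b"] int_unit_cases[of "s - b" s]
        int_unit_cases[of s "b - s"] int_unit_cases[of "b - s" s] by (auto simp: mult.commute)
    then show ?thesis using s by auto
  qed
  have xyzw: "2 * x = a + b * p" "2 * y = b * q" "2 * z = b * r" "2 * w = a - b * p"
    using bp bq br by (simp_all add: a_def)
  consider "a = 2" "b = 0" | "a = -2" "b = 0" | "a = 0" "b = 2" | "a = 0" "b = -2" using ab by blast
  then show ?thesis
  proof cases
    case 1
    then have "x = 1" "y = 0" "z = 0" "w = 1" using xyzw by simp_all
    then have "X = mat 1" by (simp add: mat2_eq_iff mat_def x_def y_def z_def w_def)
    then show ?thesis by simp
  next
    case 2
    then have "x = -1" "y = 0" "z = 0" "w = -1" using xyzw by simp_all
    then have "X = - mat 1" by (simp add: mat2_eq_iff mat_def x_def y_def z_def w_def)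
    then show ?thesis by simp
  next
    case 3
    then have "x = p" "y = q" "z = r" "w = - p" using xyzw by simp_all
    then have "X = C" using C22 by (simp add: mat2_eq_iff x_def y_def z_def w_def p_def q_def r_def)
    then show ?thesis by simp
  next
    case 4
    then have "x = - p" "y = - q" "z = - r" "w = p" using xyzw by simp_all
    then have "X = - C" using C22 by (simp add: mat2_eq_iff x_def y_def z_def w_def p_def q_def r_def)
    then show ?thesis by simp
  qed
qed

text \<open>Conjugation by \<open>X\<close> sends \<open>C\<close> to its negative, so the trace
  equals its negative. Over the integers the inverse is replaced by the adjugate: the combination of
  the entries \<open>e\<close> is the trace of adj(X) (XC + CX).\<close>

lemma anticommute_traceless:
  fixes C X :: "int^2^2"
  assumes "X ** C = - (C ** X)" "det X \<noteq> 0"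
  shows "C$1$1 + C$2$2 = 0"
proof -
  define t where "t = C$1$1 + C$2$2"
  define e where "e i j = (X ** C) $ i $ j + (C ** X) $ i $ j" for i j
  have e: "e i j = 0" for i j using assms(1) by (simp add: e_def)
  have "2 * (det X * t) = X$2$2 * e 1 1 - X$1$2 * e 2 1 - X$2$1 * e 1 2 + X$1$1 * e 2 2"
    by (simp add: det_2 t_def e_def mat2_mult_component algebra_simps)
  then have "det X * t = 0" by (simp add: e)
  then show ?thesis using assms(2) by (simp add: t_def)
qed

lemma parallel_cross:
  fixes ck xk xi ci xj cj yk yi yj :: int
  assumes "ck \<noteq> 0" "xi * ck = xk * ci" "xj * ck = xk * cj" "yi * ck = yk * ci" "yj * ck = yk * cj"
  shows "xi * yj = xj * yi"
proof -
  have "(xi * ck) * (yj * ck) = (xj * ck) * (yi * ck)" unfolding assms(2-5) by simp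
  then have "(xi * yj) * (ck * ck) = (xj * yi) * (ck * ck)" by (simp only: mult_ac)
  then show ?thesis using assms(1) by simp
qed

text \<open>The traceless parts of \<open>X\<close> and \<open>Y\<close> are both parallel to that
  of \<open>C\<close>, which is nonzero, hence to each other. The commutator of 2 x 2 matrices
  depends only on the minors of their traceless parts, so it vanishes.\<close>

lemma commutant_commutative:
  fixes C X Y :: "int^2^2"
  assumes C: "C$1$2 \<noteq> 0 \<or> C$2$1 \<noteq> 0 \<or> C$1$1 \<noteq> C$2$2"
    and X: "X ** C = C ** X" and Y: "Y ** C = C ** Y"
  shows "X ** Y = Y ** X"
proof -
  define p q r where "p = C$1$2" and "q = C$2$1" and "r = C$1$1 - C$2$2"
  define x1 x2 x3 where "x1 = X$1$2" and "x2 = X$2$1" and "x3 = X$1$1 - X$2$2"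
  define y1 y2 y3 where "y1 = Y$1$2" and "y2 = Y$2$1" and "y3 = Y$1$1 - Y$2$2"
  have x: "x1 * q = x2 * p" "x1 * r = x3 * p" "x2 * r = x3 * q"
    unfolding p_def q_def r_def x1_def x2_def x3_def by (rule commuting_entries[OF X])+
  have y: "y1 * q = y2 * p" "y1 * r = y3 * p" "y2 * r = y3 * q"
    unfolding p_def q_def r_def y1_def y2_def y3_def by (rule commuting_entries[OF Y])+
  have cross: "x1 * y2 = x2 * y1 \<and> x1 * y3 = x3 * y1 \<and> x2 * y3 = x3 * y2"
  proof -
    consider "p \<noteq> 0" | "q \<noteq> 0" | "r \<noteq> 0" using C by (auto simp: p_def q_def r_def)
    then show ?thesis
    proof cases
      case 1
      have "x1 * y2 = x2 * y1"
        by (rule parallel_cross[of p x1 x1 p x2 q y1 y1 y2]) (use x y 1 in simp_all)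
      moreover have "x1 * y3 = x3 * y1"
        by (rule parallel_cross[of p x1 x1 p x3 r y1 y1 y3]) (use x y 1 in simp_all)
      moreover have "x2 * y3 = x3 * y2"
        by (rule parallel_cross[of p x2 x1 q x3 r y2 y1 y3]) (use x y 1 in simp_all)
      ultimately show ?thesis by blast
    next
      case 2
      have "x1 * y2 = x2 * y1"
        by (rule parallel_cross[of q x1 x2 p x2 q y1 y2 y2]) (use x y 2 in simp_all)
      moreover have "x1 * y3 = x3 * y1"
        by (rule parallel_cross[of q x1 x2 p x3 r y1 y2 y3]) (use x y 2 in simp_all)
      moreover have "x2 * y3 = x3 * y2"
        by (rule parallel_cross[of q x2 x2 q x3 r y2 y2 y3]) (use x y 2 in simp_all)
      ultimately show ?thesis by blast
    next
      case 3
      have "x1 * y2 = x2 * y1"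
        by (rule parallel_cross[of r x1 x3 p x2 q y1 y3 y2]) (use x y 3 in simp_all)
      moreover have "x1 * y3 = x3 * y1"
        by (rule parallel_cross[of r x1 x3 p x3 r y1 y3 y3]) (use x y 3 in simp_all)
      moreover have "x2 * y3 = x3 * y2"
        by (rule parallel_cross[of r x2 x3 q x3 r y2 y3 y3]) (use x y 3 in simp_all)
      ultimately show ?thesis by blast
    qed
  qed
  then show ?thesis
    unfolding mat2_eq_iff x1_def x2_def x3_def y1_def y2_def y3_def
    by (simp add: mat2_mult_component algebra_simps)
qed

text \<open>A scalar matrix of determinant 1 or -1 has determinant 1, being the square of the
  scalar, so the scalar is 1 or -1.\<close>

lemma scalar_unit:
  fixes C :: "int^2^2"
  assumes "\<bar>det C\<bar> = 1" "C \<noteq> mat 1" "C \<noteq> - mat 1"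
  shows "C$1$2 \<noteq> 0 \<or> C$2$1 \<noteq> 0 \<or> C$1$1 \<noteq> C$2$2"
proof (rule ccontr)
  assume "\<not> ?thesis"
  then have C: "C$1$2 = 0" "C$2$1 = 0" "C$1$1 = C$2$2" by auto
  then have "C$2$2 * C$2$2 = 1"
    using assms(1) zero_le_square[of "C$2$2"] by (auto simp: det_2 abs_if split: if_splits)
  then show False
    using int_unit_cases C assms(2,3) by (auto simp: mat2_simps)
qed

section \<open>Reduction modulo 3\<close>

type_synonym quad = "int \<times> int \<times> int \<times> int"

text \<open>Residue matrices are plain quadruples, so that a claim about all 81 of them can be
  decided by evaluation.\<close>

definition mod3 :: "int^2^2 \<Rightarrow> quad" where
  "mod3 A = (A$1$1 mod 3, A$1$2 mod 3, A$2$1 mod 3, A$2$2 mod 3)"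

fun mul3 :: "quad \<Rightarrow> quad \<Rightarrow> quad" where
  "mul3 (a, b, c, d) (a', b', c', d') =
    ((a * a' + b * c') mod 3, (a * b' + b * d') mod 3, (c * a' + d * c') mod 3, (c * b' + d * d') mod 3)"

lemma mod3_add_mult:
  "((a::int) mod 3 * (b mod 3) + c mod 3 * (d mod 3)) mod 3 = (a * b + c * d) mod 3"
  by (intro mod_add_cong mod_mult_cong) simp_all

lemma mod3_diff_mult:
  "((a::int) mod 3 * (b mod 3) - c mod 3 * (d mod 3)) mod 3 = (a * b - c * d) mod 3"
  by (intro mod_diff_cong mod_mult_cong) simp_all

lemma mod3_mult: "mod3 (A ** B) = mul3 (mod3 A) (mod3 B)"
  by (simp add: mod3_def mat2_mult_component mod3_add_mult)

lemma mod3_one: "mod3 (mat 1) = (1, 0, 0, 1)"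
  by (simp add: mod3_def mat_def)

definition quads3 :: "quad list" where
  "quads3 = List.product [0,1,2] (List.product [0,1,2] (List.product [0,1,2] [0,1,2]))"

lemma mod3_int_cases: "(x::int) mod 3 \<in> {0, 1, 2}"
  by auto

lemma set_quads3: "set quads3 = {0,1,2} \<times> {0,1,2} \<times> {0,1,2} \<times> {0,1,2}"
  by (simp add: quads3_def)

lemma mod3_in_quads3: "mod3 A \<in> set quads3"
  unfolding mod3_def set_quads3 by (intro SigmaI mod3_int_cases)

text \<open>The exponents 3, 6, 12, 24 are reached in turn. The number 24 is the exponent of
  GL(2,3), whose element orders are 1, 2, 3, 4, 6 and 8.\<close>

fun pow24 :: "quad \<Rightarrow> quad" where
  "pow24 x = (let y = mul3 x (mul3 x x); z = mul3 y y; w = mul3 z z in mul3 w w)"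

lemma pow24_list: "list_all (\<lambda>(a,b,c,d). (a * d - b * c) mod 3 = 0 \<or> pow24 (a,b,c,d) = (1,0,0,1)) quads3"
  by code_simp

lemma pow24_eq_one:
  assumes "\<bar>det A\<bar> = 1"
  shows "pow24 (mod3 A) = (1, 0, 0, 1)"
proof -
  have "(A$1$1 mod 3 * (A$2$2 mod 3) - A$1$2 mod 3 * (A$2$1 mod 3)) mod 3 = det A mod 3"
    by (simp only: det_2 mod3_diff_mult)
  also have "\<dots> \<noteq> 0" using assms by (auto simp: abs_if split: if_splits)
  finally show ?thesis
    using pow24_list mod3_in_quads3[of A] by (auto simp: list_all_iff mod3_def simp del: pow24.simps)
qed

text \<open>A matrix commuting with \<open>c\<close> is determined by two of its entries: by its
  first column if \<open>c21\<close> is nonzero, since then the first basis vector is cyclic for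
  \<open>c\<close>, by its second column if \<open>c12\<close> is nonzero, and by its diagonal if
  \<open>c\<close> is diagonal with distinct entries. Of the 9 pairs, (0, 0) would give the zero
  matrix.\<close>

lemma commutant_mod3_card:
  assumes S: "S \<subseteq> set quads3" "(0,0,0,0) \<notin> S"
    and c: "(c11, c12, c21, c22) \<in> set quads3" "c12 \<noteq> 0 \<or> c21 \<noteq> 0 \<or> c11 \<noteq> c22"
    and comm: "\<And>x. x \<in> S \<Longrightarrow> mul3 (c11, c12, c21, c22) x = mul3 x (c11, c12, c21, c22)"
  shows "card S \<le> 8"
proof -
  \<comment> \<open>Cancellation of a unit modulo 3; the offset \<open>k\<close> matches the shape
    of the entry equations.\<close>
  have unit: "u = v" if "((k::int) + u * c) mod 3 = (k + v * c) mod 3" "c \<in> {1,2}" "u \<in> {0,1,2}" "v \<in> {0,1,2}"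
    for u v c k :: int
  proof -
    have "3 dvd (k + u * c) - (k + v * c)" using that(1) mod_eq_dvd_iff by blast
    then have "3 dvd (u - v) * c" by (simp add: algebra_simps)
    then show ?thesis using that(2-4) by auto
  qed
  have unit': "u = v" if "(u * c + (k::int)) mod 3 = (v * c + k) mod 3" "c \<in> {1,2}" "u \<in> {0,1,2}" "v \<in> {0,1,2}"
    for u v c k :: int
    using unit[of k u c v] that by (simp only: add.commute)
  have bound: "card S \<le> 8"
    if inj: "inj_on f S" and f: "f ` S \<subseteq> {0,1,2} \<times> {0,1,2} - {(0,0)}" for f :: "quad \<Rightarrow> int \<times> int"
  proof -
    have "card S = card (f ` S)" using card_image[OF inj] by simp
    also have "\<dots> \<le> card ({0,1,2} \<times> {0,1,2} - {(0,0)} :: (int \<times> int) set)"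
      by (rule card_mono[OF _ f]) simp
    also have "\<dots> = 8" by (simp add: card_Diff_subset card_cartesian_product)
    finally show ?thesis .
  qed
  have rng: "x11 \<in> {0,1,2} \<and> x12 \<in> {0,1,2} \<and> x21 \<in> {0,1,2} \<and> x22 \<in> {0,1,2}"
    if "(x11, x12, x21, x22) \<in> S" for x11 x12 x21 x22
    using subsetD[OF S(1) that] unfolding set_quads3 by (simp only: mem_Times_iff fst_conv snd_conv)
  have crng: "c11 \<in> {0,1,2}" "c12 \<in> {0,1,2}" "c21 \<in> {0,1,2}" "c22 \<in> {0,1,2}"
    using c(1) unfolding set_quads3 by (simp_all only: mem_Times_iff fst_conv snd_conv)
  have eqs: "(c11 * x11 + c12 * x21) mod 3 = (x11 * c11 + x12 * c21) mod 3"
      "(c11 * x12 + c12 * x22) mod 3 = (x11 * c12 + x12 * c22) mod 3"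
      "(c21 * x11 + c22 * x21) mod 3 = (x21 * c11 + x22 * c21) mod 3"
      "(c21 * x12 + c22 * x22) mod 3 = (x21 * c12 + x22 * c22) mod 3"
    if "(x11, x12, x21, x22) \<in> S" for x11 x12 x21 x22
    using comm[OF that] by auto
  consider "c21 \<noteq> 0" | "c12 \<noteq> 0" | "c21 = 0" "c12 = 0" "c11 \<noteq> c22" using c(2) by blast
  then show ?thesis
  proof cases
    case 1
    then have c1: "c21 \<in> {1,2}" using crng by auto
    have det: "x12 = y12 \<and> x22 = y22"
      if "(x11, x12, x21, x22) \<in> S" "(x11, y12, x21, y22) \<in> S" for x11 x12 x21 x22 y12 y22
    proof
      show "x12 = y12"
        by (rule unit[OF trans[OF eqs(1)[OF that(1), symmetric] eqs(1)[OF that(2)]] c1])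
          (use rng[OF that(1)] rng[OF that(2)] in blast)+
      show "x22 = y22"
        by (rule unit[OF trans[OF eqs(3)[OF that(1), symmetric] eqs(3)[OF that(2)]] c1])
          (use rng[OF that(1)] rng[OF that(2)] in blast)+
    qed
    have zero: "x11 \<noteq> 0 \<or> x21 \<noteq> 0" if x: "(x11, x12, x21, x22) \<in> S" for x11 x12 x21 x22
    proof (rule ccontr)
      assume "\<not> ?thesis"
      then have "x11 = 0" "x21 = 0" by auto
      then have "x12 = 0" "x22 = 0"
        using unit[of 0 x12 c21 0, OF _ c1] unit[of 0 x22 c21 0, OF _ c1] eqs(1,3)[OF x] rng[OF x] by simp_all
      then show False using x S(2) \<open>x11 = 0\<close> \<open>x21 = 0\<close> by simp
    qed
    show ?thesis
    proof (rule bound[of "\<lambda>(x11, x12, x21, x22). (x11, x21)"])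
      show "inj_on (\<lambda>(x11, x12, x21, x22). (x11, x21)) S"
        by (rule inj_onI) (use det in auto)
      show "(\<lambda>(x11, x12, x21, x22). (x11, x21)) ` S \<subseteq> {0,1,2} \<times> {0,1,2} - {(0,0)}"
        using zero rng by fastforce
    qed
  next
    case 2
    then have c1: "c12 \<in> {1,2}" using crng by auto
    have det: "x11 = y11 \<and> x21 = y21"
      if "(x11, x12, x21, x22) \<in> S" "(y11, x12, y21, x22) \<in> S" for x11 x12 x21 x22 y11 y21
    proof
      show "x11 = y11"
        by (rule unit'[OF trans[OF eqs(2)[OF that(1), symmetric] eqs(2)[OF that(2)]] c1])
          (use rng[OF that(1)] rng[OF that(2)] in blast)+
      show "x21 = y21"
        by (rule unit'[OF trans[OF eqs(4)[OF that(1), symmetric] eqs(4)[OF that(2)]] c1])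
          (use rng[OF that(1)] rng[OF that(2)] in blast)+
    qed
    have zero: "x12 \<noteq> 0 \<or> x22 \<noteq> 0" if x: "(x11, x12, x21, x22) \<in> S" for x11 x12 x21 x22
    proof (rule ccontr)
      assume "\<not> ?thesis"
      then have "x12 = 0" "x22 = 0" by auto
      then have "x11 = 0" "x21 = 0"
        using unit[of 0 x11 c12 0, OF _ c1] unit[of 0 x21 c12 0, OF _ c1] eqs(2,4)[OF x] rng[OF x] by simp_all
      then show False using x S(2) \<open>x12 = 0\<close> \<open>x22 = 0\<close> by simp
    qed
    show ?thesis
    proof (rule bound[of "\<lambda>(x11, x12, x21, x22). (x12, x22)"])
      show "inj_on (\<lambda>(x11, x12, x21, x22). (x12, x22)) S"
        by (rule inj_onI) (use det in auto)
      show "(\<lambda>(x11, x12, x21, x22). (x12, x22)) ` S \<subseteq> {0,1,2} \<times> {0,1,2} - {(0,0)}"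
        using zero rng by fastforce
    qed
  next
    case 3
    have diag: "x12 = 0 \<and> x21 = 0" if x: "(x11, x12, x21, x22) \<in> S" for x11 x12 x21 x22
    proof -
      have "(c11 * x12) mod 3 = (x12 * c22) mod 3" "(c22 * x21) mod 3 = (x21 * c11) mod 3"
        using eqs(2,3)[OF x] unfolding 3(1,2)
        by (simp_all only: mult_zero_left mult_zero_right add_0_left add_0_right)
      then have "(0 + c11 * x12) mod 3 = (0 + c22 * x12) mod 3" "(0 + c22 * x21) mod 3 = (0 + c11 * x21) mod 3"
        by (simp_all only: add_0 mult.commute)
      then have "x12 \<notin> {1, 2}" "x21 \<notin> {1, 2}" using unit crng 3(3) by metis+
      then show ?thesis using rng[OF x] by blast
    qed
    show ?thesis
    proof (rule bound[of "\<lambda>(x11, x12, x21, x22). (x11, x22)"])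
      show "inj_on (\<lambda>(x11, x12, x21, x22). (x11, x22)) S"
        by (rule inj_onI) (use diag in \<open>auto, blast+\<close>)
      show "(\<lambda>(x11, x12, x21, x22). (x11, x22)) ` S \<subseteq> {0,1,2} \<times> {0,1,2} - {(0,0)}"
        using diag rng S(2) by fastforce
    qed
  qed
qed

text \<open>Writing A = 1 + 3B gives det A = 1 + 3 tr B + 9 det B. The value -1 is impossible modulo
  3, so tr B = -3 det B and tr A = 2 - 9 det B; the nearest values other than 2 are -7 and
  11.\<close>

lemma congruence_trace:
  assumes "mod3 A = (1, 0, 0, 1)" "\<bar>det A\<bar> = 1"
  shows "det A = 1 \<and> (A$1$1 + A$2$2 = 2 \<or> 7 \<le> \<bar>A$1$1 + A$2$2\<bar>)"
proof -
  have "A$1$1 mod 3 = 1" "A$1$2 mod 3 = 0" "A$2$1 mod 3 = 0" "A$2$2 mod 3 = 1"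
    using assms(1) by (simp_all add: mod3_def)
  then obtain a b c d where A: "A$1$1 = 1 + 3 * a" "A$1$2 = 3 * b" "A$2$1 = 3 * c" "A$2$2 = 1 + 3 * d"
    by (metis add.commute add_0 mod_mult_div_eq mult.commute)
  have det: "det A = 1 + 3 * (a + d) + 9 * (a * d - b * c)" by (simp add: det_2 A algebra_simps)
  then have "det A \<noteq> -1" by presburger
  then have d1: "det A = 1" using assms(2) by linarith
  define m where "m = a * d - b * c"
  have "a + d = - 3 * m" using det d1 by (simp add: m_def)
  then have tr: "A$1$1 + A$2$2 = 2 - 9 * m" by (simp add: A)
  have "m = 0 \<or> m \<ge> 1 \<or> m \<le> -1" by linarith
  then show ?thesis using d1 tr by auto
qed

section \<open>The lower central series\<close>

lemma lower_central_props:
  assumes "group K"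
  shows "lower_central K n \<subseteq> carrier K \<and> subgroup (lower_central K n) K \<and>
    lower_central K (Suc n) \<subseteq> lower_central K n \<and>
    (\<forall>x\<in>carrier K. \<forall>y\<in>lower_central K n. x \<otimes>\<^bsub>K\<^esub> y \<otimes>\<^bsub>K\<^esub> inv\<^bsub>K\<^esub> x \<in> lower_central K n)"
proof (induction n)
  case 0
  interpret group K by fact
  have "generate K (\<Union>x\<in>carrier K. \<Union>y\<in>carrier K.
      {x \<otimes>\<^bsub>K\<^esub> y \<otimes>\<^bsub>K\<^esub> inv\<^bsub>K\<^esub> x \<otimes>\<^bsub>K\<^esub> inv\<^bsub>K\<^esub> y}) \<subseteq> carrier K"
    by (rule generate_incl) auto
  then show ?case by (simp add: subgroup_self)
next
  case (Suc n)
  interpret group K by fact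
  let ?c = "\<lambda>x y. x \<otimes>\<^bsub>K\<^esub> y \<otimes>\<^bsub>K\<^esub> inv\<^bsub>K\<^esub> x \<otimes>\<^bsub>K\<^esub> inv\<^bsub>K\<^esub> y"
  have sub: "subgroup (lower_central K n) K" "lower_central K (Suc n) \<subseteq> lower_central K n"
    "lower_central K n \<subseteq> carrier K"
    using Suc by auto
  have subS: "subgroup (lower_central K (Suc n)) K"
    unfolding lower_central.simps(2)
    by (rule generate_is_subgroup) (use sub(3) in auto)
  have carS: "lower_central K (Suc n) \<subseteq> carrier K" using sub by blast
  \<comment> \<open>Normality of the next term: the conjugate of \<open>y\<close> is the commutator
    of \<open>x\<close> and \<open>y\<close> times \<open>y\<close>. The commutator lies in that
    term because \<open>y\<close> also lies in the preceding one.\<close>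
  have conj: "x \<otimes>\<^bsub>K\<^esub> y \<otimes>\<^bsub>K\<^esub> inv\<^bsub>K\<^esub> x \<in> lower_central K (Suc n)"
    if x: "x \<in> carrier K" and y: "y \<in> lower_central K (Suc n)" for x y
  proof -
    have "?c x y \<in> lower_central K (Suc n)"
      unfolding lower_central.simps(2) by (rule generate.incl) (use x y sub(2) in blast)
    then have "?c x y \<otimes>\<^bsub>K\<^esub> y \<in> lower_central K (Suc n)"
      using subgroup.m_closed[OF subS _ y] by blast
    moreover have "?c x y \<otimes>\<^bsub>K\<^esub> y = x \<otimes>\<^bsub>K\<^esub> y \<otimes>\<^bsub>K\<^esub> inv\<^bsub>K\<^esub> x"
      using x subsetD[OF carS y] by (simp add: m_assoc)
    ultimately show ?thesis by simp
  qed
  have "lower_central K (Suc (Suc n)) \<subseteq> lower_central K (Suc n)"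
    unfolding lower_central.simps(2)[of K "Suc n"]
  proof (rule generate_subgroup_incl[OF _ subS])
    show "(\<Union>x\<in>carrier K. \<Union>y\<in>lower_central K (Suc n). {?c x y}) \<subseteq> lower_central K (Suc n)"
      using conj subgroup.m_closed[OF subS] subgroup.m_inv_closed[OF subS] by auto
  qed
  then show ?case using subS conj carS by blast
qed

lemma lower_central_commutator:
  assumes "x \<in> carrier K" "y \<in> lower_central K n"
  shows "x \<otimes>\<^bsub>K\<^esub> y \<otimes>\<^bsub>K\<^esub> inv\<^bsub>K\<^esub> x \<otimes>\<^bsub>K\<^esub> inv\<^bsub>K\<^esub> y \<in> lower_central K (Suc n)"
  unfolding lower_central.simps(2) by (rule generate.incl) (use assms in blast)

lemma lower_central_antimono:
  assumes "group K" "m \<le> n"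
  shows "lower_central K n \<subseteq> lower_central K m"
  using assms(2)
proof (induction n rule: dec_induct)
  case (step n)
  then show ?case using lower_central_props[OF assms(1), of n] by blast
qed simp

text \<open>Both images are in bijection with the common fibres. Applied to the coset map and the
  residue map, this counts cosets by residues.\<close>

lemma card_image_cong_kernel:
  assumes "\<And>x y. x \<in> A \<Longrightarrow> y \<in> A \<Longrightarrow> f x = f y \<longleftrightarrow> g x = g y"
  shows "card (f ` A) = card (g ` A)"
proof (rule bij_betw_same_card)
  have sel: "inv_into A f (f x) \<in> A \<and> f (inv_into A f (f x)) = f x" if "x \<in> A" for x
    using that by (simp add: inv_into_into f_inv_into_f)
  then have gsel: "g (inv_into A f (f x)) = g x" if "x \<in> A" for x
    using assms that by blast
  show "bij_betw (\<lambda>z. g (inv_into A f z)) (f ` A) (g ` A)"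
    unfolding bij_betw_def
  proof
    show "inj_on (\<lambda>z. g (inv_into A f z)) (f ` A)"
      by (rule inj_onI) (use assms gsel in auto)
    show "(\<lambda>z. g (inv_into A f z)) ` f ` A = g ` A"
      using gsel by (force simp: image_iff)
  qed
qed

text \<open>The computation of the index sees the homeomorphisms only through a homomorphism to
  integer matrices, so it is done for an abstract group.\<close>

locale int_matrix_rep = group K for K (structure) +
  fixes hm :: "'a \<Rightarrow> int^2^2"
  assumes hm_mult: "x \<in> carrier K \<Longrightarrow> y \<in> carrier K \<Longrightarrow> hm (x \<otimes> y) = hm x ** hm y"
    and hm_one: "hm \<one> = mat 1"
begin

lemma hm_inv: "x \<in> carrier K \<Longrightarrow> hm x ** hm (inv x) = mat 1"
  using hm_mult[of x "inv x"] hm_one by simp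

lemma hm_det: "x \<in> carrier K \<Longrightarrow> \<bar>det (hm x)\<bar> = 1"
proof -
  assume "x \<in> carrier K"
  then have "det (hm x) * det (hm (inv x)) = 1"
    using hm_inv by (metis det_I det_mul)
  then show ?thesis using int_unit_cases by fastforce
qed

lemma hm_commutator:
  assumes x: "x \<in> carrier K" and y: "y \<in> carrier K"
    and c: "hm (x \<otimes> y \<otimes> inv x \<otimes> inv y) = s" "s = mat 1 \<or> s = - mat 1"
  shows "hm x ** hm y = hm y ** hm x \<or> hm x ** hm y = - (hm y ** hm x)"
proof -
  let ?c = "x \<otimes> y \<otimes> inv x \<otimes> inv y"
  have "?c \<otimes> (y \<otimes> x) = x \<otimes> y"
    using x y by (simp add: m_assoc) (metis inv_closed l_inv m_assoc m_closed r_one)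
  then have "hm x ** hm y = s ** (hm y ** hm x)"
    using hm_mult[of ?c "y \<otimes> x"] hm_mult[of x y] hm_mult[of y x] x y c(1) by simp
  moreover have "- mat 1 ** M = - M" for M :: "int^2^2"
    by (simp add: mat2_simps)
  ultimately show ?thesis using c(2) by auto
qed

text \<open>The element \<open>c\<close> comes from the last term of the lower central series whose image is not
  contained in \<open>{1, -1}\<close>.\<close>

lemma central_or_small:
  assumes "nilpotent_group K"
  shows "hm ` carrier K \<subseteq> {mat 1, - mat 1} \<or>
    (\<exists>c\<in>carrier K. hm c \<noteq> mat 1 \<and> hm c \<noteq> - mat 1 \<and>
      (\<forall>x\<in>carrier K. hm x ** hm c = hm c ** hm x \<or> hm x ** hm c = - (hm c ** hm x)))"
proof (rule ccontr)
  assume neg: "\<not> ?thesis"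
  obtain n where n: "lower_central K n = {\<one>}"
    using assms by (auto simp: nilpotent_group_def)
  \<comment> \<open>Descent from the trivial term to the whole group: commutators mapped to 1 or -1
    make an exceptional \<open>c\<close> commute or anticommute with every image, which the negated
    claim forbids.\<close>
  have "hm ` lower_central K (n - m) \<subseteq> {mat 1, - mat 1}" for m
  proof (induction m)
    case 0
    show ?case using n hm_one by simp
  next
    case (Suc m)
    show ?case
    proof (cases "m < n")
      case True
      then have eq: "n - m = Suc (n - Suc m)" by simp
      show ?thesis
      proof (rule ccontr)
        assume "\<not> ?thesis"
        then obtain c where c: "c \<in> lower_central K (n - Suc m)" "hm c \<noteq> mat 1" "hm c \<noteq> - mat 1"
          by blast
        have cK: "c \<in> carrier K" using c(1) lower_central_props[OF is_group, of "n - Suc m"] by blast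
        have "hm x ** hm c = hm c ** hm x \<or> hm x ** hm c = - (hm c ** hm x)" if x: "x \<in> carrier K" for x
        proof (rule hm_commutator[OF x cK refl])
          show "hm (x \<otimes> c \<otimes> inv x \<otimes> inv c) = mat 1 \<or> hm (x \<otimes> c \<otimes> inv x \<otimes> inv c) = - mat 1"
            using lower_central_commutator[OF x c(1)] Suc unfolding eq by blast
        qed
        then show False using neg c cK by blast
      qed
    next
      case False
      then show ?thesis using Suc by simp
    qed
  qed
  from this[of n] show False using neg by simp
qed

definition residue :: "'a \<Rightarrow> quad" where
  "residue x = mod3 (hm x)"

lemma residue_mult:
  "x \<in> carrier K \<Longrightarrow> y \<in> carrier K \<Longrightarrow> residue (x \<otimes> y) = mul3 (residue x) (residue y)"
  by (simp add: residue_def hm_mult mod3_mult)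

lemma card_residue_le:
  assumes "nilpotent_group K"
  shows "card (residue ` carrier K) \<le> 8"
proof -
  have small: ?thesis if F: "hm ` carrier K \<subseteq> set L" "length L \<le> 8" for L
  proof -
    have "residue ` carrier K \<subseteq> set (map mod3 L)"
      using F(1) by (force simp: residue_def)
    then have "card (residue ` carrier K) \<le> card (set (map mod3 L))" by (intro card_mono) simp_all
    also have "\<dots> \<le> 8" using card_length[of "map mod3 L"] F(2) by simp
    finally show ?thesis .
  qed
  from central_or_small[OF assms] show ?thesis
  proof
    assume "hm ` carrier K \<subseteq> {mat 1, - mat 1}"
    then show ?thesis using small[of "[mat 1, - mat 1]"] by simp
  next
    assume "\<exists>c\<in>carrier K. hm c \<noteq> mat 1 \<and> hm c \<noteq> - mat 1 \<and>
      (\<forall>x\<in>carrier K. hm x ** hm c = hm c ** hm x \<or> hm x ** hm c = - (hm c ** hm x))"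
    then obtain c where c: "c \<in> carrier K" and c1: "hm c \<noteq> mat 1" "hm c \<noteq> - mat 1"
      and pm: "\<And>x. x \<in> carrier K \<Longrightarrow> hm x ** hm c = hm c ** hm x \<or> hm x ** hm c = - (hm c ** hm x)"
      by blast
    define C where "C = hm c"
    have detC: "\<bar>det C\<bar> = 1" using hm_det[OF c] by (simp add: C_def)
    show ?thesis
    proof (cases "\<forall>x\<in>carrier K. hm x ** C = C ** hm x")
      case True
      have comm: "hm x ** hm y = hm y ** hm x" if "x \<in> carrier K" "y \<in> carrier K" for x y
        using commutant_commutative[OF scalar_unit[OF hm_det[OF c] c1]] True that by (simp add: C_def)
      let ?S = "residue ` carrier K"
      show ?thesis
      proof (cases "\<exists>y\<in>carrier K. \<exists>c11 c12 c21 c22. residue y = (c11, c12, c21, c22) \<and>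
          (c12 \<noteq> 0 \<or> c21 \<noteq> 0 \<or> c11 \<noteq> c22)")
        case True
        then obtain y c11 c12 c21 c22 where y: "y \<in> carrier K" "residue y = (c11, c12, c21, c22)"
          "c12 \<noteq> 0 \<or> c21 \<noteq> 0 \<or> c11 \<noteq> c22" by blast
        show ?thesis
        proof (rule commutant_mod3_card[OF _ _ _ y(3)])
          show "?S \<subseteq> set quads3" "(c11, c12, c21, c22) \<in> set quads3"
            using mod3_in_quads3 y(2) by (auto simp: residue_def simp flip: y(2))
          \<comment> \<open>The zero quadruple has zero 24th power, whereas residues of group
            elements have 24th power 1.\<close>
          have "residue x \<noteq> (0, 0, 0, 0)" if "x \<in> carrier K" for x
            using pow24_eq_one[OF hm_det[OF that]] by (auto simp: residue_def)
          then show "(0, 0, 0, 0) \<notin> ?S" by force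
          fix z assume "z \<in> ?S"
          then obtain x where x: "x \<in> carrier K" "z = residue x" by blast
          have "mod3 (hm y ** hm x) = mod3 (hm x ** hm y)" using comm[OF x(1) y(1)] by simp
          then show "mul3 (c11, c12, c21, c22) z = mul3 z (c11, c12, c21, c22)"
            unfolding x(2) y(2)[symmetric] residue_def mod3_mult .
        qed
      next
        case False
        have "?S \<subseteq> set [(0,0,0,0), (1,0,0,1), (2,0,0,2)]"
        proof
          fix z assume "z \<in> ?S"
          then obtain x where x: "x \<in> carrier K" "z = residue x" by blast
          obtain d11 d12 d21 d22 where z: "z = (d11, d12, d21, d22)" by (metis prod_cases4)
          have "\<not> (d12 \<noteq> 0 \<or> d21 \<noteq> 0 \<or> d11 \<noteq> d22)" using False x z by blast
          then have "d12 = 0" "d21 = 0" "d11 = d22" by blast+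
          moreover have "d22 \<in> {0, 1, 2}" using x(2) z mod3_int_cases by (auto simp: residue_def mod3_def)
          ultimately show "z \<in> set [(0,0,0,0), (1,0,0,1), (2,0,0,2)]" using z by auto
        qed
        then have "card ?S \<le> card (set [(0,0,0,0), (1,0,0,1), (2,0,0,2::int)] :: quad set)"
          by (intro card_mono) simp_all
        also have "\<dots> \<le> 8" by (rule order_trans[OF card_length]) simp
        finally show ?thesis .
      qed
    next
      case False
      then obtain g where g: "g \<in> carrier K" and anti: "hm g ** C = - (C ** hm g)"
        using pm by (auto simp: C_def)
      have tr: "C$1$1 + C$2$2 = 0"
        by (rule anticommute_traceless[OF anti]) (use hm_det[OF g] in auto)
      define D where "D = hm (inv g)"
      have gD: "hm g ** D = mat 1" using hm_inv[OF g] by (simp add: D_def)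
      have four: "hm x \<in> {mat 1, - mat 1, C, - C}" if "x \<in> carrier K" "hm x ** C = C ** hm x" for x
        by (rule commutant_traceless[OF tr detC that(2) hm_det[OF that(1)]])
      have neg_mult: "(- M) ** N = - (M ** N)" "M ** (- N) = - (M ** N)" for M N :: "int^2^2"
        by (simp_all add: mat2_simps)
      \<comment> \<open>The elements commuting with \<open>C\<close> take at most four values. If
        \<open>x\<close> anticommutes with \<open>C\<close>, then \<open>x\<close> times
        \<open>g\<close> commutes with it, so \<open>hm x\<close> is one of these four values times
        \<open>D\<close>.\<close>
      have "hm x \<in> set [mat 1, - mat 1, C, - C, D, - D, C ** D, - (C ** D)]" if x: "x \<in> carrier K" for x
      proof (cases "hm x ** C = C ** hm x")
        case True
        then show ?thesis using four[OF x] by auto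
      next
        case False
        then have ax: "hm x ** C = - (C ** hm x)" using pm[OF x] by (simp add: C_def)
        have "hm (x \<otimes> g) ** C = hm x ** (hm g ** C)"
          using x g by (simp add: hm_mult matrix_mul_assoc)
        also have "\<dots> = C ** hm (x \<otimes> g)"
          using x g by (simp add: anti neg_mult matrix_mul_assoc ax hm_mult)
        finally have "hm (x \<otimes> g) \<in> {mat 1, - mat 1, C, - C}" using four[of "x \<otimes> g"] x g by simp
        moreover have "hm x = hm (x \<otimes> g) ** D"
          using x g gD by (simp add: hm_mult matrix_mul_assoc[symmetric])
        ultimately show ?thesis by (auto simp: neg_mult)
      qed
      then have "hm ` carrier K \<subseteq> set [mat 1, - mat 1, C, - C, D, - D, C ** D, - (C ** D)]"
        by blast
      then show ?thesis by (rule small) simp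
    qed
  qed
qed

section \<open>The congruence kernel and its index\<close>

definition congruence_kernel :: "'a set" where
  "congruence_kernel = {x \<in> carrier K. residue x = (1, 0, 0, 1)}"

lemma residue_in_quads3: "residue x \<in> set quads3"
  by (simp add: residue_def mod3_in_quads3)

lemma mul3_one: "x \<in> set quads3 \<Longrightarrow> mul3 x (1, 0, 0, 1) = x \<and> mul3 (1, 0, 0, 1) x = x"
  by (auto simp: quads3_def)

lemma residue_one: "residue \<one> = (1, 0, 0, 1)"
  by (simp add: residue_def hm_one mod3_one)

lemma residue_inv:
  assumes "x \<in> carrier K"
  shows "mul3 (residue x) (residue (inv x)) = (1, 0, 0, 1)"
  using residue_mult[of x "inv x"] residue_one assms by simp

lemma normal_congruence_kernel: "congruence_kernel \<lhd> K"
proof -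
  have "subgroup congruence_kernel K"
  proof (rule subgroupI)
    fix x assume x: "x \<in> congruence_kernel"
    then have "residue (inv x) = (1, 0, 0, 1)"
      using residue_inv[of x] mul3_one[OF residue_in_quads3, of "inv x"] by (simp add: congruence_kernel_def)
    then show "inv x \<in> congruence_kernel" using x by (simp add: congruence_kernel_def)
  qed (auto simp: congruence_kernel_def residue_mult residue_one intro: exI[of _ \<one>])
  moreover have "x \<otimes> h \<otimes> inv x \<in> congruence_kernel" if "x \<in> carrier K" "h \<in> congruence_kernel" for x h
  proof -
    have "residue (x \<otimes> h \<otimes> inv x) = mul3 (mul3 (residue x) (1, 0, 0, 1)) (residue (inv x))"
      using that by (simp add: residue_mult congruence_kernel_def)
    then show ?thesis
      using that mul3_one[OF residue_in_quads3] residue_inv[of x] by (simp add: congruence_kernel_def)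
  qed
  ultimately show ?thesis by (simp add: normal_inv_iff)
qed

text \<open>Quadruples form no group under \<open>mul3\<close>, so cancellation goes through
  inverses of group elements and not of residues.\<close>

lemma residue_eq_iff:
  assumes x: "x \<in> carrier K" and y: "y \<in> carrier K"
  shows "congruence_kernel #> x = congruence_kernel #> y \<longleftrightarrow> residue x = residue y"
proof -
  interpret N: normal congruence_kernel K by (rule normal_congruence_kernel)
  have sub: "subgroup congruence_kernel K" by (rule N.subgroup_axioms)
  have "congruence_kernel #> x = congruence_kernel #> y \<longleftrightarrow> x \<in> congruence_kernel #> y"
    using repr_independence[OF _ y sub, of x] rcos_self[OF x sub] by blast
  also have "\<dots> \<longleftrightarrow> x \<otimes> inv y \<in> congruence_kernel"
    using x y by (simp add: subgroup.rcos_module[OF sub is_group])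
  also have "\<dots> \<longleftrightarrow> mul3 (residue x) (residue (inv y)) = (1, 0, 0, 1)"
    using residue_mult[of x "inv y"] x y unfolding congruence_kernel_def by auto
  also have "\<dots> \<longleftrightarrow> residue x = residue y"
  proof
    assume a: "mul3 (residue x) (residue (inv y)) = (1, 0, 0, 1)"
    have "x = (x \<otimes> inv y) \<otimes> y" using x y by (simp add: m_assoc)
    then have "residue x = mul3 (residue (x \<otimes> inv y)) (residue y)"
      using residue_mult[of "x \<otimes> inv y" y] x y by simp
    also have "residue (x \<otimes> inv y) = (1, 0, 0, 1)" using a x y by (simp add: residue_mult)
    finally show "residue x = residue y" using mul3_one[OF residue_in_quads3] by simp
  next
    assume "residue x = residue y"
    then show "mul3 (residue x) (residue (inv y)) = (1, 0, 0, 1)" using residue_inv[OF y] by simp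
  qed
  finally show ?thesis .
qed

lemma pow24_in_kernel:
  assumes "x \<in> carrier K"
  shows "x [^] (24::nat) \<in> congruence_kernel"
proof -
  define y where "y = x \<otimes> (x \<otimes> x)"
  define z where "z = y \<otimes> y"
  define w where "w = z \<otimes> z"
  have car: "y \<in> carrier K" "z \<in> carrier K" "w \<in> carrier K" "w \<otimes> w \<in> carrier K"
    using assms by (simp_all add: y_def z_def w_def)
  have "y = x [^] (3::nat)" using assms by (simp add: y_def numeral_3_eq_3 m_assoc)
  then have "w \<otimes> w = x [^] (24::nat)"
    using assms by (simp add: w_def z_def nat_pow_mult)
  moreover have "residue (w \<otimes> w) = pow24 (residue x)"
    using assms car by (simp add: residue_mult Let_def y_def z_def w_def)
  moreover have "pow24 (residue x) = (1, 0, 0, 1)"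
    unfolding residue_def by (rule pow24_eq_one[OF hm_det[OF assms]])
  ultimately show ?thesis using car by (simp add: congruence_kernel_def)
qed

lemma index_congruence_kernel:
  assumes "nilpotent_group K"
  shows "finite (rcosets congruence_kernel)"
    and "card (rcosets congruence_kernel) \<in> {1, 2, 3, 4, 6, 8}"
proof -
  interpret N: normal congruence_kernel K by (rule normal_congruence_kernel)
  interpret Q: group "K Mod congruence_kernel" by (rule N.factorgroup_is_group)
  have eq: "rcosets congruence_kernel = (\<lambda>x. congruence_kernel #> x) ` carrier K"
    unfolding RCOSETS_def by blast
  have "finite (residue ` carrier K)"
    by (rule finite_subset[of _ "set quads3"]) (use residue_in_quads3 in blast, rule finite_set)
  then show fin: "finite (rcosets congruence_kernel)"
  proof -
    assume f: "finite (residue ` carrier K)"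
    have "(\<lambda>x. congruence_kernel #> x) ` carrier K
      \<subseteq> (\<lambda>r. congruence_kernel #> (SOME x. x \<in> carrier K \<and> residue x = r)) ` residue ` carrier K"
    proof
      fix z assume "z \<in> (\<lambda>x. congruence_kernel #> x) ` carrier K"
      then obtain x where x: "x \<in> carrier K" "z = congruence_kernel #> x" by blast
      let ?y = "SOME y. y \<in> carrier K \<and> residue y = residue x"
      have "?y \<in> carrier K \<and> residue ?y = residue x"
        by (rule someI[of _ x]) (simp add: x)
      then have "z = congruence_kernel #> ?y" using residue_eq_iff x by metis
      then show "z \<in> (\<lambda>r. congruence_kernel #> (SOME x. x \<in> carrier K \<and> residue x = r)) ` residue ` carrier K"
        using x(1) by blast
    qed
    then show ?thesis unfolding eq using f finite_subset by blast
  qed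
  define n where "n = card (rcosets congruence_kernel)"
  have n8: "n \<le> 8"
    using card_residue_le[OF assms] card_image_cong_kernel[of "carrier K" "\<lambda>x. congruence_kernel #> x" residue]
      residue_eq_iff by (simp add: n_def eq)
  have n0: "n \<noteq> 0"
    using fin eq by (auto simp: n_def)
  have ord: "order (K Mod congruence_kernel) = n"
    by (simp add: order_def FactGroup_def n_def)
  have carQ: "carrier (K Mod congruence_kernel) = rcosets congruence_kernel"
    by (simp add: FactGroup_def)
  have pow: "(congruence_kernel #> x) [^]\<^bsub>K Mod congruence_kernel\<^esub> k = congruence_kernel #> (x [^] k)"
    if "x \<in> carrier K" for x and k :: nat
    using N.FactGroup_pow[OF that] by simp
  have exp24: "a [^]\<^bsub>K Mod congruence_kernel\<^esub> (24::nat) = \<one>\<^bsub>K Mod congruence_kernel\<^esub>"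
    if "a \<in> carrier (K Mod congruence_kernel)" for a
  proof -
    from that obtain x where x: "x \<in> carrier K" "a = congruence_kernel #> x"
      unfolding carQ eq by blast
    have "congruence_kernel #> (x [^] (24::nat)) = congruence_kernel"
      using pow24_in_kernel[OF x(1)] N.subgroup_axioms by (simp add: subgroup.rcos_const[OF _ is_group])
    then show ?thesis using pow[OF x(1)] x(2) by (simp add: FactGroup_def)
  qed
  \<comment> \<open>The order of an element of the quotient divides both \<open>n\<close> and 24,
    hence is 1. Among 2, ..., 8 only 5 and 7 are coprime to 24.\<close>
  have coprime_trivial: "n = 1" if "coprime n 24"
  proof -
    have "a = \<one>\<^bsub>K Mod congruence_kernel\<^esub>" if a: "a \<in> carrier (K Mod congruence_kernel)" for a
    proof -
      have "Q.ord a dvd n" using Q.pow_order_eq_1[OF a] Q.pow_eq_id[OF a, of n] by (simp add: ord)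
      moreover have "Q.ord a dvd 24" using exp24[OF a] Q.pow_eq_id[OF a, of 24] by simp
      ultimately have "Q.ord a = 1" using \<open>coprime n 24\<close> by (metis coprime_common_divisor nat_dvd_1_iff_1)
      then show ?thesis using Q.ord_eq_1[OF a] by simp
    qed
    then have "carrier (K Mod congruence_kernel) = {\<one>\<^bsub>K Mod congruence_kernel\<^esub>}" by blast
    then show ?thesis using carQ by (simp add: n_def)
  qed
  have "coprime 5 (24::nat)" "coprime 7 (24::nat)"
    by (simp_all add: coprime_iff_gcd_eq_1 gcd_non_0_nat)
  then have "n \<noteq> 5" "n \<noteq> 7" using coprime_trivial by auto
  then have "n \<in> {1, 2, 3, 4, 6, 8}" using n8 n0 by auto
  then show "card (rcosets congruence_kernel) \<in> {1, 2, 3, 4, 6, 8}" by (simp add: n_def)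
qed

end

section \<open>Rotation vectors\<close>

lemma displacement_lift:
  assumes "is_lift f F" "hmat f = mat 1"
  shows "displacement F (proj_torus x) = F x - x"
  by (rule displacement_proj_torus)
    (use lift_hmat[OF assms(1)] assms(2) in \<open>simp add: equivariant_def rmat_one\<close>)

lemma continuous_on_displacement:
  assumes "is_lift f F" "hmat f = mat 1"
  shows "continuous_on UNIV (displacement F)"
  by (rule continuous_on_from_torus)
    (simp add: displacement_lift[OF assms], intro continuous_intros is_liftD(1)[OF assms(1)])

lemma rotation_vector_bounded:
  assumes "is_lift f F" "hmat f = mat 1"
  obtains B where "\<And>\<nu>. torus_prob \<nu> \<Longrightarrow> norm (rotation_vector \<nu> F) \<le> B"
proof -
  obtain B where B: "\<And>p. norm (displacement F p) \<le> B"
    using torus_bounded[OF continuous_on_displacement[OF assms]] by blast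
  have "norm (rotation_vector \<nu> F) \<le> B" if \<nu>: "torus_prob \<nu>" for \<nu>
  proof -
    interpret prob_space \<nu> using torus_probD(1)[OF \<nu>] .
    have "norm (rotation_vector \<nu> F) \<le> (\<integral>p. norm (displacement F p) \<partial>\<nu>)"
      unfolding rotation_vector_def by (rule integral_norm_bound)
    also have "\<dots> \<le> (\<integral>p. B \<partial>\<nu>)"
      using torus_integrable[OF \<nu> continuous_on_displacement[OF assms]] B
      by (intro integral_mono) auto
    finally show ?thesis by (simp add: prob_space)
  qed
  then show thesis by (rule that)
qed

text \<open>The displacement of the composition is that of \<open>F\<close> at \<open>g p\<close>
  plus that of \<open>G\<close> at \<open>p\<close>; invariance of \<open>\<nu>\<close> under
  \<open>g\<close> removes the shift in the first term.\<close>

lemma rotation_vector_compose: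
  assumes \<nu>: "torus_prob \<nu>" and inv: "distr \<nu> borel g = \<nu>" and g: "continuous_on UNIV g"
    and F: "is_lift f F" "hmat f = mat 1" and G: "is_lift g G" "hmat g = mat 1"
  shows "rotation_vector \<nu> (F \<circ> G) = rotation_vector \<nu> F + rotation_vector \<nu> G"
proof -
  have cF: "continuous_on UNIV (displacement F)" by (rule continuous_on_displacement[OF F])
  have cG: "continuous_on UNIV (displacement G)" by (rule continuous_on_displacement[OF G])
  have cFg: "continuous_on UNIV (\<lambda>p. displacement F (g p))"
    by (rule continuous_on_compose2[OF cF g]) simp
  have "displacement (F \<circ> G) p = displacement F (g p) + displacement G p" for p
  proof -
    have "g p = proj_torus (G (rep_torus p))" using is_liftD(2)[OF G(1), of "rep_torus p"] by simp
    then show ?thesis by (simp add: displacement_lift[OF F]) (simp add: displacement_def)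
  qed
  then have "rotation_vector \<nu> (F \<circ> G) = (\<integral>p. displacement F (g p) + displacement G p \<partial>\<nu>)"
    by (simp add: rotation_vector_def)
  also have "\<dots> = (\<integral>p. displacement F (g p) \<partial>\<nu>) + rotation_vector \<nu> G"
    unfolding rotation_vector_def
    by (rule Bochner_Integration.integral_add) (intro torus_integrable \<nu> cFg cG)+
  also have "(\<integral>p. displacement F (g p) \<partial>\<nu>) = (\<integral>p. displacement F p \<partial>distr \<nu> borel g)"
    by (rule integral_distr_torus[symmetric, OF torus_measurable[OF \<nu> g] cF])
  finally show ?thesis by (simp add: inv rotation_vector_def o_def)
qed

lemma rotation_vector_id:
  assumes "torus_prob \<nu>" "is_lift id F"
  shows "rotation_vector \<nu> F = F 0"
proof -
  obtain w where "\<And>x. F x = id x + w" using lift_unique[OF is_lift_id assms(2)] by blast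
  then have "displacement F p = F 0" for p by (simp add: displacement_def)
  then show ?thesis
    using prob_space.prob_space[OF torus_probD(1)[OF assms(1)]] by (simp add: rotation_vector_def)
qed

text \<open>The difference \<open>q\<close> between \<open>\<Psi>\<close> and its linear part is
  periodic. Hence the displacement of \<open>E\<close> at \<open>\<psi> p\<close> is the matrix
  applied to the displacement of \<open>Z\<close> at \<open>p\<close>, plus the coboundary of
  \<open>q\<close> along \<open>\<zeta>\<close>, whose integral vanishes by invariance.\<close>

lemma rotation_vector_conjugate:
  assumes \<nu>: "torus_prob \<nu>" and inv: "distr \<nu> borel \<zeta> = \<nu>"
    and cont: "continuous_on UNIV \<psi>" "continuous_on UNIV \<zeta>"
    and \<Psi>: "is_lift \<psi> \<Psi>" and E: "is_lift \<eta> E" "hmat \<eta> = mat 1" and Z: "is_lift \<zeta> Z" "hmat \<zeta> = mat 1"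
    and eq: "\<And>x. E (\<Psi> x) = \<Psi> (Z x)"
  shows "rotation_vector (distr \<nu> borel \<psi>) E = rmat (hmat \<psi>) *v rotation_vector \<nu> Z"
proof -
  let ?A = "rmat (hmat \<psi>)"
  define q where "q p = \<Psi> (rep_torus p) - ?A *v rep_torus p" for p
  have q: "q (proj_torus x) = \<Psi> x - ?A *v x" for x
  proof -
    have "rep_torus (proj_torus x) - x \<in> int_lattice"
      using proj_torus_eq_iff[of "rep_torus (proj_torus x)" x] by simp
    then have "\<Psi> (x + (rep_torus (proj_torus x) - x)) = \<Psi> x + ?A *v (rep_torus (proj_torus x) - x)"
      using lift_hmat[OF \<Psi>] unfolding equivariant_def by blast
    then show ?thesis by (simp add: q_def matrix_vector_mult_diff_distrib)
  qed
  have cq: "continuous_on UNIV q"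
    by (rule continuous_on_from_torus)
      (simp add: q, intro continuous_intros is_liftD(1)[OF \<Psi>] matrix_vector_mult_linear_continuous_on)
  have cq\<zeta>: "continuous_on UNIV (\<lambda>p. q (\<zeta> p))" by (rule continuous_on_compose2[OF cq cont(2)]) simp
  have cE: "continuous_on UNIV (displacement E)" by (rule continuous_on_displacement[OF E])
  have cZ: "continuous_on UNIV (displacement Z)" by (rule continuous_on_displacement[OF Z])
  have bl: "bounded_linear ((*v) ?A)" by (rule matrix_vector_mul_bounded_linear)
  have iZ: "integrable \<nu> (displacement Z)" by (rule torus_integrable[OF \<nu> cZ])
  have disp: "displacement E (\<psi> p) = ?A *v displacement Z p + (q (\<zeta> p) - q p)" for p
  proof -
    define x where "x = rep_torus p"
    have p: "p = proj_torus x" by (simp add: x_def)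
    have "\<psi> p = proj_torus (\<Psi> x)" "\<zeta> p = proj_torus (Z x)"
      using is_liftD(2)[OF \<Psi>, of x] is_liftD(2)[OF Z(1), of x] p by simp_all
    then show ?thesis
      by (simp add: p displacement_lift[OF E] displacement_lift[OF Z] q eq matrix_vector_mult_diff_distrib)
  qed
  have "rotation_vector (distr \<nu> borel \<psi>) E = (\<integral>p. displacement E (\<psi> p) \<partial>\<nu>)"
    unfolding rotation_vector_def by (rule integral_distr_torus[OF torus_measurable[OF \<nu> cont(1)] cE])
  also have "\<dots> = (\<integral>p. ?A *v displacement Z p \<partial>\<nu>) + ((\<integral>p. q (\<zeta> p) \<partial>\<nu>) - (\<integral>p. q p \<partial>\<nu>))"
    unfolding disp
    by (simp add: integrable_bounded_linear[OF bl iZ] torus_integrable[OF \<nu> cq] torus_integrable[OF \<nu> cq\<zeta>])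
  also have "(\<integral>p. q (\<zeta> p) \<partial>\<nu>) = (\<integral>p. q p \<partial>\<nu>)"
    using integral_distr_torus[OF torus_measurable[OF \<nu> cont(2)] cq] inv by simp
  also have "(\<integral>p. ?A *v displacement Z p \<partial>\<nu>) = ?A *v rotation_vector \<nu> Z"
    unfolding rotation_vector_def by (rule integral_bounded_linear[OF bl iZ])
  finally show ?thesis by simp
qed

text \<open>With an arbitrary lift of \<open>g\<close> the composition misses \<open>H\<close> by a
  lattice vector \<open>w\<close>. Translating that lift by the inverse matrix applied to
  \<open>w\<close> repairs this, the inverse being the matrix of \<open>f'\<close>.\<close>

lemma lift_factor:
  assumes f: "continuous_on UNIV f" "continuous_on UNIV f'" "f \<circ> f' = id"
    and g: "continuous_on UNIV g" and F: "is_lift f F" and H: "is_lift (f \<circ> g) H"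
  obtains G where "is_lift g G" "\<And>x. F (G x) = H x"
proof -
  obtain G0 where G0: "is_lift g G0" using lift_exists[OF g] .
  obtain w where w: "w \<in> int_lattice" "\<And>x. H x = (F \<circ> G0) x + w"
    using lift_unique[OF is_lift_compose[OF F G0] H] by blast
  define w' where "w' = rmat (hmat f') *v w"
  have w': "w' \<in> int_lattice" unfolding w'_def by (rule rmat_lattice[OF w(1)])
  have "hmat f ** hmat f' = mat 1"
    using hmat_compose[OF f(1,2)] f(3) hmat_id by simp
  then have "rmat (hmat f) *v w' = w"
    by (simp add: w'_def matrix_vector_mul_assoc rmat_mult[symmetric] rmat_one)
  then have "F (G0 x + w') = H x" for x
    using lift_hmat[OF F] w' w(2) by (simp add: equivariant_def)
  then show thesis
    using that is_lift_translate[OF G0 w'] by blast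
qed

section \<open>Bounded solutions of the recursion\<close>

lemma unbounded_line:
  fixes a e :: "'v::real_normed_vector"
  assumes "\<And>n::nat. norm (a + real n *\<^sub>R e) \<le> B"
  shows "e = 0"
proof (rule ccontr)
  assume "e \<noteq> 0"
  then obtain n :: nat where n: "B + norm a < real n * norm e"
    using reals_Archimedean3[of "norm e"] by auto
  have "real n * norm e = norm ((a + real n *\<^sub>R e) - a)" by simp
  also have "\<dots> \<le> norm (a + real n *\<^sub>R e) + norm a" by (rule norm_triangle_ineq4)
  also have "\<dots> \<le> B + norm a" using assms[of n] by simp
  finally show False using n by simp
qed

text \<open>The recursion is the characteristic equation of a matrix of determinant 1 and trace \<open>t\<close>, whose
  only possible eigenvalue on the unit circle is 1. Boundedness of \<open>r\<close> along two-sided orbits then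
  forces \<open>d\<close> to vanish.\<close>

lemma bounded_recursion:
  fixes r d :: "'m \<Rightarrow> 'v::real_normed_vector" and t :: real
  assumes P: "\<And>m. m \<in> S \<Longrightarrow> P m \<in> S" "\<And>m. m \<in> S \<Longrightarrow> \<exists>m'\<in>S. P m' = m"
    and r: "\<And>m. m \<in> S \<Longrightarrow> norm (r m) \<le> B"
    and d: "\<And>m. m \<in> S \<Longrightarrow> d m = r (P m) - r m"
    and rec: "\<And>m. m \<in> S \<Longrightarrow> d (P (P m)) = t *\<^sub>R d (P m) - d m"
    and t: "t = 2 \<or> 2 < \<bar>t\<bar>" and m: "m \<in> S"
  shows "d m = 0"
  using t
proof
  assume t2: "t = 2"
  have orbit: "(P ^^ n) m \<in> S" for n
    by (induction n) (simp_all add: m P(1))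
  \<comment> \<open>For t = 2 second differences of \<open>d\<close> vanish along the orbit, so
    \<open>d\<close> is affine there, and constant by boundedness. Then \<open>r\<close> is affine
    with slope \<open>d m\<close>, and boundedness forces the slope to be 0.\<close>
  define e where "e = d (P m) - d m"
  have step: "d ((P ^^ Suc n) m) - d ((P ^^ n) m) = e" for n
  proof (induction n)
    case (Suc n)
    show ?case
      using rec[OF orbit[of n]] Suc by (simp add: t2 scaleR_2)
  qed (simp add: e_def)
  have d_n: "d ((P ^^ n) m) = d m + real n *\<^sub>R e" for n
  proof (induction n)
    case (Suc n)
    then show ?case using step[of n] by (simp add: algebra_simps)
  qed simp
  have d_bound: "norm (d m') \<le> 2 * B" if "m' \<in> S" for m'
    using norm_triangle_ineq4[of "r (P m')" "r m'"] r[OF that] r[OF P(1)[OF that]] d[OF that] by simp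
  have "e = 0"
    by (rule unbounded_line[of "d m" e "2 * B"]) (metis d_bound d_n orbit)
  then have dc: "d ((P ^^ n) m) = d m" for n using d_n by simp
  have r_n: "r ((P ^^ n) m) = r m + real n *\<^sub>R d m" for n
  proof (induction n)
    case (Suc n)
    then show ?case using d[OF orbit[of n]] dc[of n] by (simp add: algebra_simps)
  qed simp
  show ?thesis
    by (rule unbounded_line[of "r m" "d m" B]) (metis r r_n orbit)
next
  assume t2: "2 < \<bar>t\<bar>"
  \<comment> \<open>Here t d(m) is the sum of \<open>d\<close> at the successor and at a predecessor
    of m, so every bound valid on all of \<open>S\<close> improves by the factor 2 / |t| < 1. This
    is where surjectivity of \<open>P\<close> enters.\<close>
  have d_bound: "norm (d m') \<le> 2 * B * (2 / \<bar>t\<bar>) ^ k" if "m' \<in> S" for m' k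
    using that
  proof (induction k arbitrary: m')
    case 0
    then show ?case
      using norm_triangle_ineq4[of "r (P m')" "r m'"] r[OF 0] r[OF P(1)[OF 0]] d[OF 0] by simp
  next
    case (Suc k)
    obtain m0 where m0: "m0 \<in> S" "P m0 = m'" using P(2)[OF Suc.prems] by blast
    have "t *\<^sub>R d m' = d (P m') + d m0" using rec[OF m0(1)] m0(2) by simp
    then have "\<bar>t\<bar> * norm (d m') = norm (d (P m') + d m0)" by (metis norm_scaleR)
    also have "\<dots> \<le> norm (d (P m')) + norm (d m0)" by (rule norm_triangle_ineq)
    also have "\<dots> \<le> 2 * (2 * B * (2 / \<bar>t\<bar>) ^ k)"
      using Suc.IH[OF P(1)[OF Suc.prems]] Suc.IH[OF m0(1)] by simp
    finally show ?case using t2 by (simp add: field_simps)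
  qed
  have "(\<lambda>k. 2 * B * (2 / \<bar>t\<bar>) ^ k) \<longlonglongrightarrow> 0"
    by (rule tendsto_mult_right_zero, rule LIMSEQ_power_zero) (use t2 in simp)
  then have "norm (d m) \<le> 0"
    by (rule Lim_bounded2) (use d_bound[OF m] in blast)
  then show ?thesis by simp
qed

lemma rmat_cayley_hamilton:
  fixes u :: "real^2"
  assumes "det M = 1"
  shows "rmat M *v (rmat M *v u) = of_int (M$1$1 + M$2$2) *\<^sub>R (rmat M *v u) - u"
proof -
  define a b c e where "a = real_of_int (M$1$1)" and "b = real_of_int (M$1$2)"
    and "c = real_of_int (M$2$1)" and "e = real_of_int (M$2$2)"
  have "real_of_int (M$1$1 * M$2$2 - M$1$2 * M$2$1) = 1" using assms by (simp add: det_2)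
  then have det: "a * e - b * c = 1" by (simp add: a_def b_def c_def e_def)
  have "a * (a * x + b * y) + b * (c * x + e * y) = (a + e) * (a * x + b * y) - x"
    "c * (a * x + b * y) + e * (c * x + e * y) = (a + e) * (c * x + e * y) - y" for x y
  proof -
    have "a * (a * x + b * y) + b * (c * x + e * y) = (a + e) * (a * x + b * y) - (a * e - b * c) * x"
      "c * (a * x + b * y) + e * (c * x + e * y) = (a + e) * (c * x + e * y) - (a * e - b * c) * y"
      by (simp_all add: algebra_simps)
    then show "a * (a * x + b * y) + b * (c * x + e * y) = (a + e) * (a * x + b * y) - x"
      "c * (a * x + b * y) + e * (c * x + e * y) = (a + e) * (c * x + e * y) - y"
      unfolding det by simp_all
  qed
  then show ?thesis
    by (simp add: vec_eq_iff forall_2 matrix_vector_mult_def sum_2 rmat_def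
        flip: a_def b_def c_def e_def)
qed

text \<open>\<open>\<psi>\<close> moves the measures, \<open>\<eta>\<close> is the map whose
  rotation vector is followed, and \<open>\<eta>'\<close> is their commutator. The assumption
  \<open>IH\<close> supplies the claim for the commutator.\<close>

lemma rotation_vector_invariant_step:
  assumes S: "\<And>\<nu>. \<nu> \<in> S \<Longrightarrow> torus_prob \<nu>"
    and \<psi>: "continuous_on UNIV \<psi>" "continuous_on UNIV \<psi>'" "\<psi> \<circ> \<psi>' = id"
    and \<eta>: "continuous_on UNIV \<eta>" "continuous_on UNIV \<theta>" "\<eta> \<circ> \<theta> = id" "hmat \<eta> = mat 1"
    and \<eta>': "continuous_on UNIV \<eta>'" "hmat \<eta>' = mat 1" "\<eta> \<circ> \<psi> = \<psi> \<circ> (\<eta> \<circ> \<eta>')"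
    and S_\<psi>: "\<And>\<nu>. \<nu> \<in> S \<Longrightarrow> distr \<nu> borel \<psi> \<in> S" "\<And>\<nu>. \<nu> \<in> S \<Longrightarrow> distr \<nu> borel \<psi>' \<in> S"
    and S_\<eta>: "\<And>\<nu>. \<nu> \<in> S \<Longrightarrow> distr \<nu> borel \<eta> = \<nu>" "\<And>\<nu>. \<nu> \<in> S \<Longrightarrow> distr \<nu> borel \<eta>' = \<nu>"
    and IH: "\<And>\<nu> E'. \<nu> \<in> S \<Longrightarrow> is_lift \<eta>' E' \<Longrightarrow>
      rotation_vector (distr \<nu> borel \<psi>) E' = rotation_vector \<nu> E'"
    and M: "det (hmat \<psi>) = 1"
      "hmat \<psi> $ 1 $ 1 + hmat \<psi> $ 2 $ 2 = 2 \<or> 7 \<le> \<bar>hmat \<psi> $ 1 $ 1 + hmat \<psi> $ 2 $ 2\<bar>"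
    and \<nu>: "\<nu> \<in> S" and E: "is_lift \<eta> E"
  shows "rotation_vector (distr \<nu> borel \<psi>) E = rotation_vector \<nu> E"
proof -
  let ?A = "rmat (hmat \<psi>)" and ?P = "\<lambda>\<nu>. distr \<nu> borel \<psi>"
  define \<zeta> where "\<zeta> = \<eta> \<circ> \<eta>'"
  have \<zeta>: "continuous_on UNIV \<zeta>" "hmat \<zeta> = mat 1"
    unfolding \<zeta>_def o_def[of \<eta>]
    using continuous_on_compose2[OF \<eta>(1) \<eta>'(1)] hmat_compose[OF \<eta>(1) \<eta>'(1)] \<eta>(4) \<eta>'(2)
    by (simp_all add: o_def)
  obtain \<Psi> where \<Psi>: "is_lift \<psi> \<Psi>" using lift_exists[OF \<psi>(1)] .
  have "is_lift (\<psi> \<circ> \<zeta>) (E \<circ> \<Psi>)"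
    using is_lift_compose[OF E \<Psi>] \<eta>'(3) by (simp add: \<zeta>_def)
  then obtain Z where Z: "is_lift \<zeta> Z" "\<And>x. \<Psi> (Z x) = (E \<circ> \<Psi>) x"
    using lift_factor[OF \<psi> \<zeta>(1) \<Psi>] by blast
  obtain E' where E': "is_lift \<eta>' E'" "\<And>x. E (E' x) = Z x"
    using lift_factor[OF \<eta>(1-3) \<eta>'(1) E Z(1)[unfolded \<zeta>_def]] by blast
  have Z_eq: "Z = E \<circ> E'" using E'(2) by (simp add: fun_eq_iff)
  define r where "r \<nu> = rotation_vector \<nu> E" for \<nu>
  define r' where "r' \<nu> = rotation_vector \<nu> E'" for \<nu>
  have distr2: "distr (distr \<nu> borel f) borel g = distr \<nu> borel (g \<circ> f)"
    if "torus_prob \<nu>" "continuous_on UNIV f" "continuous_on UNIV g" for \<nu> and f g :: "torus \<Rightarrow> torus"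
    by (rule distr_distr[OF borel_measurable_continuous_onI[OF that(3)] torus_measurable[OF that(1,2)]])
  have rP: "r (?P \<nu>) = ?A *v (r \<nu> + r' \<nu>)" if "\<nu> \<in> S" for \<nu>
  proof -
    have prob: "torus_prob \<nu>" by (rule S[OF that])
    have "distr \<nu> borel \<zeta> = \<nu>"
      unfolding \<zeta>_def using distr2[OF prob \<eta>'(1) \<eta>(1)] S_\<eta>[OF that] by simp
    then have "r (?P \<nu>) = ?A *v rotation_vector \<nu> Z"
      unfolding r_def by (rule rotation_vector_conjugate[OF prob _ \<psi>(1) \<zeta>(1) \<Psi> E \<eta>(4) Z(1) \<zeta>(2)])
        (simp add: Z(2))
    also have "rotation_vector \<nu> Z = r \<nu> + r' \<nu>"
      unfolding Z_eq r_def r'_def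
      by (rule rotation_vector_compose[OF prob S_\<eta>(2)[OF that] \<eta>'(1) E \<eta>(4) E'(1) \<eta>'(2)])
    finally show ?thesis .
  qed
  define d where "d \<nu> = r (?P \<nu>) - r \<nu>" for \<nu>
  \<comment> \<open>In the difference of two instances of \<open>rP\<close> the commutator terms
    cancel by \<open>IH\<close>.\<close>
  have dP: "d (?P \<nu>) = ?A *v d \<nu>" if "\<nu> \<in> S" for \<nu>
    using rP[OF that] rP[OF S_\<psi>(1)[OF that]] IH[OF that E'(1)]
    by (simp add: d_def r'_def matrix_vector_mult_diff_distrib[symmetric])
  obtain B where B: "\<And>\<nu>. torus_prob \<nu> \<Longrightarrow> norm (r \<nu>) \<le> B"
    using rotation_vector_bounded[OF E \<eta>(4)] unfolding r_def by blast
  have "d \<nu> = 0"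
  proof (rule bounded_recursion[where S = S and P = ?P and r = r and B = B
        and t = "of_int (hmat \<psi> $ 1 $ 1 + hmat \<psi> $ 2 $ 2)"])
    show "\<exists>\<nu>'\<in>S. ?P \<nu>' = \<nu>" if "\<nu> \<in> S" for \<nu>
    proof
      have "distr \<nu> borel (\<lambda>p. p) = distr \<nu> \<nu> (\<lambda>p. p)"
        by (rule distr_cong) (use torus_probD[OF S[OF that]] in auto)
      then show "?P (distr \<nu> borel \<psi>') = \<nu>"
        using distr2[OF S[OF that] \<psi>(2,1)] \<psi>(3) by (simp add: distr_id id_def)
    qed (rule S_\<psi>(2)[OF that])
    show "d (?P (?P \<nu>)) = of_int (hmat \<psi> $ 1 $ 1 + hmat \<psi> $ 2 $ 2) *\<^sub>R d (?P \<nu>) - d \<nu>" if "\<nu> \<in> S" for \<nu>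
      using dP[OF that] dP[OF S_\<psi>(1)[OF that]] rmat_cayley_hamilton[OF M(1)] by simp
    have "2 < \<bar>real_of_int k\<bar>" if "7 \<le> \<bar>k\<bar>" for k using that by linarith
    then show "real_of_int (hmat \<psi> $ 1 $ 1 + hmat \<psi> $ 2 $ 2) = 2
      \<or> 2 < \<bar>real_of_int (hmat \<psi> $ 1 $ 1 + hmat \<psi> $ 2 $ 2)\<bar>"
      using M(2) by (metis of_int_numeral)
  qed (use S_\<psi>(1) B S \<nu> in \<open>simp_all add: d_def\<close>)
  then show ?thesis by (simp add: d_def r_def)
qed

section \<open>Descent along the lower central series\<close>

lemma isotopic_to_id_compose:
  assumes "isotopic_to_id f" "isotopic_to_id g"
  shows "isotopic_to_id (f \<circ> g)"
proof -
  have g: "homeomorphic_map euclidean euclidean g"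
    using homotopic_with_imp_property[OF assms(2)[unfolded isotopic_to_id_def]] by simp
  have "homotopic_with (homeomorphic_map euclidean euclidean) euclidean euclidean (id \<circ> g) (f \<circ> g)"
    by (rule homotopic_with_compose_continuous_map_right[OF assms(1)[unfolded isotopic_to_id_def]])
      (use g in \<open>auto intro: homeomorphic_map_compose dest: homeomorphic_imp_continuous_map\<close>)
  then show ?thesis
    using homotopic_with_trans[OF assms(2)[unfolded isotopic_to_id_def]] by (simp add: isotopic_to_id_def)
qed

text \<open>Precomposing the isotopy from \<open>id\<close> to \<open>f\<close> with
  \<open>g\<close> gives an isotopy from \<open>g\<close> to \<open>id\<close>.\<close>

lemma isotopic_to_id_inverse:
  assumes "isotopic_to_id f" "homeomorphic_map euclidean euclidean g" "f \<circ> g = id"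
  shows "isotopic_to_id g"
proof -
  have "homotopic_with (homeomorphic_map euclidean euclidean) euclidean euclidean (id \<circ> g) (f \<circ> g)"
    by (rule homotopic_with_compose_continuous_map_right[OF assms(1)[unfolded isotopic_to_id_def]])
      (use assms(2) in \<open>auto intro: homeomorphic_map_compose dest: homeomorphic_imp_continuous_map\<close>)
  then show ?thesis
    using assms(3) unfolding isotopic_to_id_def by (subst homotopic_with_sym) simp
qed

lemma isotopic_to_id_conjugate:
  assumes "isotopic_to_id f" "homeomorphic_map euclidean euclidean g"
    "homeomorphic_map euclidean euclidean g'" "g \<circ> g' = id"
  shows "isotopic_to_id (g \<circ> f \<circ> g')"
proof -
  have "homotopic_with (homeomorphic_map euclidean euclidean) euclidean euclidean (id \<circ> g') (f \<circ> g')"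
    by (rule homotopic_with_compose_continuous_map_right[OF assms(1)[unfolded isotopic_to_id_def]])
      (use assms(3) in \<open>auto intro: homeomorphic_map_compose dest: homeomorphic_imp_continuous_map\<close>)
  then have "homotopic_with (homeomorphic_map euclidean euclidean) euclidean euclidean
      (g \<circ> (id \<circ> g')) (g \<circ> (f \<circ> g'))"
    by (rule homotopic_with_compose_continuous_map_left)
      (use assms(2) in \<open>auto intro: homeomorphic_map_compose dest: homeomorphic_imp_continuous_map\<close>)
  then show ?thesis using assms(4) by (simp add: isotopic_to_id_def comp_assoc)
qed

lemma isotopic_to_id_id: "isotopic_to_id id"
  by (simp add: isotopic_to_id_def homeomorphic_map_id)

lemma distr_compose_torus:
  fixes f g :: "torus \<Rightarrow> torus"
  assumes "torus_prob \<nu>" "continuous_on UNIV f" "continuous_on UNIV g"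
  shows "distr (distr \<nu> borel f) borel g = distr \<nu> borel (g \<circ> f)"
  by (rule distr_distr[OF borel_measurable_continuous_onI[OF assms(3)] torus_measurable[OF assms(1,2)]])

lemma distr_id_torus:
  assumes "torus_prob \<nu>"
  shows "distr \<nu> borel id = \<nu>"
proof -
  have "distr \<nu> borel id = distr \<nu> \<nu> (\<lambda>p. p)"
    by (rule distr_cong) (use torus_probD[OF assms] in auto)
  then show ?thesis by (simp add: distr_id)
qed

lemma distr_intertwine:
  fixes a f g :: "torus \<Rightarrow> torus"
  assumes "torus_prob \<nu>" "continuous_on UNIV a" "continuous_on UNIV f" "continuous_on UNIV g"
    and "f \<circ> a = a \<circ> g" "distr \<nu> borel g = \<nu>"
  shows "distr (distr \<nu> borel a) borel f = distr \<nu> borel a"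
  using distr_compose_torus[OF assms(1,2,3)] distr_compose_torus[OF assms(1,4,2)] assms(5,6) by simp

section \<open>Invariance and rotation vectors as linear constraints\<close>

lemma inv_measures_iff: "\<mu> \<in> inv_measures f \<longleftrightarrow> torus_prob \<mu> \<and> distr \<mu> borel f = \<mu>"
  by (auto simp: inv_measures_def torus_prob_def)

lemma lin_meas_antimono: "\<E>' \<subseteq> \<E> \<Longrightarrow> lin_meas \<E> \<subseteq> lin_meas \<E>'"
  by (auto simp: lin_meas_def)

text \<open>Coboundaries of continuous functions along each map in \<open>X\<close> must integrate
  to 0, and the two coordinates of the displacement to those of \<open>v\<close>.\<close>

definition rotation_constraints ::
    "(torus \<Rightarrow> torus) set \<Rightarrow> (real^2 \<Rightarrow> real^2) \<Rightarrow> real^2 \<Rightarrow> ((torus \<Rightarrow> real) \<times> real) set" where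
  "rotation_constraints X F v =
    (\<Union>b\<in>X. {(\<lambda>p. u (b p) - u p, 0) | u. continuous_on UNIV u}) \<union> (\<Union>i. {(\<lambda>p. displacement F p $ i, v $ i)})"

lemma rotation_constraints_continuous:
  assumes X: "\<And>b. b \<in> X \<Longrightarrow> continuous_on UNIV b" and F: "is_lift f F" "hmat f = mat 1"
    and e: "(\<phi>, c) \<in> rotation_constraints X F v"
  shows "continuous_on UNIV \<phi>"
  using e unfolding rotation_constraints_def
proof (elim UnE UN_E)
  fix b assume b: "b \<in> X" "(\<phi>, c) \<in> {(\<lambda>p. u (b p) - u p, 0) | u. continuous_on UNIV u}"
  then obtain u where u: "continuous_on UNIV u" "\<phi> = (\<lambda>p. u (b p) - u p)" by blast
  show ?thesis
    unfolding u(2) by (intro continuous_on_diff u(1) continuous_on_compose2[OF u(1) X[OF b(1)]]) simp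
next
  fix i assume "(\<phi>, c) \<in> {(\<lambda>p. displacement F p $ i, v $ i)}"
  then show ?thesis
    using continuous_on_displacement[OF F] by (auto intro!: continuous_intros)
qed

lemma lin_meas_rotation_constraints:
  assumes X: "\<And>b. b \<in> X \<Longrightarrow> continuous_on UNIV b" and F: "is_lift f F" "hmat f = mat 1"
  shows "\<nu> \<in> lin_meas (rotation_constraints X F v) \<longleftrightarrow>
    torus_prob \<nu> \<and> (\<forall>b\<in>X. distr \<nu> borel b = \<nu>) \<and> rotation_vector \<nu> F = v"
proof (cases "torus_prob \<nu>")
  case prob: True
  have comp: "(\<integral>p. displacement F p $ i \<partial>\<nu>) = rotation_vector \<nu> F $ i" for i
    unfolding rotation_vector_def
    by (rule integral_bounded_linear[OF bounded_linear_vec_nth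
          torus_integrable[OF prob continuous_on_displacement[OF F]]])
  have inv: "distr \<nu> borel b = \<nu> \<longleftrightarrow>
      (\<forall>u :: torus \<Rightarrow> real. continuous_on UNIV u \<longrightarrow> (\<integral>p. u (b p) - u p \<partial>\<nu>) = 0)" if b: "b \<in> X" for b
  proof -
    have diff: "(\<integral>p. u (b p) - u p \<partial>\<nu>) = (\<integral>p. u p \<partial>distr \<nu> borel b) - (\<integral>p. u p \<partial>\<nu>)"
      if u: "continuous_on UNIV u" for u :: "torus \<Rightarrow> real"
    proof -
      have "continuous_on UNIV (\<lambda>p. u (b p))"
        by (rule continuous_on_compose2[OF u X[OF b]]) simp
      then show ?thesis
        by (simp add: torus_integrable[OF prob] u
            integral_distr_torus[OF torus_measurable[OF prob X[OF b]] u])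
    qed
    show ?thesis
    proof
      assume "distr \<nu> borel b = \<nu>"
      then show "\<forall>u :: torus \<Rightarrow> real. continuous_on UNIV u \<longrightarrow> (\<integral>p. u (b p) - u p \<partial>\<nu>) = 0"
        using diff by simp
    next
      assume zero: "\<forall>u :: torus \<Rightarrow> real. continuous_on UNIV u \<longrightarrow> (\<integral>p. u (b p) - u p \<partial>\<nu>) = 0"
      show "distr \<nu> borel b = \<nu>"
        by (rule torus_measure_eqI[OF torus_prob_distr[OF prob X[OF b]] prob])
          (use zero diff in force)
    qed
  qed
  have "\<nu> \<in> lin_meas (rotation_constraints X F v) \<longleftrightarrow>
      (\<forall>b\<in>X. \<forall>u :: torus \<Rightarrow> real. continuous_on UNIV u \<longrightarrow> (\<integral>p. u (b p) - u p \<partial>\<nu>) = 0)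
      \<and> (\<forall>i. (\<integral>p. displacement F p $ i \<partial>\<nu>) = v $ i)"
    using prob unfolding lin_meas_def rotation_constraints_def by (simp add: ball_Un) blast
  also have "\<dots> \<longleftrightarrow> (\<forall>b\<in>X. distr \<nu> borel b = \<nu>) \<and> rotation_vector \<nu> F = v"
    using inv by (simp add: comp vec_eq_iff)
  finally show ?thesis using prob by simp
qed (simp add: lin_meas_def)

lemma rotation_constraints_mono:
  "Y \<subseteq> Y' \<Longrightarrow> rotation_constraints Y F v \<subseteq> rotation_constraints Y' F v"
  unfolding rotation_constraints_def by (intro Un_mono UN_mono subset_refl)

text \<open>Each constraint mentions at most one map. In the finite intersection argument this
  reduces a whole layer to finitely many maps.\<close>

lemma rotation_constraints_finite:
  assumes "finite E" "E \<subseteq> rotation_constraints X F v"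
  obtains Y where "finite Y" "Y \<subseteq> X" "E \<subseteq> rotation_constraints Y F v"
proof -
  have "\<exists>Y. finite Y \<and> Y \<subseteq> X \<and> E \<subseteq> rotation_constraints Y F v"
    using assms
  proof (induction E rule: finite_induct)
    case empty
    show ?case by (rule exI[of _ "{}"]) simp
  next
    case (insert e E)
    then obtain Y where Y: "finite Y" "Y \<subseteq> X" "E \<subseteq> rotation_constraints Y F v" by auto
    have "e \<in> rotation_constraints X F v" using insert.prems by simp
    then consider b where "b \<in> X" "e \<in> rotation_constraints {b} F v" | "e \<in> rotation_constraints {} F v"
      unfolding rotation_constraints_def by blast
    then show ?case
    proof cases
      case 1
      then show ?thesis
        using Y rotation_constraints_mono[of Y "insert b Y" F v]
          rotation_constraints_mono[of "{b}" "insert b Y" F v]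
        by (intro exI[of _ "insert b Y"]) auto
    next
      case 2
      then show ?thesis using Y rotation_constraints_mono[of "{}" Y F v] by (intro exI[of _ Y]) auto
    qed
  qed
  then show thesis using that by blast
qed

section \<open>Layers of a nilpotent group of torus homeomorphisms\<close>

locale nilpotent_torus_group =
  fixes G :: "(torus \<Rightarrow> torus) set" and K :: "(torus \<Rightarrow> torus) monoid"
  assumes subgroup_G: "subgroup G Homeo_torus" and K_eq: "K = Homeo_torus\<lparr>carrier := G\<rparr>"
    and nilpotent: "nilpotent_group K"
begin

abbreviation iv :: "(torus \<Rightarrow> torus) \<Rightarrow> torus \<Rightarrow> torus" where
  "iv \<equiv> m_inv K"

lemma K_simps [simp]: "carrier K = G" "x \<otimes>\<^bsub>K\<^esub> y = x \<circ> y" "\<one>\<^bsub>K\<^esub> = id"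
  by (simp_all add: K_eq Homeo_torus_def)

lemma group_K: "group K"
  using nilpotent by (simp add: nilpotent_group_def)

lemma G_homeo: "f \<in> G \<Longrightarrow> homeomorphic_map euclidean euclidean f"
  using subgroup.subset[OF subgroup_G] by (auto simp: Homeo_torus_def)

lemma G_cont: "f \<in> G \<Longrightarrow> continuous_on UNIV f"
  using homeomorphic_imp_continuous_map[OF G_homeo] by simp

sublocale int_matrix_rep K hmat
  using group_K by (simp add: int_matrix_rep_def int_matrix_rep_axioms_def hmat_id hmat_compose G_cont)

lemma iv_closed: "f \<in> G \<Longrightarrow> iv f \<in> G"
  using inv_closed by simp

lemma comp_closed: "f \<in> G \<Longrightarrow> g \<in> G \<Longrightarrow> f \<circ> g \<in> G"
  using m_closed by simp

lemma hmat_comp: "f \<in> G \<Longrightarrow> g \<in> G \<Longrightarrow> hmat (f \<circ> g) = hmat f ** hmat g"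
  using hm_mult[of f g] by simp

lemma iv_comp: "f \<in> G \<Longrightarrow> f \<circ> iv f = id" "f \<in> G \<Longrightarrow> iv f \<circ> f = id"
  using r_inv[of f] l_inv[of f] by simp_all

lemma iv_apply: "f \<in> G \<Longrightarrow> f (iv f p) = p" "f \<in> G \<Longrightarrow> iv f (f p) = p"
  using iv_comp[of f] by (simp_all add: fun_eq_iff)

lemma iv_iv: "f \<in> G \<Longrightarrow> iv (iv f) = f"
  using inv_inv by simp

lemma kernel_subset: "congruence_kernel \<subseteq> G"
  by (auto simp: congruence_kernel_def)

lemma kernel_closed:
  "f \<in> congruence_kernel \<Longrightarrow> g \<in> congruence_kernel \<Longrightarrow> f \<circ> g \<in> congruence_kernel"
  "f \<in> congruence_kernel \<Longrightarrow> iv f \<in> congruence_kernel"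
  using normal_imp_subgroup[OF normal_congruence_kernel] subgroup.m_closed subgroup.m_inv_closed
  by fastforce+

lemma kernel_matrix:
  assumes "f \<in> congruence_kernel"
  shows "det (hmat f) = 1"
    "hmat f $ 1 $ 1 + hmat f $ 2 $ 2 = 2 \<or> 7 \<le> \<bar>hmat f $ 1 $ 1 + hmat f $ 2 $ 2\<bar>"
  using congruence_trace[of "hmat f"] hm_det[of f] assms by (auto simp: congruence_kernel_def residue_def)

lemma hmat_trivial_in_kernel: "f \<in> G \<Longrightarrow> hmat f = mat 1 \<Longrightarrow> f \<in> congruence_kernel"
  by (simp add: congruence_kernel_def residue_def mod3_one)

lemma hmat_iv: "f \<in> G \<Longrightarrow> hmat f ** hmat (iv f) = mat 1" "f \<in> G \<Longrightarrow> hmat (iv f) ** hmat f = mat 1"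
  using hm_inv[of f] hm_inv[of "iv f"] iv_closed[of f] iv_iv[of f] by simp_all

text \<open>The lower central series of \<open>G\<close> cut down to the congruence kernel: all
  matrices satisfy the trace condition, and commutators with kernel elements still descend by one
  layer.\<close>

definition layer :: "nat \<Rightarrow> (torus \<Rightarrow> torus) set" where
  "layer k = lower_central K k \<inter> congruence_kernel"

lemma layer_G: "f \<in> layer k \<Longrightarrow> f \<in> G"
  using kernel_subset by (auto simp: layer_def)

lemma layer_closed:
  assumes "f \<in> layer k"
  shows "g \<in> layer k \<Longrightarrow> f \<circ> g \<in> layer k" "iv f \<in> layer k"
proof -
  have sub: "subgroup (lower_central K k) K" using lower_central_props[OF group_K] by blast
  show "f \<circ> g \<in> layer k" if "g \<in> layer k"
    using subgroup.m_closed[OF sub, of f g] assms that kernel_closed(1) by (simp add: layer_def)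
  show "iv f \<in> layer k"
    using subgroup.m_inv_closed[OF sub, of f] assms kernel_closed(2) by (simp add: layer_def)
qed

lemma layer_antimono: "k \<le> m \<Longrightarrow> layer m \<subseteq> layer k"
  using lower_central_antimono[OF group_K] by (auto simp: layer_def)

lemma layer_zero: "layer 0 = congruence_kernel"
  using kernel_subset by (auto simp: layer_def)

lemma kernel_commutator:
  assumes "x \<in> congruence_kernel" "a \<in> congruence_kernel"
  shows "iv x \<circ> iv a \<circ> x \<circ> a \<in> congruence_kernel"
  using assms by (intro kernel_closed)

lemma layer_commutator:
  assumes x: "x \<in> congruence_kernel" and a: "a \<in> layer k"
  shows "iv x \<circ> iv a \<circ> x \<circ> a \<in> layer (Suc k)"
proof -
  have G: "x \<in> G" "a \<in> G" using x a kernel_subset layer_G by auto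
  have "iv x \<circ> iv a \<circ> iv (iv x) \<circ> iv (iv a) \<in> lower_central K (Suc k)"
    using lower_central_commutator[of "iv x" K "iv a" k] iv_closed[OF G(1)] layer_closed(2)[OF a]
    by (simp add: layer_def del: lower_central.simps)
  then show ?thesis
    using kernel_commutator[OF x] a G iv_iv by (simp add: layer_def del: lower_central.simps)
qed

text \<open>The roles are exchanged by inversion, the inverse of a commutator being the commutator
  in the other order.\<close>

lemma layer_commutator':
  assumes x: "x \<in> layer k" and a: "a \<in> congruence_kernel"
  shows "iv x \<circ> iv a \<circ> x \<circ> a \<in> layer (Suc k)"
proof -
  have G: "x \<in> G" "a \<in> G" using x a kernel_subset layer_G by auto
  have "iv (iv a \<circ> iv x \<circ> a \<circ> x) \<in> layer (Suc k)"
    by (rule layer_closed(2)[OF layer_commutator[OF a x]])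
  moreover have "iv (iv a \<circ> iv x \<circ> a \<circ> x) = iv x \<circ> iv a \<circ> x \<circ> a"
  proof -
    have "(iv x \<circ> iv a \<circ> x \<circ> a) \<circ> (iv a \<circ> iv x \<circ> a \<circ> x) = id"
      using G by (simp add: fun_eq_iff iv_apply)
    then show ?thesis
      using inv_equality[of "iv x \<circ> iv a \<circ> x \<circ> a" "iv a \<circ> iv x \<circ> a \<circ> x"] G
      by (simp add: comp_closed iv_closed)
  qed
  ultimately show ?thesis by simp
qed

lemma hmat_commutator:
  assumes "x \<in> G" "a \<in> G" "hmat x = mat 1"
  shows "hmat (iv x \<circ> iv a \<circ> x \<circ> a) = mat 1"
proof -
  have "hmat (iv x) = mat 1" using hmat_iv(2)[OF assms(1)] assms(3) by simp
  then show ?thesis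
    using assms hmat_iv(2)[OF assms(2)] by (simp add: hmat_comp comp_closed iv_closed)
qed

lemma commutator_intertwine:
  assumes "x \<in> G" "a \<in> G"
  shows "x \<circ> a = a \<circ> (x \<circ> (iv x \<circ> iv a \<circ> x \<circ> a))"
  using assms by (simp add: fun_eq_iff iv_apply)

text \<open>Invariance under \<open>\<phi>\<close> is a separate condition, because
  \<open>\<phi>\<close> lies in the kernel but not necessarily in \<open>layer k\<close>.\<close>

definition layer_measures :: "(torus \<Rightarrow> torus) \<Rightarrow> nat \<Rightarrow> torus measure set" where
  "layer_measures \<phi> k = {\<nu>. torus_prob \<nu> \<and> distr \<nu> borel \<phi> = \<nu> \<and> (\<forall>b\<in>layer k. distr \<nu> borel b = \<nu>)}"

text \<open>\<open>x\<close> after \<open>a\<close> equals \<open>a\<close> after \<open>x\<close>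
  and a commutator from the next layer, and both of the latter preserve
  \<open>\<nu>\<close>.\<close>

lemma push_invariant:
  assumes \<nu>: "torus_prob \<nu>" "\<And>b. b \<in> layer (Suc k) \<Longrightarrow> distr \<nu> borel b = \<nu>"
    and a: "a \<in> layer k" and x: "x \<in> congruence_kernel" "distr \<nu> borel x = \<nu>"
  shows "distr (distr \<nu> borel a) borel x = distr \<nu> borel a"
proof -
  let ?c = "iv x \<circ> iv a \<circ> x \<circ> a"
  have c: "?c \<in> layer (Suc k)" by (rule layer_commutator[OF x(1) a])
  have G: "x \<in> G" "a \<in> G" using x a kernel_subset layer_G by auto
  show ?thesis
  proof (rule distr_intertwine[OF \<nu>(1) G_cont[OF G(2)] G_cont[OF G(1)] _ commutator_intertwine[OF G]])
    show "continuous_on UNIV (x \<circ> ?c)" by (intro G_cont comp_closed G layer_G[OF c])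
    show "distr \<nu> borel (x \<circ> ?c) = \<nu>"
      using distr_compose_torus[OF \<nu>(1) G_cont[OF layer_G[OF c]] G_cont[OF G(1)]] \<nu>(2)[OF c] x(2) by simp
  qed
qed

lemma layer_measures_push:
  assumes "\<phi> \<in> congruence_kernel" "\<nu> \<in> layer_measures \<phi> (Suc k)" "a \<in> layer k"
  shows "distr \<nu> borel a \<in> layer_measures \<phi> (Suc k)"
proof -
  have \<nu>: "torus_prob \<nu>" "\<And>b. b \<in> layer (Suc k) \<Longrightarrow> distr \<nu> borel b = \<nu>" "distr \<nu> borel \<phi> = \<nu>"
    using assms(2) by (auto simp: layer_measures_def)
  have "distr (distr \<nu> borel a) borel b = distr \<nu> borel a" if b: "b \<in> layer (Suc k)" for b
    by (rule push_invariant[OF \<nu>(1,2) assms(3) _ \<nu>(2)[OF b]], assumption) (use b in \<open>simp add: layer_def\<close>)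
  then show ?thesis
    using push_invariant[OF \<nu>(1,2) assms(3,1) \<nu>(3)] torus_prob_distr[OF \<nu>(1) G_cont[OF layer_G[OF assms(3)]]]
    by (simp add: layer_measures_def)
qed

text \<open>The index \<open>i\<close> of the commutator's layer is left open to serve two cases:
  \<open>x\<close> in a deep layer, where the commutator descends because of \<open>x\<close>, and
  \<open>x = \<phi>\<close>, where it descends because of \<open>a\<close>.\<close>

lemma layer_rotation_step:
  assumes \<phi>: "\<phi> \<in> congruence_kernel" and a: "a \<in> layer k"
    and x: "x \<in> congruence_kernel" "hmat x = mat 1"
      "\<And>\<nu>. \<nu> \<in> layer_measures \<phi> (Suc k) \<Longrightarrow> distr \<nu> borel x = \<nu>"
    and c: "iv x \<circ> iv a \<circ> x \<circ> a \<in> layer i" "Suc k \<le> i"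
    and IH: "\<And>\<nu> c E. c \<in> layer i \<Longrightarrow> hmat c = mat 1 \<Longrightarrow> \<nu> \<in> layer_measures \<phi> (Suc k) \<Longrightarrow>
      is_lift c E \<Longrightarrow> rotation_vector (distr \<nu> borel a) E = rotation_vector \<nu> E"
    and \<nu>: "\<nu> \<in> layer_measures \<phi> (Suc k)" and E: "is_lift x E"
  shows "rotation_vector (distr \<nu> borel a) E = rotation_vector \<nu> E"
proof -
  let ?c = "iv x \<circ> iv a \<circ> x \<circ> a"
  have G: "x \<in> G" "a \<in> G" "a \<in> congruence_kernel" using x(1) a kernel_subset layer_G by (auto simp: layer_def)
  have hc: "hmat ?c = mat 1" by (rule hmat_commutator[OF G(1,2) x(2)])
  show ?thesis
  proof (rule rotation_vector_invariant_step[where S = "layer_measures \<phi> (Suc k)" and \<psi>' = "iv a" and \<theta> = "iv x"])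
    show "torus_prob \<nu>" if "\<nu> \<in> layer_measures \<phi> (Suc k)" for \<nu>
      using that by (simp add: layer_measures_def)
    show "continuous_on UNIV a" "continuous_on UNIV (iv a)" "continuous_on UNIV x" "continuous_on UNIV (iv x)"
      "continuous_on UNIV ?c"
      by (intro G_cont iv_closed comp_closed G)+
    show "a \<circ> iv a = id" "x \<circ> iv x = id" by (rule iv_comp(1), rule G)+
    show "x \<circ> a = a \<circ> (x \<circ> ?c)" by (rule commutator_intertwine[OF G(1,2)])
    show "distr \<nu> borel a \<in> layer_measures \<phi> (Suc k)" "distr \<nu> borel (iv a) \<in> layer_measures \<phi> (Suc k)"
      if "\<nu> \<in> layer_measures \<phi> (Suc k)" for \<nu>
      by (rule layer_measures_push[OF \<phi> that], rule a layer_closed(2)[OF a])+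
    show "distr \<nu> borel ?c = \<nu>" if "\<nu> \<in> layer_measures \<phi> (Suc k)" for \<nu>
      using that c layer_antimono[OF c(2)] by (auto simp: layer_measures_def)
    show "rotation_vector (distr \<nu> borel a) E' = rotation_vector \<nu> E'"
      if "\<nu> \<in> layer_measures \<phi> (Suc k)" "is_lift ?c E'" for \<nu> E'
      by (rule IH[OF c(1) hc that])
  qed (use x hc \<nu> E kernel_matrix[OF G(3)] in auto)
qed

text \<open>Induction from the deep end of the series: the commutator of \<open>x\<close> and
  \<open>a\<close> lies one layer deeper, so its rotation vectors are already known not to
  change.\<close>

lemma layer_rotation:
  assumes \<phi>: "\<phi> \<in> congruence_kernel" and a: "a \<in> layer k" and i: "Suc k \<le> i"
    and x: "x \<in> layer i" "hmat x = mat 1"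
    and \<nu>: "\<nu> \<in> layer_measures \<phi> (Suc k)" and E: "is_lift x E"
  shows "rotation_vector (distr \<nu> borel a) E = rotation_vector \<nu> E"
proof -
  obtain n where n: "lower_central K n = {id}"
    using nilpotent by (auto simp: nilpotent_group_def)
  show ?thesis
    using i x \<nu> E
  proof (induction "n - i" arbitrary: i x \<nu> E)
    \<comment> \<open>At or beyond the trivial term \<open>x\<close> is the identity, whose lifts
      are translations with the same rotation vector for every measure.\<close>
    case 0
    then have "x \<in> layer n" using layer_antimono[of n i] by auto
    then have x: "x = id" using n by (simp add: layer_def)
    have prob: "torus_prob \<nu>" using 0 by (simp add: layer_measures_def)
    show ?case
      using rotation_vector_id[OF prob 0(6)[unfolded x]]
        rotation_vector_id[OF torus_prob_distr[OF prob G_cont[OF layer_G[OF a]]] 0(6)[unfolded x]] by simp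
  next
    case (Suc m)
    have ak: "a \<in> congruence_kernel" "x \<in> congruence_kernel" using a Suc.prems by (auto simp: layer_def)
    show ?case
    proof (rule layer_rotation_step[OF \<phi> a ak(2) Suc.prems(3) _ layer_commutator'[OF Suc.prems(2) ak(1)]])
      show "distr \<nu> borel x = \<nu>" if "\<nu> \<in> layer_measures \<phi> (Suc k)" for \<nu>
        using that Suc.prems(2) layer_antimono[OF Suc.prems(1)] by (auto simp: layer_measures_def)
      show "Suc k \<le> Suc i" using Suc.prems(1) by simp
      show "rotation_vector (distr \<nu> borel a) E = rotation_vector \<nu> E"
        if "c \<in> layer (Suc i)" "hmat c = mat 1" "\<nu> \<in> layer_measures \<phi> (Suc k)" "is_lift c E" for \<nu> c E
        by (rule Suc.hyps(1)[OF _ _ that]) (use Suc.hyps(2) Suc.prems(1) in simp_all)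
    qed (use Suc.prems in simp_all)
  qed
qed

lemma layer_rotation_base:
  assumes \<phi>: "\<phi> \<in> congruence_kernel" "hmat \<phi> = mat 1" "is_lift \<phi> \<Phi>"
    and a: "a \<in> layer k" and \<nu>: "\<nu> \<in> layer_measures \<phi> (Suc k)"
  shows "rotation_vector (distr \<nu> borel a) \<Phi> = rotation_vector \<nu> \<Phi>"
  by (rule layer_rotation_step[OF \<phi>(1) a \<phi>(1,2) _ layer_commutator[OF \<phi>(1) a] _ _ \<nu> \<phi>(3)])
    (auto simp: layer_measures_def intro: layer_rotation[OF \<phi>(1) a])

text \<open>Modulo \<open>layer (Suc k)\<close> the elements of \<open>layer k\<close> commute with
  the kernel, so on measures invariant under the deeper layer they act as commuting maps, as
  Markov-Kakutani requires.\<close>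

lemma layer_descend:
  assumes \<phi>: "\<phi> \<in> congruence_kernel" "hmat \<phi> = mat 1" "is_lift \<phi> \<Phi>"
    and ne: "\<exists>\<nu>\<in>layer_measures \<phi> (Suc k). rotation_vector \<nu> \<Phi> = v"
  shows "\<exists>\<nu>\<in>layer_measures \<phi> k. rotation_vector \<nu> \<Phi> = v"
proof -
  have cont: "continuous_on UNIV b" if "b \<in> insert \<phi> (layer k)" for b
    using that \<phi>(1) kernel_subset by (auto intro: G_cont layer_G)
  have mem: "\<nu> \<in> lin_meas (rotation_constraints X \<Phi> v) \<longleftrightarrow>
      torus_prob \<nu> \<and> (\<forall>b\<in>X. distr \<nu> borel b = \<nu>) \<and> rotation_vector \<nu> \<Phi> = v"
    if "X \<subseteq> insert \<phi> (layer k)" for X \<nu>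
    by (rule lin_meas_rotation_constraints[OF _ \<phi>(3,2)]) (use cont that in blast)
  have suc: "layer (Suc k) \<subseteq> layer k" by (rule layer_antimono) simp
  \<comment> \<open>Maps are adjoined one at a time. Pushing by the new map keeps the invariances
    already imposed by \<open>push_invariant\<close> and the rotation vector by
    \<open>layer_rotation_base\<close>, so a fixed measure exists among the admissible ones.\<close>
  have finite_ne: "lin_meas (rotation_constraints (insert \<phi> (layer (Suc k)) \<union> Y) \<Phi> v) \<noteq> {}"
    if "finite Y" "Y \<subseteq> layer k" for Y
    using that
  proof (induction Y rule: finite_induct)
    case empty
    obtain \<nu> where "\<nu> \<in> layer_measures \<phi> (Suc k)" "rotation_vector \<nu> \<Phi> = v" using ne by blast
    then have "\<nu> \<in> lin_meas (rotation_constraints (insert \<phi> (layer (Suc k))) \<Phi> v)"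
      using mem[of "insert \<phi> (layer (Suc k))"] suc by (auto simp: layer_measures_def)
    then show ?case by auto
  next
    case (insert a Y)
    let ?X = "insert \<phi> (layer (Suc k)) \<union> Y"
    have a: "a \<in> layer k" and Y: "Y \<subseteq> layer k" using insert.prems by auto
    have X: "?X \<subseteq> insert \<phi> (layer k)" "?X \<subseteq> congruence_kernel"
      using Y suc \<phi>(1) by (auto simp: layer_def)
    obtain \<mu> where \<mu>: "\<mu> \<in> lin_meas (rotation_constraints ?X \<Phi> v)" "distr \<mu> borel a = \<mu>"
    proof (rule lin_meas_fixed_point)
      show "lin_meas (rotation_constraints ?X \<Phi> v) \<noteq> {}" using insert.IH Y by blast
      show "continuous_on UNIV u" if "(u, c) \<in> rotation_constraints ?X \<Phi> v" for u c
        by (rule rotation_constraints_continuous[OF _ \<phi>(3,2) that]) (use cont X(1) in blast)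
      show "continuous_on UNIV a" by (rule G_cont[OF layer_G[OF a]])
      fix \<nu> assume "\<nu> \<in> lin_meas (rotation_constraints ?X \<Phi> v)"
      then have \<nu>: "torus_prob \<nu>" "\<And>b. b \<in> ?X \<Longrightarrow> distr \<nu> borel b = \<nu>" "rotation_vector \<nu> \<Phi> = v"
        using mem[OF X(1)] by auto
      have "\<nu> \<in> layer_measures \<phi> (Suc k)" using \<nu> by (simp add: layer_measures_def)
      then have "rotation_vector (distr \<nu> borel a) \<Phi> = v"
        using layer_rotation_base[OF \<phi> a] \<nu>(3) by simp
      moreover have "distr (distr \<nu> borel a) borel b = distr \<nu> borel a" if b: "b \<in> ?X" for b
        by (rule push_invariant[OF \<nu>(1) _ a _ \<nu>(2)[OF b]]) (use \<nu>(2) b X(2) in auto)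
      ultimately show "distr \<nu> borel a \<in> lin_meas (rotation_constraints ?X \<Phi> v)"
        using mem[OF X(1)] torus_prob_distr[OF \<nu>(1) G_cont[OF layer_G[OF a]]] by blast
    qed
    have "\<mu> \<in> lin_meas (rotation_constraints (insert \<phi> (layer (Suc k)) \<union> insert a Y) \<Phi> v)"
      using \<mu> mem[OF X(1)] mem[of "insert \<phi> (layer (Suc k)) \<union> insert a Y"] X(1) a by auto
    then show ?case by blast
  qed
  have "lin_meas (rotation_constraints (insert \<phi> (layer k)) \<Phi> v) \<noteq> {}"
  proof (rule lin_meas_finite_intersection)
    show "continuous_on UNIV u" if "(u, c) \<in> rotation_constraints (insert \<phi> (layer k)) \<Phi> v" for u c
      by (rule rotation_constraints_continuous[OF _ \<phi>(3,2) that]) (use cont in blast)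
    fix \<E>' assume "\<E>' \<subseteq> rotation_constraints (insert \<phi> (layer k)) \<Phi> v" "finite \<E>'"
    from rotation_constraints_finite[OF this(2,1)]
    obtain Y where Y: "finite Y" "Y \<subseteq> insert \<phi> (layer k)" "\<E>' \<subseteq> rotation_constraints Y \<Phi> v"
      by blast
    \<comment> \<open>\<open>\<phi>\<close> may occur in \<open>Y\<close> without lying in
      \<open>layer k\<close>; it belongs to the fixed part of the constraints anyway.\<close>
    define Y' where "Y' = Y - {\<phi>}"
    have Y': "finite Y'" "Y' \<subseteq> layer k" "Y \<subseteq> insert \<phi> (layer (Suc k)) \<union> Y'" using Y by (auto simp: Y'_def)
    then obtain \<nu> where \<nu>: "\<nu> \<in> lin_meas (rotation_constraints (insert \<phi> (layer (Suc k)) \<union> Y') \<Phi> v)"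
      using finite_ne by blast
    moreover have "\<E>' \<subseteq> rotation_constraints (insert \<phi> (layer (Suc k)) \<union> Y') \<Phi> v"
      using Y(3) rotation_constraints_mono[OF Y'(3)] by (rule subset_trans)
    ultimately have "\<nu> \<in> lin_meas \<E>'" using lin_meas_antimono by blast
    then show "lin_meas \<E>' \<noteq> {}" by blast
  qed
  then obtain \<nu> where "\<nu> \<in> lin_meas (rotation_constraints (insert \<phi> (layer k)) \<Phi> v)" by blast
  then have "\<nu> \<in> layer_measures \<phi> k \<and> rotation_vector \<nu> \<Phi> = v"
    using mem[of "insert \<phi> (layer k)"] by (simp add: layer_measures_def)
  then show ?thesis by blast
qed

lemma rotation_realized:
  assumes \<phi>: "\<phi> \<in> G" "hmat \<phi> = mat 1" "is_lift \<phi> \<Phi>" and \<mu>: "\<mu> \<in> inv_measures \<phi>"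
  shows "\<exists>\<nu>\<in>common_inv_measures congruence_kernel. rotation_vector \<nu> \<Phi> = rotation_vector \<mu> \<Phi>"
proof -
  have \<phi>K: "\<phi> \<in> congruence_kernel" by (rule hmat_trivial_in_kernel[OF \<phi>(1,2)])
  obtain n where n: "lower_central K n = {id}"
    using nilpotent by (auto simp: nilpotent_group_def)
  let ?v = "rotation_vector \<mu> \<Phi>"
  have "\<exists>\<nu>\<in>layer_measures \<phi> (n - m). rotation_vector \<nu> \<Phi> = ?v" for m
  proof (induction m)
    case 0
    \<comment> \<open>The deepest layer is trivial, so invariance under \<open>\<phi>\<close> alone
      suffices to start.\<close>
    have "\<mu> \<in> layer_measures \<phi> n"
      using \<mu> n distr_id_torus by (auto simp: layer_measures_def layer_def inv_measures_iff)
    then show ?case by auto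
  next
    case (Suc m)
    show ?case
    proof (cases "m < n")
      case True
      then have eq: "n - m = Suc (n - Suc m)" by simp
      show ?thesis by (rule layer_descend[OF \<phi>K \<phi>(2,3) Suc[unfolded eq]])
    qed (use Suc in simp)
  qed
  from this[of n] obtain \<nu> where \<nu>: "\<nu> \<in> layer_measures \<phi> 0" "rotation_vector \<nu> \<Phi> = ?v" by auto
  then have "\<nu> \<in> common_inv_measures congruence_kernel"
    by (auto simp: layer_measures_def layer_zero common_inv_measures_def inv_measures_iff)
  then show ?thesis using \<nu>(2) by blast
qed

section \<open>Consequences for maps isotopic to the identity\<close>

lemma isotopic_part_kernel: "isotopic_part G \<subseteq> congruence_kernel"
  using hmat_isotopic hmat_trivial_in_kernel by (auto simp: isotopic_part_def)

lemma isotopic_part_eq: "isotopic_part congruence_kernel = isotopic_part G"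
  using isotopic_part_kernel kernel_subset by (auto simp: isotopic_part_def)

lemma isotopicD: "\<phi> \<in> isotopic_part G \<Longrightarrow> \<phi> \<in> G \<and> hmat \<phi> = mat 1"
  using hmat_isotopic by (auto simp: isotopic_part_def)

lemma rotation_sets_eq:
  assumes \<phi>: "\<phi> \<in> isotopic_part G" and \<Phi>: "is_lift \<phi> \<Phi>"
  shows "{rotation_vector \<mu> \<Phi> | \<mu>. \<mu> \<in> inv_measures \<phi>}
    = {rotation_vector \<nu> \<Phi> | \<nu>. \<nu> \<in> common_inv_measures congruence_kernel}" (is "?L = ?R")
proof
  show "?L \<subseteq> ?R" using rotation_realized[OF _ _ \<Phi>] isotopicD[OF \<phi>] by (smt (verit) Collect_mono_iff)
  show "?R \<subseteq> ?L" using isotopic_part_kernel \<phi> by (auto simp: common_inv_measures_def)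
qed

text \<open>The set depends on the group only through its isotopic part, each map being tested on
  its own invariant measures.\<close>

lemma irrotational_eq: "irrotational G = irrotational congruence_kernel"
  by (simp add: irrotational_def isotopic_part_eq)

lemma common_irrotational_eq: "irrotational congruence_kernel = common_irrotational congruence_kernel"
proof -
  have "(\<forall>\<mu>\<in>inv_measures f. rotation_vector \<mu> F = 0) \<longleftrightarrow>
      (\<forall>\<nu>\<in>common_inv_measures congruence_kernel. rotation_vector \<nu> F = 0)"
    if "f \<in> isotopic_part G" "is_lift f F" for f F
  proof -
    have "(\<forall>\<mu>\<in>M. rotation_vector \<mu> F = 0) \<longleftrightarrow> {rotation_vector \<mu> F | \<mu>. \<mu> \<in> M} \<subseteq> {0}" for M
      by auto
    then show ?thesis using rotation_sets_eq[OF that] by simp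
  qed
  then show ?thesis
    unfolding irrotational_def common_irrotational_def isotopic_part_eq by blast
qed

lemma common_inv_measuresD:
  assumes "\<nu> \<in> common_inv_measures congruence_kernel"
  shows "torus_prob \<nu>" "f \<in> isotopic_part G \<Longrightarrow> distr \<nu> borel f = \<nu>"
proof -
  \<comment> \<open>A member of the kernel makes the intersection defining the common measures
    proper; over an empty family it would contain every measure.\<close>
  have "id \<in> congruence_kernel"
    using hmat_trivial_in_kernel[OF _ hmat_id] one_closed by simp
  then show "torus_prob \<nu>" using assms by (auto simp: common_inv_measures_def inv_measures_iff)
  show "distr \<nu> borel f = \<nu>" if "f \<in> isotopic_part G"
    using that assms isotopic_part_kernel by (auto simp: common_inv_measures_def inv_measures_iff)
qed

text \<open>Here all maps are tested on the same measures, on which the rotation vector is additive.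
  This form yields the closure under composition and inverses.\<close>

lemma irrotational_iff:
  "f \<in> irrotational G \<longleftrightarrow> f \<in> isotopic_part G \<and>
    (\<exists>F. is_lift f F \<and> (\<forall>\<nu>\<in>common_inv_measures congruence_kernel. rotation_vector \<nu> F = 0))"
  unfolding irrotational_eq common_irrotational_eq common_irrotational_def isotopic_part_eq by simp

lemma subgroup_irrotational: "subgroup (irrotational G) K"
proof (rule subgroupI)
  show "irrotational G \<subseteq> carrier K" by (auto simp: irrotational_def isotopic_part_def)
  have "id \<in> irrotational G"
  proof -
    have "rotation_vector \<nu> id = 0" if "\<nu> \<in> common_inv_measures congruence_kernel" for \<nu>
      using rotation_vector_id[OF common_inv_measuresD(1)[OF that] is_lift_id] by simp
    moreover have "id \<in> isotopic_part G"
      using one_closed isotopic_to_id_id by (simp add: isotopic_part_def)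
    ultimately show ?thesis unfolding irrotational_iff using is_lift_id by blast
  qed
  then show "irrotational G \<noteq> {}" by blast
next
  fix f assume "f \<in> irrotational G"
  then obtain F where f: "f \<in> isotopic_part G" and F: "is_lift f F"
    and zero: "\<And>\<nu>. \<nu> \<in> common_inv_measures congruence_kernel \<Longrightarrow> rotation_vector \<nu> F = 0"
    unfolding irrotational_iff by blast
  have fG: "f \<in> G" "hmat f = mat 1" using isotopicD[OF f] by auto
  have ivf: "iv f \<in> isotopic_part G"
    using isotopic_to_id_inverse[OF _ G_homeo[OF iv_closed[OF fG(1)]] iv_comp(1)[OF fG(1)]] f iv_closed[OF fG(1)]
    by (simp add: isotopic_part_def)
  have hiv: "hmat (iv f) = mat 1" using isotopicD[OF ivf] by simp
  have "is_lift (f \<circ> iv f) id" using iv_comp(1)[OF fG(1)] is_lift_id by simp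
  then obtain F' where F': "is_lift (iv f) F'" "\<And>x. F (F' x) = id x"
    using lift_factor[OF G_cont[OF fG(1)] G_cont[OF iv_closed[OF fG(1)]] iv_comp(1)[OF fG(1)]
        G_cont[OF iv_closed[OF fG(1)]] F] by blast
  have "rotation_vector \<nu> F' = 0" if \<nu>: "\<nu> \<in> common_inv_measures congruence_kernel" for \<nu>
  proof -
    have "rotation_vector \<nu> (F \<circ> F') = rotation_vector \<nu> F + rotation_vector \<nu> F'"
      by (rule rotation_vector_compose[OF common_inv_measuresD(1)[OF \<nu>] common_inv_measuresD(2)[OF \<nu> ivf]
            G_cont[OF iv_closed[OF fG(1)]] F fG(2) F'(1) hiv])
    moreover have "F \<circ> F' = id" using F'(2) by (simp add: fun_eq_iff)
    ultimately show ?thesis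
      using zero[OF \<nu>] rotation_vector_id[OF common_inv_measuresD(1)[OF \<nu>] is_lift_id] by simp
  qed
  then show "iv f \<in> irrotational G" unfolding irrotational_iff using ivf F'(1) by blast
next
  fix f g assume "f \<in> irrotational G" "g \<in> irrotational G"
  then obtain F E where f: "f \<in> isotopic_part G" and F: "is_lift f F"
    and g: "g \<in> isotopic_part G" and E: "is_lift g E"
    and zero: "\<And>\<nu>. \<nu> \<in> common_inv_measures congruence_kernel \<Longrightarrow> rotation_vector \<nu> F = 0"
      "\<And>\<nu>. \<nu> \<in> common_inv_measures congruence_kernel \<Longrightarrow> rotation_vector \<nu> E = 0"
    unfolding irrotational_iff by blast
  have fg: "f \<circ> g \<in> isotopic_part G"
    using f g isotopic_to_id_compose comp_closed by (simp add: isotopic_part_def)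
  have "rotation_vector \<nu> (F \<circ> E) = 0" if \<nu>: "\<nu> \<in> common_inv_measures congruence_kernel" for \<nu>
    using rotation_vector_compose[OF common_inv_measuresD(1)[OF \<nu>] common_inv_measuresD(2)[OF \<nu> g] _ F _ E]
      zero[OF \<nu>] isotopicD[OF f] isotopicD[OF g] G_cont by simp
  then show "f \<otimes>\<^bsub>K\<^esub> g \<in> irrotational G"
    unfolding irrotational_iff using fg is_lift_compose[OF F E] by auto
qed

text \<open>Here each map is tested on its own invariant measures. Pushing by the inverse of
  \<open>g\<close> carries measures invariant under the conjugate to measures invariant under
  \<open>f\<close>, and changes rotation vectors by an invertible matrix, so \<open>g\<close> may be
  any element of \<open>G\<close>.\<close>

lemma irrotational_conjugate:
  assumes g: "g \<in> G" and f: "f \<in> irrotational G"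
  shows "g \<circ> f \<circ> iv g \<in> irrotational G"
proof -
  obtain F where fi: "f \<in> isotopic_part G" and F: "is_lift f F"
    and zero: "\<And>\<mu>. \<mu> \<in> inv_measures f \<Longrightarrow> rotation_vector \<mu> F = 0"
    using f by (auto simp: irrotational_def)
  have fG: "f \<in> G" "hmat f = mat 1" using isotopicD[OF fi] by auto
  define z where "z = g \<circ> f \<circ> iv g"
  have z: "z \<in> isotopic_part G"
    using isotopic_to_id_conjugate[OF _ G_homeo[OF g] G_homeo[OF iv_closed[OF g]] iv_comp(1)[OF g]] fi g
    by (simp add: isotopic_part_def z_def comp_closed iv_closed)
  have zG: "z \<in> G" "hmat z = mat 1" using isotopicD[OF z] by auto
  have ig: "iv g \<in> G" by (rule iv_closed[OF g])
  have eq: "f \<circ> iv g = iv g \<circ> z" using g by (simp add: z_def fun_eq_iff iv_apply)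
  obtain \<Theta> where \<Theta>: "is_lift (iv g) \<Theta>" using lift_exists[OF G_cont[OF ig]] .
  have "is_lift (iv g \<circ> z) (F \<circ> \<Theta>)" using is_lift_compose[OF F \<Theta>] eq by simp
  then obtain Z where Z: "is_lift z Z" "\<And>x. \<Theta> (Z x) = (F \<circ> \<Theta>) x"
    using lift_factor[OF G_cont[OF ig] G_cont[OF g] iv_comp(2)[OF g] G_cont[OF zG(1)] \<Theta>] by blast
  have "rotation_vector \<mu> Z = 0" if \<mu>: "\<mu> \<in> inv_measures z" for \<mu>
  proof -
    have prob: "torus_prob \<mu>" and inv: "distr \<mu> borel z = \<mu>" using \<mu> by (auto simp: inv_measures_iff)
    have "distr \<mu> borel (iv g) \<in> inv_measures f"
      using distr_intertwine[OF prob G_cont[OF ig] G_cont[OF fG(1)] G_cont[OF zG(1)] eq inv]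
        torus_prob_distr[OF prob G_cont[OF ig]] by (simp add: inv_measures_iff)
    then have "rmat (hmat (iv g)) *v rotation_vector \<mu> Z = 0"
      using rotation_vector_conjugate[OF prob inv G_cont[OF ig] G_cont[OF zG(1)] \<Theta> F fG(2) Z(1) zG(2)]
        Z(2) zero by simp
    then have "rmat (hmat g) *v (rmat (hmat (iv g)) *v rotation_vector \<mu> Z) = 0" by simp
    then show ?thesis
      using hmat_iv(1)[OF g] by (simp add: matrix_vector_mul_assoc rmat_mult[symmetric] rmat_one)
  qed
  then show ?thesis using z Z(1) by (auto simp: irrotational_def z_def)
qed

lemma normal_irrotational: "irrotational G \<lhd> K"
  using subgroup_irrotational irrotational_conjugate by (simp add: normal_inv_iff)

end

theorem proposition4p8:
  fixes G :: "(torus \<Rightarrow> torus) set"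
  assumes "subgroup G Homeo_torus"
    and "nilpotent_group (Homeo_torus\<lparr>carrier := G\<rparr>)"
  shows "(\<exists>H. H \<lhd> Homeo_torus\<lparr>carrier := G\<rparr>
            \<and> finite (rcosets\<^bsub>Homeo_torus\<lparr>carrier := G\<rparr>\<^esub> H)
            \<and> card (rcosets\<^bsub>Homeo_torus\<lparr>carrier := G\<rparr>\<^esub> H) \<in> {1, 2, 3, 4, 6, 8}
            \<and> isotopic_part G \<subseteq> H
            \<and> (\<forall>\<phi>\<in>isotopic_part G. \<forall>\<Phi>. is_lift \<phi> \<Phi> \<longrightarrow>
                  {rotation_vector \<mu> \<Phi> | \<mu>. \<mu> \<in> inv_measures \<phi>}
                  = {rotation_vector \<nu> \<Phi> | \<nu>. \<nu> \<in> common_inv_measures H})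
            \<and> irrotational G = irrotational H
            \<and> irrotational H = common_irrotational H)
         \<and> irrotational G \<lhd> Homeo_torus\<lparr>carrier := G\<rparr>"
proof -
  interpret nilpotent_torus_group G "Homeo_torus\<lparr>carrier := G\<rparr>"
    using assms by (simp add: nilpotent_torus_group_def)
  show ?thesis
    using normal_congruence_kernel index_congruence_kernel[OF nilpotent] isotopic_part_kernel
      rotation_sets_eq irrotational_eq common_irrotational_eq normal_irrotational by blast
qed

end
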